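(* Let $k$ be a field of odd characteristic $p$, let $n\in\mathbb{N}_0$, let $(\alpha|\beta)$ be a pair of compositions with $|\alpha|+|\beta|=n$, and let $s=\ell(\beta)$. For each $1\le i\le s$, write $\beta_i=p\eta_i+r_i$ with integers $\eta_i\ge 0$ and $0\le r_i\le p-1$, and let $r=\sum_{i=1}^sr_i$. Let $\lambda$ be the partition obtained by rearranging the parts of the concatenation $\alpha\#(1^r)$, and let $\mu$ be the partition obtained by rearranging $(\eta_1,\ldots,\eta_s)$ (discarding zeros). (i) The signed Young permutation module $M(\alpha|\beta)$ has the summand $Y(\lambda|p\mu)$ with $(M(\alpha|\beta):Y(\lambda|p\mu))=1$ and, if $Y(\delta|p\theta)$ is a summand of $M(\alpha|\beta)$, then $(\delta|p\theta)\unrhd(\lambda|p\mu)$. (ii) The mixed power $K^{\alpha|\beta}E$ has the summand $\mathrm{List}^{\lambda|p\mu}E$ with $(K^{\alpha|\beta}E:\mathrm{List}^{\lambda|p\mu}E)=1$ and, if $\mathrm{List}^{\delta|p\theta}E$ is a summand of $K^{\alpha|\beta}E$, then $(\delta|p\theta)\unrhd(\lambda|p\mu)$.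
   Context: $\mathbb{N}$ denotes the positive integers and $\mathbb{N}_0$ the non-negative integers. Compositions and partitions. A composition of $n\in\mathbb{N}_0$ is a finite sequence $\lambda=(\lambda_1,\ldots,\lambda_r)$ of positive integers with sum $n$; write $|\lambda|=n$, $\ell(\lambda)=r$; the unique composition of $0$ is $\varnothing$. It is a partition if $\lambda_1\ge\cdots\ge\lambda_r$. $(1^r)$ is the partition with $r$ parts equal to $1$; $p\mu=(p\mu_1,p\mu_2,\ldots)$; $\#$ is concatenation. $\mathscr{P}^2_p(n)$ is the set of pairs $(\lambda|p\mu)$ with $\lambda,\mu$ partitions and $|\lambda|+p|\mu|=n$. Dominance order on $\mathscr{P}^2_p(n)$: $(\lambda|p\mu)\unrhd(\delta|p\xi)$ if for all $\ell\in\mathbb{N}$ both $\sum_{i=1}^\ell\lambda_i\ge\sum_{i=1}^\ell\delta_i$ and $|\lambda|+p\sum_{i=1}^\ell\mu_i\ge|\delta|+p\sum_{i=1}^\ell\xi_i$ (parts beyond the length are $0$); $\rhd$ means $\unrhd$ and $\neq$. Signed Young permutation modules. For a composition $\alpha$, $\mathfrak{S}_\alpha=\mathfrak{S}_{\alpha_1}\times\mathfrak{S}_{\alpha_2}\times\cdots$ is the Young subgroup, and $k(\alpha)$, $\mathrm{sgn}(\alpha)$ are the restrictions to $\mathfrak{S}_\alpha$ of the trivial and sign representations over $k$ of $\mathfrak{S}_{|\alpha|}$. For compositions $\alpha,\beta$ with $|\alpha|+|\beta|=n$, $M(\alpha|\beta)=\mathrm{Ind}_{\mathfrak{S}_\alpha\times\mathfrak{S}_\beta}^{\mathfrak{S}_n}(k(\alpha)\boxtimes\mathrm{sgn}(\beta))$.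 Signed Young modules. By a theorem of Donkin, the isomorphism classes of indecomposable summands of the modules $M(\alpha|\beta)$, $|\alpha|+|\beta|=n$, are parametrised by $\mathscr{P}^2_p(n)$: they are the pairwise non-isomorphic modules $Y(\lambda|p\mu)$, $(\lambda|p\mu)\in\mathscr{P}^2_p(n)$, determined by the property that $Y(\lambda|p\mu)$ is a summand of $M(\lambda|p\mu)$ with multiplicity one and every other indecomposable summand of $M(\lambda|p\mu)$ is isomorphic to some $Y(\delta|p\theta)$ with $(\delta|p\theta)\rhd(\lambda|p\mu)$. $(M(\alpha|\beta):Y(\delta|p\theta))$ is the multiplicity of $Y(\delta|p\theta)$ as a direct summand of $M(\alpha|\beta)$. Mixed powers. For $r\in\mathbb{N}$, $\mathrm{S}(\infty,r)$ is the $k$-algebra with basis $\{\xi_f\}$ indexed by the orbits $f$ of the diagonal place-permutation action of $\mathfrak{S}_r$ on $\mathbb{N}^r\times\mathbb{N}^r$, with $\xi_g\xi_h=\sum_f(\lambda^f_{g,h}\cdot1_k)\xi_f$, where, for any fixed $(\mathbf{p},\mathbf{q})\in f$, $\lambda^f_{g,h}=|\{\mathbf{j}\in\mathbb{N}^r:(\mathbf{p},\mathbf{j})\in g,\ (\mathbf{j},\mathbf{q})\in h\}|$; $\mathrm{S}(\infty,0)=k$ and $\mathrm{S}(\infty)=\bigoplus_{r\ge0}\mathrm{S}(\infty,r)$. It has a comultiplication $\Delta(\xi_f)=\sum_{f=g\#h}\xi_g\otimes\xi_h$, where $g\#h$ is the orbit of the concatenation $(\mathbf{i}\#\mathbf{p},\mathbf{j}\#\mathbf{q})$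 of $(\mathbf{i},\mathbf{j})\in g$ and $(\mathbf{p},\mathbf{q})\in h$; so the tensor product over $k$ of an $\mathrm{S}(\infty,r)$-module and an $\mathrm{S}(\infty,s)$-module is an $\mathrm{S}(\infty,r+s)$-module. $E$ is the natural $\mathrm{S}(\infty,1)$-module with $k$-basis $\{e_i:i\in\mathbb{N}\}$ and $\xi_fe_j=e_i$ if $f=\{(i,j)\}$ and $0$ otherwise. $S^rE$ and $\bigwedge^rE$ are the $r$th symmetric and exterior powers (both $k$ for $r=0$), $S^\alpha E=S^{\alpha_1}E\otimes S^{\alpha_2}E\otimes\cdots$, $\bigwedge^\beta E=\bigwedge^{\beta_1}E\otimes\bigwedge^{\beta_2}E\otimes\cdots$, and $K^{\alpha|\beta}E=S^\alpha E\otimes\bigwedge^\beta E$, an $\mathrm{S}(\infty,|\alpha|+|\beta|)$-module. Listing modules. By Donkin, the isomorphism classes of indecomposable summands of the mixed powers for $\mathrm{S}(\infty,n)$ are parametrised by $\mathscr{P}^2_p(n)$: they are the pairwise non-isomorphic modules $\mathrm{List}^{\lambda|p\mu}E$, determined by the property that $\mathrm{List}^{\lambda|p\mu}E$ is a summand of $K^{\lambda|p\mu}E$ with multiplicity one and every other indecomposable summand of $K^{\lambda|p\mu}E$ is isomorphic to some $\mathrm{List}^{\delta|p\theta}E$ with $(\delta|p\theta)\rhd(\lambda|p\mu)$. $(K^{\alpha|\beta}E:\mathrm{List}^{\delta|p\theta}E)$ is the multiplicity of $\mathrm{List}^{\delta|p\theta}E$ as a direct summand of $K^{\alpha|\beta}E$.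 *)

theory Defs
  imports
    "HOL-Library.Function_Algebras"
    "HOL-Library.Extended_Nat"
    "HOL-Computational_Algebra.Computational_Algebra"
    "HOL-Combinatorics.Permutations"
    "HOL-Algebra.Sym_Groups"
begin

section \<open>Compositions, partitions, dominance\<close>

definition composition :: "nat list \<Rightarrow> bool" where
  "composition \<alpha> \<longleftrightarrow> (\<forall>a\<in>set \<alpha>. 0 < a)"

definition is_partition :: "nat list \<Rightarrow> bool" where
  "is_partition \<alpha> \<longleftrightarrow> composition \<alpha> \<and> sorted_wrt (\<ge>) \<alpha>"

text \<open>The pair \<open>(\<lambda>, \<mu>)\<close> stands for \<open>(\<lambda>|p\<mu>)\<close>; the second component is not multiplied by \<open>p\<close>.\<close>

definition partition_pairs :: "nat \<Rightarrow> nat \<Rightarrow> (nat list \<times> nat list) set" where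
  "partition_pairs p n =
     {(la, mu). is_partition la \<and> is_partition mu \<and> sum_list la + p * sum_list mu = n}"

definition dominates :: "nat \<Rightarrow> nat list \<times> nat list \<Rightarrow> nat list \<times> nat list \<Rightarrow> bool" where
  "dominates p x y \<longleftrightarrow> (\<forall>l\<ge>1.
     sum_list (take l (fst x)) \<ge> sum_list (take l (fst y)) \<and>
     sum_list (fst x) + p * sum_list (take l (snd x))
       \<ge> sum_list (fst y) + p * sum_list (take l (snd y)))"

definition strictly_dominates :: "nat \<Rightarrow> nat list \<times> nat list \<Rightarrow> nat list \<times> nat list \<Rightarrow> bool" where
  "strictly_dominates p x y \<longleftrightarrow> dominates p x y \<and> x \<noteq> y"


section \<open>Modules\<close>

text \<open>
  A module is a subspace of a space of \<open>k\<close>-valued functions on a type (with pointwise addition and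
  scalar multiplication) on which elements of some set \<open>A\<close> act \<open>k\<close>-linearly. Every vector space
  is isomorphic to such a subspace. The set \<open>A\<close> is a group (a module is then a representation over
  \<open>k\<close>) or the algebra \<open>S(\<infinity>,n)\<close>.
\<close>

definition fscale :: "'k::field \<Rightarrow> ('x \<Rightarrow> 'k) \<Rightarrow> ('x \<Rightarrow> 'k)" where
  "fscale c v = (\<lambda>x. c * v x)"

interpretation fun_space: vector_space fscale
  by unfold_locales (auto simp: fscale_def fun_eq_iff algebra_simps)

record ('k, 'a, 'x) kmodule =
  mod_carrier :: "('x \<Rightarrow> 'k) set"
  mod_act :: "'a \<Rightarrow> ('x \<Rightarrow> 'k) \<Rightarrow> ('x \<Rightarrow> 'k)"

definition linear_action :: "'a set \<Rightarrow> ('k::field, 'a, 'x) kmodule \<Rightarrow> bool" where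
  "linear_action A M \<longleftrightarrow>
     fun_space.subspace (mod_carrier M) \<and>
     (\<forall>a\<in>A. \<forall>u\<in>mod_carrier M. mod_act M a u \<in> mod_carrier M) \<and>
     (\<forall>a\<in>A. \<forall>u\<in>mod_carrier M. \<forall>v\<in>mod_carrier M.
        mod_act M a (u + v) = mod_act M a u + mod_act M a v) \<and>
     (\<forall>a\<in>A. \<forall>c. \<forall>u\<in>mod_carrier M. mod_act M a (fscale c u) = fscale c (mod_act M a u))"

definition submodule_of :: "'a set \<Rightarrow> ('k::field, 'a, 'x) kmodule \<Rightarrow> ('x \<Rightarrow> 'k) set \<Rightarrow> bool" where
  "submodule_of A M U \<longleftrightarrow>
     fun_space.subspace U \<and> U \<subseteq> mod_carrier M \<and> (\<forall>a\<in>A. \<forall>u\<in>U. mod_act M a u \<in> U)"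

definition mod_restrict :: "('k, 'a, 'x) kmodule \<Rightarrow> ('x \<Rightarrow> 'k) set \<Rightarrow> ('k, 'a, 'x) kmodule" where
  "mod_restrict M U = M\<lparr>mod_carrier := U\<rparr>"

definition mod_iso ::
  "'a set \<Rightarrow> ('k::field, 'a, 'x) kmodule \<Rightarrow> ('k, 'a, 'y) kmodule \<Rightarrow> bool" where
  "mod_iso A M N \<longleftrightarrow> (\<exists>\<phi>.
     bij_betw \<phi> (mod_carrier M) (mod_carrier N) \<and>
     (\<forall>u\<in>mod_carrier M. \<forall>v\<in>mod_carrier M. \<phi> (u + v) = \<phi> u + \<phi> v) \<and>
     (\<forall>c. \<forall>u\<in>mod_carrier M. \<phi> (fscale c u) = fscale c (\<phi> u)) \<and>
     (\<forall>a\<in>A. \<forall>u\<in>mod_carrier M. \<phi> (mod_act M a u) = mod_act N a (\<phi> u)))"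

definition direct_summand :: "'a set \<Rightarrow> ('k::field, 'a, 'x) kmodule \<Rightarrow> ('x \<Rightarrow> 'k) set \<Rightarrow> bool" where
  "direct_summand A M U \<longleftrightarrow> submodule_of A M U \<and>
     (\<exists>C. submodule_of A M C \<and> U \<inter> C = {0} \<and> mod_carrier M = {u + c | u c. u \<in> U \<and> c \<in> C})"

definition indecomposable :: "'a set \<Rightarrow> ('k::field, 'a, 'x) kmodule \<Rightarrow> bool" where
  "indecomposable A M \<longleftrightarrow> mod_carrier M \<noteq> {0} \<and>
     (\<forall>U. direct_summand A M U \<longrightarrow> U = {0} \<or> U = mod_carrier M)"

definition has_summand ::
  "'a set \<Rightarrow> ('k::field, 'a, 'x) kmodule \<Rightarrow> ('k, 'a, 'y) kmodule \<Rightarrow> bool" where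
  "has_summand A M N \<longleftrightarrow> (\<exists>U. direct_summand A M U \<and> mod_iso A (mod_restrict M U) N)"

text \<open>\<open>M\<close> has a direct summand that is the internal direct sum of \<open>m\<close> submodules isomorphic
  to \<open>N\<close>.\<close>

definition has_summand_copies ::
  "'a set \<Rightarrow> ('k::field, 'a, 'x) kmodule \<Rightarrow> ('k, 'a, 'y) kmodule \<Rightarrow> nat \<Rightarrow> bool" where
  "has_summand_copies A M N m \<longleftrightarrow> (\<exists>W.
     (\<forall>i<m. submodule_of A M (W i) \<and> mod_iso A (mod_restrict M (W i)) N) \<and>
     (\<forall>w. (\<forall>i<m. w i \<in> W i) \<and> (\<Sum>i<m. w i) = 0 \<longrightarrow> (\<forall>i<m. w i = 0)) \<and>
     direct_summand A M {\<Sum>i<m. w i | w. \<forall>i<m. w i \<in> W i})"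

text \<open>The multiplicity of \<open>N\<close> as a direct summand of \<open>M\<close>: the largest \<open>m\<close> such that the direct sum
  of \<open>m\<close> copies of \<open>N\<close> is a direct summand of \<open>M\<close>.\<close>

definition multiplicity_in ::
  "'a set \<Rightarrow> ('k::field, 'a, 'x) kmodule \<Rightarrow> ('k, 'a, 'y) kmodule \<Rightarrow> enat" where
  "multiplicity_in A M N = Sup (enat ` {m. has_summand_copies A M N m})"

text \<open>
  The family \<open>Z (\<lambda>, \<mu>)\<close>, \<open>(\<lambda>|p\<mu>)\<close> of degree \<open>n\<close>, represents without repetition the isomorphism
  classes of indecomposable summands of the modules \<open>K \<alpha> \<beta>\<close>, \<open>|\<alpha>| + |\<beta>| = n\<close>, labelled by the
  triangularity property with respect to dominance.
\<close>

definition labels_summands :: "nat \<Rightarrow> nat \<Rightarrow> 'a set \<Rightarrow>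
    (nat list \<Rightarrow> nat list \<Rightarrow> ('k::field, 'a, 'x) kmodule) \<Rightarrow>
    (nat list \<times> nat list \<Rightarrow> ('k, 'a, 'y) kmodule) \<Rightarrow> bool" where
  "labels_summands p n A K Z \<longleftrightarrow>
     (\<forall>x\<in>partition_pairs p n. indecomposable A (Z x)) \<and>
     (\<forall>x\<in>partition_pairs p n. \<forall>y\<in>partition_pairs p n. mod_iso A (Z x) (Z y) \<longrightarrow> x = y) \<and>
     (\<forall>\<alpha> \<beta> U. composition \<alpha> \<and> composition \<beta> \<and> sum_list \<alpha> + sum_list \<beta> = n \<and>
        direct_summand A (K \<alpha> \<beta>) U \<and> indecomposable A (mod_restrict (K \<alpha> \<beta>) U) \<longrightarrow>
        (\<exists>x\<in>partition_pairs p n. mod_iso A (mod_restrict (K \<alpha> \<beta>) U) (Z x))) \<and>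
     (\<forall>(la, mu)\<in>partition_pairs p n.
        let M = K la (map ((*) p) mu) in
        multiplicity_in A M (Z (la, mu)) = 1 \<and>
        (\<forall>U. direct_summand A M U \<and> indecomposable A (mod_restrict M U) \<and>
             \<not> mod_iso A (mod_restrict M U) (Z (la, mu)) \<longrightarrow>
          (\<exists>x\<in>partition_pairs p n. strictly_dominates p x (la, mu) \<and>
             mod_iso A (mod_restrict M U) (Z x))))"


section \<open>Signed Young permutation modules and signed Young modules\<close>

definition group_module :: "('g, 'm) monoid_scheme \<Rightarrow> ('k::field, 'g, 'x) kmodule \<Rightarrow> bool" where
  "group_module G M \<longleftrightarrow> linear_action (carrier G) M \<and>
     (\<forall>u\<in>mod_carrier M. mod_act M \<one>\<^bsub>G\<^esub> u = u) \<and>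
     (\<forall>g\<in>carrier G. \<forall>h\<in>carrier G. \<forall>u\<in>mod_carrier M.
        mod_act M (g \<otimes>\<^bsub>G\<^esub> h) u = mod_act M g (mod_act M h u))"

text \<open>
  The representation of a finite group \<open>G\<close> induced from the one-dimensional representation of the
  subgroup \<open>H\<close> with character \<open>\<chi>\<close>. In terms of \<open>kG \<otimes>\<^bsub>kH\<^esub> k\<^sub>\<chi>\<close>, the element \<open>g \<otimes> 1\<close> is the function
  supported on \<open>gH\<close> with value \<open>\<chi>(h)\<^sup>-\<^sup>1\<close> at \<open>gh\<close>.
\<close>

definition induced_module ::
  "('g, 'm) monoid_scheme \<Rightarrow> 'g set \<Rightarrow> ('g \<Rightarrow> 'k::field) \<Rightarrow> ('k, 'g, 'g) kmodule" where
  "induced_module G H \<chi> = \<lparr>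
     mod_carrier = {\<phi>. (\<forall>g. g \<notin> carrier G \<longrightarrow> \<phi> g = 0) \<and>
       (\<forall>g\<in>carrier G. \<forall>h\<in>H. \<phi> (g \<otimes>\<^bsub>G\<^esub> h) = inverse (\<chi> h) * \<phi> g)},
     mod_act = (\<lambda>g \<phi> x. if x \<in> carrier G then \<phi> (inv\<^bsub>G\<^esub> g \<otimes>\<^bsub>G\<^esub> x) else 0)\<rparr>"

definition young_block :: "nat list \<Rightarrow> nat \<Rightarrow> nat set" where
  "young_block \<gamma> i = {sum_list (take i \<gamma>) + 1 .. sum_list (take (Suc i) \<gamma>)}"

definition young_subgroup :: "nat list \<Rightarrow> (nat \<Rightarrow> nat) set" where
  "young_subgroup \<gamma> = {\<sigma>. \<sigma> permutes {1..sum_list \<gamma>} \<and>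
     (\<forall>i<length \<gamma>. \<sigma> ` young_block \<gamma> i = young_block \<gamma> i)}"

text \<open>\<open>\<SS>\<^sub>\<alpha> \<times> \<SS>\<^sub>\<beta>\<close> is the Young subgroup of the concatenation; on it, \<open>k(\<alpha>) \<boxtimes> sgn(\<beta>)\<close> is the sign of
  the permutation of the last \<open>|\<beta>|\<close> points.\<close>

definition signed_perm_module ::
  "nat list \<Rightarrow> nat list \<Rightarrow> ('k::field, nat \<Rightarrow> nat, nat \<Rightarrow> nat) kmodule" where
  "signed_perm_module \<alpha> \<beta> = (let n = sum_list \<alpha> + sum_list \<beta> in
     induced_module (sym_group n) (young_subgroup (\<alpha> @ \<beta>))
       (\<lambda>\<sigma>. of_int (sign_on {sum_list \<alpha> + 1 .. n} \<sigma>)))"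

text \<open>A choice of representatives \<open>Y(\<lambda>|p\<mu>)\<close> of the isomorphism classes of the signed Young modules
  of all symmetric groups, with the labelling of Donkin's theorem.\<close>

definition signed_young_modules ::
  "nat \<Rightarrow> (nat list \<times> nat list \<Rightarrow> ('k::field, nat \<Rightarrow> nat, 'y) kmodule) \<Rightarrow> bool" where
  "signed_young_modules p Y \<longleftrightarrow> (\<forall>n.
     (\<forall>x\<in>partition_pairs p n. group_module (sym_group n) (Y x)) \<and>
     labels_summands p n (carrier (sym_group n)) signed_perm_module Y)"


section \<open>The algebra \<open>S(\<infinity>)\<close>\<close>

type_synonym word_orbit = "(nat list \<times> nat list) set"

definition words :: "nat \<Rightarrow> nat list set" where
  "words r = {i. length i = r \<and> (\<forall>x\<in>set i. 1 \<le> x)}"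

definition orbit_of :: "nat list \<Rightarrow> nat list \<Rightarrow> word_orbit" where
  "orbit_of i j = {(permute_list \<sigma> i, permute_list \<sigma> j) | \<sigma>. \<sigma> permutes {..<length i}}"

definition word_orbits :: "nat \<Rightarrow> word_orbit set" where
  "word_orbits r = {orbit_of i j | i j. i \<in> words r \<and> j \<in> words r}"

text \<open>Elements of \<open>S(\<infinity>)\<close> are given by their coefficients with respect to the \<open>\<xi>\<^sub>f\<close>.\<close>

definition schur_algebra :: "nat \<Rightarrow> (word_orbit \<Rightarrow> 'k::field) set" where
  "schur_algebra r = {a. finite {f. a f \<noteq> 0} \<and> {f. a f \<noteq> 0} \<subseteq> word_orbits r}"

definition structure_constant :: "word_orbit \<Rightarrow> word_orbit \<Rightarrow> word_orbit \<Rightarrow> nat" where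
  "structure_constant g h f =
     (let (p, q) = (SOME x. x \<in> f) in card {j. (p, j) \<in> g \<and> (j, q) \<in> h})"

definition schur_mult ::
  "(word_orbit \<Rightarrow> 'k::field) \<Rightarrow> (word_orbit \<Rightarrow> 'k) \<Rightarrow> (word_orbit \<Rightarrow> 'k)" where
  "schur_mult a b = (\<lambda>f. if f \<in> (\<Union>r. word_orbits r)
     then \<Sum>g | a g \<noteq> 0. \<Sum>h | b h \<noteq> 0. a g * b h * of_nat (structure_constant g h f) else 0)"

definition schur_module ::
  "nat \<Rightarrow> ('k::field, word_orbit \<Rightarrow> 'k, 'x) kmodule \<Rightarrow> bool" where
  "schur_module r M \<longleftrightarrow> linear_action (schur_algebra r) M \<and>
     (\<forall>a\<in>schur_algebra r. \<forall>b\<in>schur_algebra r. \<forall>u\<in>mod_carrier M.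
        mod_act M (a + b) u = mod_act M a u + mod_act M b u \<and>
        mod_act M (schur_mult a b) u = mod_act M a (mod_act M b u)) \<and>
     (\<forall>a\<in>schur_algebra r. \<forall>c. \<forall>u\<in>mod_carrier M.
        mod_act M (fscale c a) u = fscale c (mod_act M a u))"

text \<open>The orbit \<open>g # h\<close>; all members of the union coincide.\<close>

definition orbit_append :: "word_orbit \<Rightarrow> word_orbit \<Rightarrow> word_orbit" where
  "orbit_append g h = (\<Union>(i, j)\<in>g. \<Union>(p, q)\<in>h. orbit_of (i @ p) (j @ q))"


section \<open>Mixed powers and listing modules\<close>

text \<open>
  All modules in the construction of the mixed powers come with a basis, so it is enough to record
  the vectors \<open>\<xi>\<^sub>f b\<close> for \<open>b\<close> in the basis. An \<open>S(\<infinity>,r)\<close>-module is regarded as an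
  \<open>S(\<infinity>)\<close>-module on which the other components act as zero.
\<close>

record ('k, 'x) based_module =
  basis :: "'x set"
  basis_act :: "word_orbit \<Rightarrow> 'x \<Rightarrow> ('x \<Rightarrow> 'k)"

definition unit_fun :: "'x \<Rightarrow> ('x \<Rightarrow> 'k::field)" where
  "unit_fun x = (\<lambda>y. if y = x then 1 else 0)"

definition linear_extension :: "('x \<Rightarrow> ('y \<Rightarrow> 'k::field)) \<Rightarrow> ('x \<Rightarrow> 'k) \<Rightarrow> ('y \<Rightarrow> 'k)" where
  "linear_extension F v = (\<Sum>x | v x \<noteq> 0. fscale (v x) (F x))"

definition module_of_based ::
  "('k::field, 'x) based_module \<Rightarrow> ('k, word_orbit \<Rightarrow> 'k, 'x) kmodule" where
  "module_of_based B = \<lparr>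
     mod_carrier = {v. finite {x. v x \<noteq> 0} \<and> {x. v x \<noteq> 0} \<subseteq> basis B},
     mod_act = (\<lambda>a v. linear_extension (\<lambda>f. linear_extension (basis_act B f) v) a)\<rparr>"

definition natural_module :: "('k::field, nat) based_module" where
  "natural_module = \<lparr>
     basis = {1..},
     basis_act = (\<lambda>f j i. if f = {([i], [j])} then 1 else 0)\<rparr>"

text \<open>The \<open>S(\<infinity>,0)\<close>-module \<open>k\<close>, with basis the empty tensor.\<close>

definition unit_module :: "('k::field, 'x list) based_module" where
  "unit_module = \<lparr>
     basis = {[]},
     basis_act = (\<lambda>f b. if f = {([], [])} then unit_fun b else 0)\<rparr>"

text \<open>
  \<open>V \<otimes> T\<close>, where the basis of \<open>T\<close> consists of lists: the basis vector \<open>x \<otimes> t\<close> is the list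
  \<open>x # t\<close>. The action is through the comultiplication
  \<open>\<Delta>(\<xi>\<^sub>f) = \<Sum>\<^bsub>f = g # h\<^esub> \<xi>\<^sub>g \<otimes> \<xi>\<^sub>h\<close>.
\<close>

definition pure_tensor :: "('x \<Rightarrow> 'k::field) \<Rightarrow> ('x list \<Rightarrow> 'k) \<Rightarrow> ('x list \<Rightarrow> 'k)" where
  "pure_tensor v t = (\<lambda>z. case z of [] \<Rightarrow> 0 | x # xs \<Rightarrow> v x * t xs)"

definition tensor_module ::
  "('k::field, 'x) based_module \<Rightarrow> ('k, 'x list) based_module \<Rightarrow> ('k, 'x list) based_module" where
  "tensor_module V T = \<lparr>
     basis = {x # xs | x xs. x \<in> basis V \<and> xs \<in> basis T},
     basis_act = (\<lambda>f z. case z of [] \<Rightarrow> 0 | x # xs \<Rightarrow>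
       (\<Sum>(g, h) | g \<in> (\<Union>r. word_orbits r) \<and> h \<in> (\<Union>r. word_orbits r) \<and> orbit_append g h = f.
          pure_tensor (basis_act V g x) (basis_act T h xs)))\<rparr>"

definition tensor_list :: "('k::field, 'x) based_module list \<Rightarrow> ('k, 'x list) based_module" where
  "tensor_list Vs = foldr tensor_module Vs unit_module"

definition tensor_power :: "nat \<Rightarrow> ('k::field, nat list) based_module" where
  "tensor_power r = tensor_list (replicate r natural_module)"

text \<open>
  \<open>S\<^sup>r E\<close> and \<open>\<And>\<^sup>r E\<close> are quotients of the tensor power. A basis of the former consists of the monomials
  in the \<open>e\<^sub>i\<close> with weakly increasing indices, one of the latter of the wedge products with strictly
  increasing indices; such an element is encoded by its word of indices. The next functions give the
  images under the quotient maps of the basis vector of the tensor power that belongs to an arbitrary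
  word. The actions are the ones that the quotient maps induce.
\<close>

definition sym_monomial :: "nat list \<Rightarrow> (nat list \<Rightarrow> 'k::field)" where
  "sym_monomial i = unit_fun (sort i)"

definition inversions :: "nat list \<Rightarrow> nat" where
  "inversions i = card {(a, b). a < b \<and> b < length i \<and> i ! a > i ! b}"

definition wedge_monomial :: "nat list \<Rightarrow> (nat list \<Rightarrow> 'k::field)" where
  "wedge_monomial i = (if distinct i then fscale ((- 1) ^ inversions i) (unit_fun (sort i)) else 0)"

definition sym_power :: "nat \<Rightarrow> ('k::field, nat list) based_module" where
  "sym_power r = \<lparr>
     basis = {i \<in> words r. sorted i},
     basis_act = (\<lambda>f j. linear_extension sym_monomial (basis_act (tensor_power r) f j))\<rparr>"

definition ext_power :: "nat \<Rightarrow> ('k::field, nat list) based_module" where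
  "ext_power r = \<lparr>
     basis = {i \<in> words r. sorted i \<and> distinct i},
     basis_act = (\<lambda>f j. linear_extension wedge_monomial (basis_act (tensor_power r) f j))\<rparr>"

definition mixed_power ::
  "nat list \<Rightarrow> nat list \<Rightarrow> ('k::field, word_orbit \<Rightarrow> 'k, nat list list) kmodule" where
  "mixed_power \<alpha> \<beta> = module_of_based (tensor_list (map sym_power \<alpha> @ map ext_power \<beta>))"

text \<open>A choice of representatives \<open>List\<^bsup>\<lambda>|p\<mu>\<^esup>E\<close> of the isomorphism classes of the listing modules of
  all degrees, with the labelling of Donkin's theorem.\<close>

definition listing_modules ::
  "nat \<Rightarrow> (nat list \<times> nat list \<Rightarrow> ('k::field, word_orbit \<Rightarrow> 'k, 'l) kmodule) \<Rightarrow> bool" where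
  "listing_modules p L \<longleftrightarrow> (\<forall>n.
     (\<forall>x\<in>partition_pairs p n. schur_module n (L x)) \<and>
     labels_summands p n (schur_algebra n) mixed_power L)"

end

theory Submission
  imports Defs
begin

text \<open>
  Both families of modules are quotients of a space spanned by words, the permutations of \<open>{1..n}\<close> or
  the words in \<open>\<nat>\<close>, by the relations that transposing two positions of the same block multiplies a
  word by \<open>1\<close> or \<open>-1\<close>. Linear combinations of permutations of the positions give homomorphisms between
  these quotients, and the two cases can be treated at once.

  If \<open>p\<close> does not divide \<open>m + 1\<close>, the Koszul identity exhibits the module of \<open>(\<alpha>|\<dots>,m + 1,\<dots>)\<close> as a
  retract of the module of \<open>(\<alpha>,1|\<dots>,m,\<dots>)\<close> whose complement is a retract of the module of
  \<open>(\<alpha>,2|\<dots>,m - 1,\<dots>)\<close>. Iterating, the module of \<open>(\<alpha>|\<beta>)\<close> is a retract of the one of \<open>(\<lambda>|p\<mu>)\<close>, which gives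
  everything except that the summand labelled \<open>(\<lambda>|p\<mu>)\<close> survives. Its endomorphism ring is local by a
  Fitting argument, so in each step it lies in the retract or in the complement; the labels occurring in
  the complement dominate a pair whose first partition has larger excess \<open>\<Sum>(\<lambda>\<^sub>i - 1)\<close>, so that
  \<open>(\<lambda>|p\<mu>)\<close> is not among them.
\<close>

section \<open>Homomorphisms, retracts and multiplicities\<close>

text \<open>The obstacle is that mixed powers of positive degree are infinite-dimensional, since
  \<open>E\<close> has a basis indexed by all positive integers, and that the algebra then has no
  unit. Neither finite length nor a Krull-Schmidt theorem is at hand. Two substitutes carry the
  argument. Multiplicities are compared only through retracts: a split injection carries copies of a
  summand to copies of a summand, so the multiplicity 1 in the module of (\<lambda>|p\<mu>) bounds
  the multiplicity in every retract of it. Fitting's lemma is proved pointwise: each vector is fixed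
  by an element of \<open>A\<close> whose image on the whole module lies in a finite-dimensional
  space, and this bounds the length of relations between powers of an endomorphism. The steps end at
  p\<mu> because a part m + 1 is lowered as long as m + 1 is nonzero in the field. Lowering it keeps
  the quotient by p and trades one unit of the residue for a new part 1, so the label is the same
  before and after. Odd characteristic enters through the exterior powers: a word with a repeated
  letter satisfies G w = - G w, which has to force G w = 0.\<close>

definition mod_hom ::
  "'a set \<Rightarrow> ('k::field, 'a, 'x) kmodule \<Rightarrow> ('k, 'a, 'y) kmodule \<Rightarrow> (('x \<Rightarrow> 'k) \<Rightarrow> ('y \<Rightarrow> 'k)) \<Rightarrow> bool" where
  "mod_hom A M N f \<longleftrightarrow>
     (\<forall>u\<in>mod_carrier M. f u \<in> mod_carrier N) \<and>
     (\<forall>u\<in>mod_carrier M. \<forall>v\<in>mod_carrier M. f (u + v) = f u + f v) \<and>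
     (\<forall>c. \<forall>u\<in>mod_carrier M. f (fscale c u) = fscale c (f u)) \<and>
     (\<forall>a\<in>A. \<forall>u\<in>mod_carrier M. f (mod_act M a u) = mod_act N a (f u))"

text \<open>Takes the place of \<open>has_summand\<close> in the proof: retracts compose, and no
  complement has to be carried along.\<close>

definition retract_of ::
  "'a set \<Rightarrow> ('k::field, 'a, 'x) kmodule \<Rightarrow> ('k, 'a, 'y) kmodule \<Rightarrow> bool" where
  "retract_of A N M \<longleftrightarrow> (\<exists>i r. mod_hom A N M i \<and> mod_hom A M N r \<and> (\<forall>u\<in>mod_carrier N. r (i u) = u))"

lemma linear_actionD:
  assumes "linear_action A M"
  shows "0 \<in> mod_carrier M"
    and "u \<in> mod_carrier M \<Longrightarrow> v \<in> mod_carrier M \<Longrightarrow> u + v \<in> mod_carrier M"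
    and "u \<in> mod_carrier M \<Longrightarrow> v \<in> mod_carrier M \<Longrightarrow> u - v \<in> mod_carrier M"
    and "u \<in> mod_carrier M \<Longrightarrow> fscale c u \<in> mod_carrier M"
    and "a \<in> A \<Longrightarrow> u \<in> mod_carrier M \<Longrightarrow> mod_act M a u \<in> mod_carrier M"
    and "a \<in> A \<Longrightarrow> u \<in> mod_carrier M \<Longrightarrow> v \<in> mod_carrier M \<Longrightarrow>
      mod_act M a (u + v) = mod_act M a u + mod_act M a v"
    and "a \<in> A \<Longrightarrow> u \<in> mod_carrier M \<Longrightarrow> mod_act M a (fscale c u) = fscale c (mod_act M a u)"
  using assms unfolding linear_action_def
  by (auto intro: fun_space.subspace_0 fun_space.subspace_add fun_space.subspace_diff
      fun_space.subspace_scale)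

lemma mod_homD:
  assumes "mod_hom A M N f"
  shows "u \<in> mod_carrier M \<Longrightarrow> f u \<in> mod_carrier N"
    and "u \<in> mod_carrier M \<Longrightarrow> v \<in> mod_carrier M \<Longrightarrow> f (u + v) = f u + f v"
    and "u \<in> mod_carrier M \<Longrightarrow> f (fscale c u) = fscale c (f u)"
    and "a \<in> A \<Longrightarrow> u \<in> mod_carrier M \<Longrightarrow> f (mod_act M a u) = mod_act N a (f u)"
  using assms unfolding mod_hom_def by auto

lemma fscale_0_left [simp]: "fscale 0 v = 0"
  by (simp add: fscale_def fun_eq_iff)

lemma fscale_1_left [simp]: "fscale 1 v = v"
  by (simp add: fscale_def fun_eq_iff)

lemma fscale_0_right [simp]: "fscale c 0 = 0"
  by (simp add: fscale_def fun_eq_iff)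

lemma mod_hom_zero:
  assumes "mod_hom A M N f" "linear_action A M"
  shows "f 0 = 0"
  using mod_homD(3)[OF assms(1) linear_actionD(1)[OF assms(2)], of 0] by simp

lemma mod_hom_diff:
  assumes f: "mod_hom A M N f" and M: "linear_action A M"
    and u: "u \<in> mod_carrier M" and v: "v \<in> mod_carrier M"
  shows "f (u - v) = f u - f v"
proof -
  have "f (u - v) + f v = f (u - v + v)"
    using mod_homD(2)[OF f linear_actionD(3)[OF M u v] v] by simp
  then show ?thesis by (simp add: algebra_simps)
qed

lemma linear_action_sum:
  assumes "linear_action A M" "\<And>i. i \<in> I \<Longrightarrow> w i \<in> mod_carrier M"
  shows "(\<Sum>i\<in>I. w i) \<in> mod_carrier M"
  using assms unfolding linear_action_def by (auto intro: fun_space.subspace_sum)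

lemma mod_hom_sum:
  assumes f: "mod_hom A M N f" and M: "linear_action A M"
    and "\<And>i. i \<in> I \<Longrightarrow> w i \<in> mod_carrier M"
  shows "f (\<Sum>i\<in>I. w i) = (\<Sum>i\<in>I. f (w i))"
  using assms(3)
  by (induction I rule: infinite_finite_induct)
     (auto simp: mod_hom_zero[OF f M] mod_homD(2)[OF f] linear_action_sum[OF M])

lemma mod_hom_comp:
  assumes f: "mod_hom A M N f" and g: "mod_hom A N P g"
  shows "mod_hom A M P (\<lambda>u. g (f u))"
  unfolding mod_hom_def
  using mod_homD(1)[OF f] mod_homD(1)[OF g]
  by (simp add: mod_homD(2)[OF f] mod_homD(2)[OF g] mod_homD(3)[OF f] mod_homD(3)[OF g]
    mod_homD(4)[OF f] mod_homD(4)[OF g])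

lemma mod_hom_id: "mod_hom A M M (\<lambda>u. u)"
  by (simp add: mod_hom_def)

lemma mod_hom_scale:
  assumes f: "mod_hom A M N f" and N: "linear_action A N"
  shows "mod_hom A M N (\<lambda>u. fscale c (f u))"
  unfolding mod_hom_def
  using mod_homD(1)[OF f]
  by (auto simp: mod_homD(2)[OF f] mod_homD(3)[OF f] mod_homD(4)[OF f] linear_actionD[OF N]
      fun_space.scale_right_distrib mult.commute)

lemma mod_iso_iff: "mod_iso A M N \<longleftrightarrow> (\<exists>f. mod_hom A M N f \<and> bij_betw f (mod_carrier M) (mod_carrier N))"
  unfolding mod_iso_def mod_hom_def
  by (intro iff_exI iffI; elim conjE; intro conjI; (assumption | simp add: bij_betw_apply))

lemma mod_hom_inv:
  assumes f: "mod_hom A M N f" and M: "linear_action A M"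
    and bij: "bij_betw f (mod_carrier M) (mod_carrier N)"
  shows "mod_hom A N M (inv_into (mod_carrier M) f)"
proof -
  let ?g = "inv_into (mod_carrier M) f"
  have gin: "?g v \<in> mod_carrier M" "f (?g v) = v" if "v \<in> mod_carrier N" for v
    using that bij by (auto simp: bij_betw_def inv_into_into f_inv_into_f)
  have eqI: "?g v = u" if "u \<in> mod_carrier M" "f u = v" for u v
    using that bij by (auto simp: bij_betw_def)
  show ?thesis
    unfolding mod_hom_def
  proof (intro conjI ballI allI)
    fix u v c a assume u: "u \<in> mod_carrier N" 
    show "?g u \<in> mod_carrier M" using gin u by blast
    show "?g (fscale c u) = fscale c (?g u)"
      using gin[OF u] by (intro eqI) (auto simp: mod_homD[OF f] linear_actionD[OF M])
    show "?g (u + v) = ?g u + ?g v" if v: "v \<in> mod_carrier N"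
      using gin[OF u] gin[OF v] by (intro eqI) (auto simp: mod_homD[OF f] linear_actionD[OF M])
    show "?g (mod_act N a u) = mod_act M a (?g u)" if a: "a \<in> A"
      using gin[OF u] a by (intro eqI) (auto simp: mod_homD[OF f] linear_actionD[OF M])
  qed
qed

lemma mod_iso_sym:
  assumes "mod_iso A M N" "linear_action A M"
  shows "mod_iso A N M"
proof -
  obtain f where f: "mod_hom A M N f" "bij_betw f (mod_carrier M) (mod_carrier N)"
    using assms(1) by (auto simp: mod_iso_iff)
  show ?thesis
    unfolding mod_iso_iff
    using mod_hom_inv[OF f(1) assms(2) f(2)] bij_betw_inv_into[OF f(2)] by (intro exI conjI)
qed

lemma mod_iso_trans:
  assumes "mod_iso A M N" "mod_iso A N P"
  shows "mod_iso A M P"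
proof -
  obtain f where f: "mod_hom A M N f" "bij_betw f (mod_carrier M) (mod_carrier N)"
    using assms(1) by (auto simp: mod_iso_iff)
  obtain g where g: "mod_hom A N P g" "bij_betw g (mod_carrier N) (mod_carrier P)"
    using assms(2) by (auto simp: mod_iso_iff)
  have "mod_hom A M P (\<lambda>u. g (f u))" "bij_betw (\<lambda>u. g (f u)) (mod_carrier M) (mod_carrier P)"
    using mod_hom_comp[OF f(1) g(1)] bij_betw_trans[OF f(2) g(2)] by (simp_all add: comp_def)
  then show ?thesis unfolding mod_iso_iff by (intro exI conjI)
qed

lemma mod_iso_retract:
  assumes "mod_iso A M N" "linear_action A M"
  shows "retract_of A M N" "retract_of A N M"
proof -
  obtain f where f: "mod_hom A M N f" "bij_betw f (mod_carrier M) (mod_carrier N)"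
    using assms(1) by (auto simp: mod_iso_iff)
  note g = mod_hom_inv[OF f(1) assms(2) f(2)]
  show "retract_of A M N"
    unfolding retract_of_def using f(1) g bij_betw_inv_into_left[OF f(2)] by (intro exI conjI ballI)
  show "retract_of A N M"
    unfolding retract_of_def using f(1) g bij_betw_inv_into_right[OF f(2)] by (intro exI conjI ballI)
qed

lemma retract_of_trans:
  assumes "retract_of A M N" "retract_of A N P"
  shows "retract_of A M P"
proof -
  obtain i r where ir: "mod_hom A M N i" "mod_hom A N M r" "\<forall>u\<in>mod_carrier M. r (i u) = u"
    using assms(1) unfolding retract_of_def by blast
  obtain j s where js: "mod_hom A N P j" "mod_hom A P N s" "\<forall>u\<in>mod_carrier N. s (j u) = u"
    using assms(2) unfolding retract_of_def by blast
  have "\<forall>u\<in>mod_carrier M. r (s (j (i u))) = u"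
    using ir(3) js(3) mod_homD(1)[OF ir(1)] by simp
  with mod_hom_comp[OF ir(1) js(1)] mod_hom_comp[OF js(2) ir(2)]
  show ?thesis unfolding retract_of_def by (intro exI conjI)
qed

section \<open>Submodules and direct summands under homomorphisms\<close>

lemma mod_restrict_simps [simp]:
  "mod_carrier (mod_restrict M U) = U" "mod_act (mod_restrict M U) = mod_act M"
  by (simp_all add: mod_restrict_def)

lemma linear_action_restrict:
  assumes "linear_action A M" "submodule_of A M U"
  shows "linear_action A (mod_restrict M U)"
  using assms unfolding linear_action_def submodule_of_def by (simp add: subset_iff)

lemma submodule_image:
  assumes f: "mod_hom A M N f" and M: "linear_action A M" and U: "submodule_of A M U"
  shows "submodule_of A N (f ` U)"
proof -
  have U': "U \<subseteq> mod_carrier M" "fun_space.subspace U" using U by (auto simp: submodule_of_def)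
  note UM = subsetD[OF U'(1)]
  have "fun_space.subspace (f ` U)"
  proof (rule fun_space.subspaceI)
    show "0 \<in> f ` U"
      using mod_hom_zero[OF f M] fun_space.subspace_0[OF U'(2)] by force
  next
    fix x y assume "x \<in> f ` U" "y \<in> f ` U"
    then obtain u v where "u \<in> U" "v \<in> U" "x = f u" "y = f v" by blast
    then show "x + y \<in> f ` U"
      using mod_homD(2)[OF f UM UM] fun_space.subspace_add[OF U'(2)]
      by (metis image_eqI)
  next
    fix c x assume "x \<in> f ` U"
    then obtain u where "u \<in> U" "x = f u" by blast
    then show "fscale c x \<in> f ` U"
      using mod_homD(3)[OF f UM] fun_space.subspace_scale[OF U'(2)] by (metis image_eqI)
  qed
  moreover have "f ` U \<subseteq> mod_carrier N" using U'(1) mod_homD(1)[OF f] by blast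
  moreover have "mod_act N a x \<in> f ` U" if "a \<in> A" "x \<in> f ` U" for a x
    using that U mod_homD(4)[OF f _ UM] unfolding submodule_of_def by (metis (no_types, lifting) imageE imageI)
  ultimately show ?thesis by (auto simp: submodule_of_def)
qed

lemma submodule_preimage:
  assumes f: "mod_hom A M N f" and M: "linear_action A M" and V: "submodule_of A N V"
  shows "submodule_of A M {u \<in> mod_carrier M. f u \<in> V}"
proof -
  have V': "fun_space.subspace V" using V by (auto simp: submodule_of_def)
  show ?thesis
    unfolding submodule_of_def
  proof (intro conjI fun_space.subspaceI)
    show "\<forall>a\<in>A. \<forall>u\<in>{u \<in> mod_carrier M. f u \<in> V}. mod_act M a u \<in> {u \<in> mod_carrier M. f u \<in> V}"
      using V by (auto simp: mod_homD[OF f] linear_actionD[OF M] submodule_of_def)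
  qed (auto simp: mod_hom_zero[OF f M] mod_homD[OF f] linear_actionD[OF M] fun_space.subspace_0[OF V']
      fun_space.subspace_add[OF V'] fun_space.subspace_scale[OF V'])
qed

lemma submodule_0:
  assumes M: "linear_action A M"
  shows "submodule_of A M {0}"
proof -
  have "mod_act M a 0 = 0" if "a \<in> A" for a
    using linear_actionD(7)[OF M that linear_actionD(1)[OF M], of 0] by simp
  then show ?thesis
    unfolding submodule_of_def
    using linear_actionD(1)[OF M] by (simp add: fun_space.subspace_single_0)
qed

text \<open>The complement of the image is the preimage of the old complement under the retraction.\<close>

lemma direct_summand_image:
  assumes i: "mod_hom A K M i" and r: "mod_hom A M K r" and ri: "\<And>u. u \<in> mod_carrier K \<Longrightarrow> r (i u) = u"
    and K: "linear_action A K" and M: "linear_action A M" and U: "direct_summand A K U"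
  shows "direct_summand A M (i ` U)"
proof -
  obtain C where sU: "submodule_of A K U" and sC: "submodule_of A K C" and UC: "U \<inter> C = {0}"
    and KUC: "mod_carrier K = {u + c | u c. u \<in> U \<and> c \<in> C}"
    using U unfolding direct_summand_def by blast
  define D where "D = {u \<in> mod_carrier M. r u \<in> C}"
  have UK: "U \<subseteq> mod_carrier K" using sU by (simp add: submodule_of_def)
  have sD: "submodule_of A M D" unfolding D_def by (rule submodule_preimage[OF r M sC])
  have sI: "submodule_of A M (i ` U)" by (rule submodule_image[OF i K sU])
  have "i ` U \<inter> D = {0}"
  proof (intro equalityI subsetI)
    fix x assume "x \<in> i ` U \<inter> D"
    then obtain u where u: "u \<in> U" "x = i u" "r (i u) \<in> C" by (auto simp: D_def)
    then have "u \<in> U \<inter> C" using ri UK by auto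
    then show "x \<in> {0}" using UC u mod_hom_zero[OF i K] by auto
  qed (use sI sD in \<open>auto simp: submodule_of_def fun_space.subspace_0\<close>)
  moreover have "mod_carrier M = {u + c | u c. u \<in> i ` U \<and> c \<in> D}"
  proof (intro equalityI subsetI)
    fix x assume x: "x \<in> mod_carrier M"
    have "r x \<in> {u + c | u c. u \<in> U \<and> c \<in> C}" using mod_homD(1)[OF r x] KUC by simp
    then obtain u c where uc: "u \<in> U" "c \<in> C" "r x = u + c" by blast
    have iu: "i u \<in> mod_carrier M" "u \<in> mod_carrier K" using uc UK mod_homD(1)[OF i] by auto
    have "r (x - i u) = c" using mod_hom_diff[OF r M x iu(1)] ri[OF iu(2)] uc(3) by simp
    then have "x - i u \<in> D" using uc(2) linear_actionD(3)[OF M x iu(1)] by (simp add: D_def)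
    moreover have "x = i u + (x - i u)" by simp
    ultimately show "x \<in> {u + c | u c. u \<in> i ` U \<and> c \<in> D}" using uc(1) by blast
  next
    fix x assume "x \<in> {u + c | u c. u \<in> i ` U \<and> c \<in> D}"
    then show "x \<in> mod_carrier M"
      using sI sD linear_actionD(2)[OF M] by (auto simp: submodule_of_def subset_iff)
  qed
  ultimately show ?thesis using sI sD unfolding direct_summand_def by blast
qed

lemma direct_summand_carrier:
  assumes "linear_action A M"
  shows "direct_summand A M (mod_carrier M)"
proof -
  have "submodule_of A M (mod_carrier M)" using assms unfolding submodule_of_def linear_action_def by auto
  moreover have "mod_carrier M = {u + c | u c. u \<in> mod_carrier M \<and> c \<in> {0}}" by auto
  ultimately show ?thesis
    using submodule_0[OF assms] linear_actionD(1)[OF assms] unfolding direct_summand_def by blast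
qed

text \<open>The retraction is the projection along a complement \<open>C\<close>. As
  \<open>U\<close> and \<open>C\<close> meet in 0, the component of x in \<open>U\<close> is the
  only u in \<open>U\<close> with x - u in \<open>C\<close>; each property of the projection is
  checked by exhibiting such a u.\<close>

lemma direct_summand_retract:
  assumes M: "linear_action A M" and U: "direct_summand A M U"
  shows "retract_of A (mod_restrict M U) M"
proof -
  obtain C where sU: "submodule_of A M U" and sC: "submodule_of A M C" and UC: "U \<inter> C = {0}"
    and MUC: "mod_carrier M = {u + c | u c. u \<in> U \<and> c \<in> C}"
    using U unfolding direct_summand_def by blast
  have sub: "fun_space.subspace U" "fun_space.subspace C" and UM: "U \<subseteq> mod_carrier M"
    and CM: "C \<subseteq> mod_carrier M"
    using sU sC by (auto simp: submodule_of_def)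
  define r where "r x = (THE u. u \<in> U \<and> x - u \<in> C)" for x
  have req: "r x = u" if "u \<in> U" "x - u \<in> C" for x u
    unfolding r_def
  proof (rule the_equality)
    fix v assume v: "v \<in> U \<and> x - v \<in> C"
    have "v - u \<in> U" using v that fun_space.subspace_diff[OF sub(1)] by blast
    moreover have "v - u = (x - u) - (x - v)" by simp
    then have "v - u \<in> C" using v that fun_space.subspace_diff[OF sub(2)] by metis
    ultimately have "v - u = 0" using UC by blast
    then show "v = u" by simp
  qed (use that in auto)
  have ex: "r x \<in> U \<and> x - r x \<in> C" if "x \<in> mod_carrier M" for x
  proof -
    have "x \<in> {u + c | u c. u \<in> U \<and> c \<in> C}" using that MUC by simp
    then obtain u c where uc: "u \<in> U" "c \<in> C" "x = u + c" by blast
    have "x - u = c" using uc(3) by simp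
    then have "x - u \<in> C" using uc(2) by simp
    then show ?thesis using req[OF uc(1)] uc(1) by simp
  qed
  have "mod_hom A M (mod_restrict M U) r"
    unfolding mod_hom_def
  proof (intro conjI ballI allI)
    fix x y a c assume x: "x \<in> mod_carrier M"
    show "r x \<in> mod_carrier (mod_restrict M U)" using ex[OF x] by simp
    show "r (x + y) = r x + r y" if "y \<in> mod_carrier M"
    proof (rule req)
      have "x + y - (r x + r y) = (x - r x) + (y - r y)" by simp
      then show "x + y - (r x + r y) \<in> C"
        using ex[OF x] ex[OF that] fun_space.subspace_add[OF sub(2)] by metis
    qed (use ex[OF x] ex[OF that] fun_space.subspace_add[OF sub(1)] in auto)
    show "r (fscale c x) = fscale c (r x)"
    proof (rule req)
      show "fscale c x - fscale c (r x) \<in> C"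
        using ex[OF x] fun_space.subspace_scale[OF sub(2)] fun_space.scale_right_diff_distrib by metis
    qed (use ex[OF x] fun_space.subspace_scale[OF sub(1)] in auto)
    show "r (mod_act M a x) = mod_act (mod_restrict M U) a (r x)" if a: "a \<in> A"
    proof -
      have "mod_act M a x = mod_act M a (r x) + mod_act M a (x - r x)"
        using ex[OF x] UM CM linear_actionD(6)[OF M a, of "r x" "x - r x"] by auto
      moreover have "mod_act M a (x - r x) \<in> C" "mod_act M a (r x) \<in> U"
        using ex[OF x] a sU sC by (auto simp: submodule_of_def)
      ultimately show ?thesis by (auto intro: req)
    qed
  qed
  moreover have "mod_hom A (mod_restrict M U) M (\<lambda>u. u)" using UM by (auto simp: mod_hom_def)
  moreover have "r u = u" if "u \<in> U" for u
    using that by (intro req) (auto simp: fun_space.subspace_0[OF sub(2)])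
  ultimately show ?thesis unfolding retract_of_def by auto
qed

section \<open>Direct summands as retracts, and multiplicities\<close>

lemma mod_iso_image:
  assumes i: "mod_hom A K M i" and inj: "inj_on i (mod_carrier K)" and U: "submodule_of A K U"
  shows "mod_iso A (mod_restrict K U) (mod_restrict M (i ` U))"
  unfolding mod_iso_iff
proof (intro exI conjI)
  have UK: "U \<subseteq> mod_carrier K" using U by (auto simp: submodule_of_def)
  show "mod_hom A (mod_restrict K U) (mod_restrict M (i ` U)) i"
    using i UK by (auto simp: mod_hom_def subset_iff)
  show "bij_betw i (mod_carrier (mod_restrict K U)) (mod_carrier (mod_restrict M (i ` U)))"
    using inj_on_subset[OF inj UK] by (simp add: bij_betw_def)
qed

text \<open>In one direction the projection onto a summand splits its inclusion; in the other,
  \<open>direct_summand_image\<close> is applied to the whole of \<open>N\<close>. Assertions about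
  internal summands can thus be proved by composing maps.\<close>

lemma has_summand_iff_retract:
  assumes M: "linear_action A M" and N: "linear_action A N"
  shows "has_summand A M N \<longleftrightarrow> retract_of A N M"
proof
  assume "has_summand A M N"
  then obtain U where U: "direct_summand A M U" "mod_iso A (mod_restrict M U) N"
    unfolding has_summand_def by blast
  have "linear_action A (mod_restrict M U)"
    using U M by (auto simp: direct_summand_def intro: linear_action_restrict)
  then have "retract_of A N (mod_restrict M U)" using mod_iso_retract(2) U by blast
  then show "retract_of A N M" using direct_summand_retract[OF M U(1)] retract_of_trans by blast
next
  assume "retract_of A N M"
  then obtain i r where ir: "mod_hom A N M i" "mod_hom A M N r" "\<And>u. u \<in> mod_carrier N \<Longrightarrow> r (i u) = u"
    unfolding retract_of_def by blast
  have inj: "inj_on i (mod_carrier N)" by (metis inj_onI ir(3))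
  have sN: "submodule_of A N (mod_carrier N)"
    using direct_summand_carrier[OF N] by (simp add: direct_summand_def)
  have NN: "mod_restrict N (mod_carrier N) = N" by (simp add: mod_restrict_def)
  have "mod_iso A (mod_restrict M (i ` mod_carrier N)) N"
    using mod_iso_sym[OF mod_iso_image[OF ir(1) inj sN]] linear_action_restrict[OF N sN] NN by metis
  then show "has_summand A M N"
    using direct_summand_image[OF ir N M direct_summand_carrier[OF N]] unfolding has_summand_def by blast
qed

text \<open>A split injection keeps the copies independent and maps their sum onto the sum of their
  images, which is again a direct summand. The upper bound for multiplicities comes from here,
  without any uniqueness of decompositions.\<close>

lemma has_summand_copies_mono:
  assumes "retract_of A K M" and K: "linear_action A K" and M: "linear_action A M"
    and "has_summand_copies A K N m"
  shows "has_summand_copies A M N m"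
proof -
  obtain i r where ir: "mod_hom A K M i" "mod_hom A M K r" "\<And>u. u \<in> mod_carrier K \<Longrightarrow> r (i u) = u"
    using assms(1) unfolding retract_of_def by blast
  have inj: "inj_on i (mod_carrier K)" by (metis inj_onI ir(3))
  obtain W where W: "\<And>j. j < m \<Longrightarrow> submodule_of A K (W j) \<and> mod_iso A (mod_restrict K (W j)) N"
    and ind: "\<And>w. (\<forall>j<m. w j \<in> W j) \<Longrightarrow> (\<Sum>j<m. w j) = 0 \<Longrightarrow> \<forall>j<m. w j = 0"
    and ds: "direct_summand A K {\<Sum>j<m. w j | w. \<forall>j<m. w j \<in> W j}"
    using assms(4) unfolding has_summand_copies_def by blast
  have WK: "W j \<subseteq> mod_carrier K" if "j < m" for j using W[OF that] by (simp add: submodule_of_def)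
  have sub: "submodule_of A M (i ` W j) \<and> mod_iso A (mod_restrict M (i ` W j)) N" if "j < m" for j
  proof -
    have sW: "submodule_of A K (W j)" using W[OF that] by blast
    have "mod_iso A (mod_restrict M (i ` W j)) (mod_restrict K (W j))"
      using mod_iso_sym[OF mod_iso_image[OF ir(1) inj sW]] linear_action_restrict[OF K sW] by blast
    then show ?thesis using W[OF that] mod_iso_trans submodule_image[OF ir(1) K sW] by blast
  qed
  have ex: "\<exists>w'. (\<forall>j<m. w' j \<in> W j) \<and> (\<forall>j<m. w j = i (w' j))" if "\<forall>j<m. w j \<in> i ` W j" for w
  proof -
    have "\<forall>j\<in>{..<m}. \<exists>u. u \<in> W j \<and> w j = i u" using that by blast
    from bchoice[OF this] show ?thesis by auto
  qed
  have sumi: "(\<Sum>j<m. w j) = i (\<Sum>j<m. w' j)" if "\<forall>j<m. w' j \<in> W j" "\<forall>j<m. w j = i (w' j)" for w w'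
  proof -
    have "i (\<Sum>j<m. w' j) = (\<Sum>j<m. i (w' j))"
      using mod_hom_sum[OF ir(1) K, of "{..<m}" w'] that WK by blast
    then show ?thesis using that by simp
  qed
  have ind': "\<forall>j<m. w j = 0" if wi: "\<forall>j<m. w j \<in> i ` W j" and w0: "(\<Sum>j<m. w j) = 0" for w
  proof -
    obtain w' where w': "\<forall>j<m. w' j \<in> W j" "\<forall>j<m. w j = i (w' j)" using ex[OF wi] by blast
    have "(\<Sum>j<m. w' j) \<in> mod_carrier K" using w' WK by (auto intro!: linear_action_sum[OF K])
    moreover have "i (\<Sum>j<m. w' j) = i 0" using sumi[OF w'] w0 mod_hom_zero[OF ir(1) K] by simp
    ultimately have "(\<Sum>j<m. w' j) = 0" using inj linear_actionD(1)[OF K] by (auto dest: inj_onD)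
    then have "\<forall>j<m. w' j = 0" using ind[OF w'(1)] by blast
    then show ?thesis using w'(2) mod_hom_zero[OF ir(1) K] by auto
  qed
  have "i ` {\<Sum>j<m. w j | w. \<forall>j<m. w j \<in> W j} = {\<Sum>j<m. w j | w. \<forall>j<m. w j \<in> i ` W j}"
  proof (intro equalityI subsetI)
    fix x assume "x \<in> i ` {\<Sum>j<m. w j | w. \<forall>j<m. w j \<in> W j}"
    then obtain w where w: "\<forall>j<m. w j \<in> W j" "x = i (\<Sum>j<m. w j)" by blast
    then have "x = (\<Sum>j<m. i (w j))" using sumi[of w "\<lambda>j. i (w j)"] by simp
    then show "x \<in> {\<Sum>j<m. w j | w. \<forall>j<m. w j \<in> i ` W j}" using w by blast
  next
    fix x assume "x \<in> {\<Sum>j<m. w j | w. \<forall>j<m. w j \<in> i ` W j}"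
    then obtain w where w: "\<forall>j<m. w j \<in> i ` W j" "x = (\<Sum>j<m. w j)" by blast
    obtain w' where "\<forall>j<m. w' j \<in> W j" "\<forall>j<m. w j = i (w' j)" using ex[OF w(1)] by blast
    then show "x \<in> i ` {\<Sum>j<m. w j | w. \<forall>j<m. w j \<in> W j}" using sumi w(2) by blast
  qed
  then have "direct_summand A M {\<Sum>j<m. w j | w. \<forall>j<m. w j \<in> i ` W j}"
    using direct_summand_image[OF ir K M ds] by simp
  then show ?thesis
    unfolding has_summand_copies_def using sub ind' by (intro exI[of _ "\<lambda>j. i ` W j"]) blast
qed

lemma multiplicity_mono:
  assumes "retract_of A K M" "linear_action A K" "linear_action A M"
  shows "multiplicity_in A K N \<le> multiplicity_in A M N"
  unfolding multiplicity_in_def using has_summand_copies_mono[OF assms]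
  by (intro Sup_subset_mono) auto

lemma has_summand_copies_1:
  fixes M :: "('k::field, 'a, 'x) kmodule"
  shows "has_summand_copies A M N 1 \<longleftrightarrow> has_summand A M N"
proof -
  have *: "{\<Sum>i<(1::nat). w i | w. \<forall>i<(1::nat). w i \<in> W i} = W 0" for W :: "nat \<Rightarrow> ('x \<Rightarrow> 'k) set"
  proof (intro equalityI subsetI)
    fix x assume "x \<in> W 0"
    then show "x \<in> {\<Sum>i<(1::nat). w i | w. \<forall>i<(1::nat). w i \<in> W i}"
      by (intro CollectI exI[of _ "\<lambda>_. x"]) auto
  qed auto
  show ?thesis
  proof
    assume "has_summand_copies A M N 1"
    then obtain W where W: "\<forall>i<(1::nat). submodule_of A M (W i) \<and> mod_iso A (mod_restrict M (W i)) N"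
      "direct_summand A M {\<Sum>i<(1::nat). w i | w. \<forall>i<(1::nat). w i \<in> W i}"
      unfolding has_summand_copies_def by blast
    have "direct_summand A M (W 0)" using W(2) unfolding * .
    then show "has_summand A M N" unfolding has_summand_def using W(1) by auto
  next
    assume "has_summand A M N"
    then obtain U where U: "direct_summand A M U" "mod_iso A (mod_restrict M U) N"
      unfolding has_summand_def by blast
    then show "has_summand_copies A M N 1"
      unfolding has_summand_copies_def
      by (intro exI[of _ "\<lambda>_. U"], subst *) (auto simp: direct_summand_def)
  qed
qed

text \<open>If 0 were the only number of copies that occurs, the supremum would be 0; and a positive
  number of copies cannot exceed the supremum 1.\<close>

lemma multiplicity_1_has_summand:
  assumes "multiplicity_in A M N = 1"
  shows "has_summand A M N"
proof -
  have "\<not> (\<forall>m. has_summand_copies A M N m \<longrightarrow> m = 0)"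
  proof
    assume "\<forall>m. has_summand_copies A M N m \<longrightarrow> m = 0"
    then have "multiplicity_in A M N \<le> 0"
      unfolding multiplicity_in_def by (intro Sup_least) (auto simp: zero_enat_def)
    then show False using assms by simp
  qed
  then obtain m where m: "has_summand_copies A M N m" "m \<noteq> 0" by blast
  then have "enat m \<le> 1"
    using assms unfolding multiplicity_in_def by (metis Sup_upper imageI mem_Collect_eq)
  then have "m = 1" using m by (simp add: one_enat_def)
  then show ?thesis using m has_summand_copies_1 by metis
qed

lemma multiplicity_ge_1:
  assumes "has_summand A M N"
  shows "multiplicity_in A M N \<ge> 1"
  unfolding multiplicity_in_def using assms has_summand_copies_1
  by (intro Sup_upper) (auto simp: one_enat_def)

text \<open>An isomorphism with its inverse is a retraction, so \<open>direct_summand_image\<close>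
  carries summands of \<open>M\<close> to summands of \<open>N\<close>.\<close>

lemma indecomposable_iso:
  assumes "mod_iso A M N" and M: "linear_action A M" and N: "linear_action A N"
    and ind: "indecomposable A N"
  shows "indecomposable A M"
proof -
  obtain f where f: "mod_hom A M N f" "bij_betw f (mod_carrier M) (mod_carrier N)"
    using assms(1) by (auto simp: mod_iso_iff)
  note g = mod_hom_inv[OF f(1) M f(2)]
  have gf: "inv_into (mod_carrier M) f (f u) = u" if "u \<in> mod_carrier M" for u
    using f(2) that by (rule bij_betw_inv_into_left)
  have f0: "f 0 = 0" by (rule mod_hom_zero[OF f(1) M])
  have inj: "inj_on f (mod_carrier M)" and im: "f ` mod_carrier M = mod_carrier N"
    using f(2) by (auto simp: bij_betw_def)
  show ?thesis
    unfolding indecomposable_def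
  proof (intro conjI allI impI)
    show "mod_carrier M \<noteq> {0}" using im f0 ind unfolding indecomposable_def by force
  next
    fix U assume U: "direct_summand A M U"
    then have UM: "U \<subseteq> mod_carrier M" "0 \<in> U"
      by (auto simp: direct_summand_def submodule_of_def fun_space.subspace_0)
    have "direct_summand A N (f ` U)" by (rule direct_summand_image[OF f(1) g gf M N U])
    then have "f ` U = {0} \<or> f ` U = mod_carrier N" using ind by (auto simp: indecomposable_def)
    then show "U = {0} \<or> U = mod_carrier M"
    proof
      assume "f ` U = {0}"
      then have "f ` U = f ` {0}" using f0 by simp
      then show ?thesis
        using inj_on_image_eq_iff[OF inj UM(1), of "{0}"] linear_actionD(1)[OF M] by simp
    next
      assume "f ` U = mod_carrier N"
      then show ?thesis using inj_on_image_eq_iff[OF inj UM(1), of "mod_carrier M"] im by simp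
    qed
  qed
qed

section \<open>A locally finite form of Fitting's lemma\<close>

text \<open>The substitute for finite length. For a symmetric group the identity serves as
  \<open>a\<close>, the modules being finite-dimensional; for the algebra, \<open>a\<close> is a sum
  of finitely many orthogonal idempotents, which maps an infinite-dimensional module into a
  finite-dimensional space.\<close>

definition locally_finite :: "'a set \<Rightarrow> ('k::field, 'a, 'x) kmodule \<Rightarrow> bool" where
  "locally_finite A M \<longleftrightarrow> (\<forall>u\<in>mod_carrier M. \<exists>a\<in>A. \<exists>T. finite T \<and> mod_act M a u = u \<and>
     (\<forall>v\<in>mod_carrier M. mod_act M a v \<in> fun_space.span T))"

lemma mod_hom_sum_hom:
  assumes f: "\<And>i. i \<in> I \<Longrightarrow> mod_hom A M N (f i)" and M: "linear_action A M" and N: "linear_action A N"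
  shows "mod_hom A M N (\<lambda>u. \<Sum>i\<in>I. f i u)"
proof -
  have act0: "mod_act N a 0 = 0" if "a \<in> A" for a
    using linear_actionD(7)[OF N that linear_actionD(1)[OF N], of 0] by simp
  have act: "mod_act N a (\<Sum>i\<in>I. w i) = (\<Sum>i\<in>I. mod_act N a (w i))"
    if "a \<in> A" "\<And>i. i \<in> I \<Longrightarrow> w i \<in> mod_carrier N" for a w
    using that(2)
    by (induction I rule: infinite_finite_induct)
       (auto simp: act0[OF that(1)] linear_actionD(6)[OF N that(1)] linear_action_sum[OF N])
  show ?thesis
    unfolding mod_hom_def
  proof (intro conjI ballI allI)
    fix u v c a assume u: "u \<in> mod_carrier M"
    show "(\<Sum>i\<in>I. f i u) \<in> mod_carrier N"
      by (rule linear_action_sum[OF N]) (use mod_homD(1)[OF f] u in blast)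
    show "(\<Sum>i\<in>I. f i (fscale c u)) = fscale c (\<Sum>i\<in>I. f i u)"
      using mod_homD(3)[OF f u] by (simp add: fun_space.scale_sum_right)
    show "(\<Sum>i\<in>I. f i (u + v)) = (\<Sum>i\<in>I. f i u) + (\<Sum>i\<in>I. f i v)" if "v \<in> mod_carrier M"
      using mod_homD(2)[OF f u that] by (simp add: sum.distrib)
    show "(\<Sum>i\<in>I. f i (mod_act M a u)) = mod_act N a (\<Sum>i\<in>I. f i u)" if "a \<in> A"
      using mod_homD(4)[OF f that u] act[OF that, of "\<lambda>i. f i u"] mod_homD(1)[OF f u] by simp
  qed
qed

lemma mod_hom_funpow: "mod_hom A M M f \<Longrightarrow> mod_hom A M M (f ^^ k)"
proof (induction k)
  case 0
  then show ?case by (simp add: mod_hom_def)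
next
  case (Suc k)
  then show ?case using mod_hom_comp[of A M M "f ^^ k" M f] by (simp add: comp_def)
qed

text \<open>One vector more than the size of the spanning set forces a relation. Dependence is a
  property of sets, so a repetition \<open>g i = g j\<close> has to be treated separately and gives
  the relation with coefficients 1 and -1.\<close>

lemma linear_relation:
  fixes g :: "nat \<Rightarrow> ('x \<Rightarrow> 'k::field)"
  assumes T: "finite T" and g: "\<And>i. g i \<in> fun_space.span T"
  obtains c j where "c j \<noteq> 0" "j \<le> card T" "(\<Sum>i\<le>card T. fscale (c i) (g i)) = 0"
proof (cases "inj_on g {..card T}")
  case True
  let ?S = "g ` {..card T}"
  have "card ?S = Suc (card T)" using card_image[OF True] by simp
  moreover have "?S \<subseteq> fun_space.span T" using g by auto
  ultimately have "fun_space.dependent ?S"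
    using fun_space.independent_span_bound[OF T, of ?S] by fastforce
  then obtain u v where v: "v \<in> ?S" "u v \<noteq> 0" "(\<Sum>v\<in>?S. fscale (u v) v) = 0"
    using fun_space.dependent_finite[of ?S] by auto
  have "(\<Sum>i\<le>card T. fscale (u (g i)) (g i)) = 0"
    using v(3) by (simp add: sum.reindex[OF True])
  moreover obtain j where "j \<le> card T" "v = g j" using v(1) by auto
  ultimately show ?thesis using that[of "\<lambda>i. u (g i)" j] v(2) by simp
next
  case False
  then obtain i j where ij: "i \<le> card T" "j \<le> card T" "i \<noteq> j" "g i = g j"
    by (auto simp: inj_on_def)
  define c :: "nat \<Rightarrow> 'k" where "c l = (if l = i then 1 else if l = j then -1 else 0)" for l
  have "(\<Sum>l\<le>card T. fscale (c l) (g l)) = (\<Sum>l\<in>{i,j}. fscale (c l) (g l))"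
    using ij by (intro sum.mono_neutral_right) (auto simp: c_def)
  also have "\<dots> = 0" using ij by (simp add: c_def)
  finally show ?thesis using that[of c i] ij by (simp add: c_def)
qed

text \<open>A relation between the vectors f^i y, solved for its lowest term f^j y, expresses that
  term as f^(j+1) applied to h y for a polynomial h in f. The bound on j depends on \<open>T\<close>
  only, not on y.\<close>

lemma hom_relation:
  fixes M :: "('k::field, 'a, 'x) kmodule"
  assumes M: "linear_action A M" and f: "mod_hom A M M f"
    and T: "finite T" and a: "a \<in> A" and aT: "\<And>v. v \<in> mod_carrier M \<Longrightarrow> mod_act M a v \<in> fun_space.span T"
    and y0: "y0 \<in> mod_carrier M" and ay: "y = mod_act M a y0"
  obtains j h where "j \<le> card T" "mod_hom A M M h" "\<And>v. v \<in> mod_carrier M \<Longrightarrow> h (f v) = f (h v)"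
    "(f ^^ j) y = (f ^^ j) (f (h y))"
proof -
  note fk = mod_hom_funpow[OF f]
  have y: "y \<in> mod_carrier M" unfolding ay by (rule linear_actionD(5)[OF M a y0])
  \<comment> \<open>Powers of f commute with \<open>a\<close>, so f^i y is the image under
    \<open>a\<close> of f^i y0. This is why y is taken of the form
    \<open>mod_act M a y0\<close>.\<close>
  have "(f ^^ i) y \<in> fun_space.span T" for i
    using aT[OF mod_homD(1)[OF fk y0]] mod_homD(4)[OF fk a y0] unfolding ay by simp
  then obtain c j0 where c: "c j0 \<noteq> 0" "j0 \<le> card T" "(\<Sum>i\<le>card T. fscale (c i) ((f ^^ i) y)) = 0"
    using linear_relation[OF T, of "\<lambda>i. (f ^^ i) y"] by blast
  define j where "j = (LEAST i. c i \<noteq> 0)"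
  have j: "c j \<noteq> 0" "j \<le> j0" and less: "\<And>i. i < j \<Longrightarrow> c i = 0"
    using LeastI[of "\<lambda>i. c i \<noteq> 0", OF c(1)] Least_le[of "\<lambda>i. c i \<noteq> 0", OF c(1)] not_less_Least
    unfolding j_def by blast+
  let ?I = "{j<..card T}"
  \<comment> \<open>Division by the lowest nonzero coefficient; the exponents in \<open>h\<close>
    below are lowered by j + 1, so that f^(j+1) restores them.\<close>
  define e where "e i = - c i / c j" for i
  define h where "h v = (\<Sum>i\<in>?I. fscale (e i) ((f ^^ (i - Suc j)) v))" for v
  have h: "mod_hom A M M h"
    unfolding h_def by (intro mod_hom_sum_hom mod_hom_scale fk M)
  have sumf: "f (\<Sum>i\<in>I. w i) = (\<Sum>i\<in>I. f (w i))"
    if "\<And>i. i \<in> I \<Longrightarrow> w i \<in> mod_carrier M" for I and w :: "nat \<Rightarrow> _"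
    using mod_hom_sum[OF f M that] .
  have comm: "h (f v) = f (h v)" if v: "v \<in> mod_carrier M" for v
    unfolding h_def using v
    by (subst sumf) (auto simp: mod_homD(3)[OF f] mod_homD(1)[OF fk] linear_actionD(4)[OF M] funpow_swap1)
  have "(f ^^ j) (f (h y)) = (f ^^ Suc j) (h y)" by (simp add: funpow_swap1)
  also have "\<dots> = (\<Sum>i\<in>?I. (f ^^ Suc j) (fscale (e i) ((f ^^ (i - Suc j)) y)))"
    unfolding h_def using mod_homD(1)[OF fk y] linear_actionD(4)[OF M]
    by (intro mod_hom_sum[OF fk M]) auto
  also have "\<dots> = (\<Sum>i\<in>?I. fscale (e i) ((f ^^ i) y))"
  proof (rule sum.cong)
    fix i assume "i \<in> ?I"
    then have "Suc j + (i - Suc j) = i" by simp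
    then show "(f ^^ Suc j) (fscale (e i) ((f ^^ (i - Suc j)) y)) = fscale (e i) ((f ^^ i) y)"
      using mod_homD(3)[OF fk mod_homD(1)[OF fk y]] funpow_add[of "Suc j" "i - Suc j" f]
      by (metis comp_apply)
  qed simp
  also have "\<dots> = fscale (- 1 / c j) (\<Sum>i\<in>?I. fscale (c i) ((f ^^ i) y))"
    by (simp add: fun_space.scale_sum_right e_def)
  also have "(\<Sum>i\<in>?I. fscale (c i) ((f ^^ i) y)) = - fscale (c j) ((f ^^ j) y)"
  proof -
    have "(\<Sum>i\<le>card T. fscale (c i) ((f ^^ i) y)) = (\<Sum>i\<in>insert j ?I. fscale (c i) ((f ^^ i) y))"
      using j c(2) less by (intro sum.mono_neutral_right) (auto simp: less)
    then show ?thesis using c(3) by (simp add: eq_neg_iff_add_eq_0 add.commute)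
  qed
  also have "fscale (- 1 / c j) (- fscale (c j) ((f ^^ j) y)) = (f ^^ j) y"
    using j(1) by (simp add: fun_eq_iff fscale_def)
  finally have rel: "(f ^^ j) (f (h y)) = (f ^^ j) y" .
  have "j \<le> card T" using j c(2) by simp
  from that[OF this h comm rel[symmetric]] show ?thesis .
qed

text \<open>\<open>M0\<close> consists of the vectors killed by some power of f, and
  \<open>M1\<close> is the intersection of the images of all powers. Once they are complementary,
  indecomposability leaves two cases. In infinite dimension complementarity is not automatic; it is
  obtained vector by vector from \<open>hom_relation\<close>.\<close>

lemma fitting:
  fixes M :: "('k::field, 'a, 'x) kmodule"
  assumes M: "linear_action A M" and lf: "locally_finite A M" and ind: "indecomposable A M"
    and f: "mod_hom A M M f"
  shows "bij_betw f (mod_carrier M) (mod_carrier M) \<or> (\<forall>u\<in>mod_carrier M. \<exists>k. (f ^^ k) u = 0)"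
proof -
  let ?C = "mod_carrier M"
  note fk = mod_hom_funpow[OF f]
  have fin: "(f ^^ k) u \<in> ?C" if "u \<in> ?C" for u k using mod_homD(1)[OF fk that] .
  have f0: "(f ^^ k) 0 = 0" for k using mod_hom_zero[OF fk M] .
  have fadd: "(f ^^ (k + l)) u = (f ^^ k) ((f ^^ l) u)" for k l u by (simp add: funpow_add)
  define M0 where "M0 = {u \<in> ?C. \<exists>k. (f ^^ k) u = 0}"
  define M1 where "M1 = {u \<in> ?C. \<forall>k. \<exists>v\<in>?C. u = (f ^^ k) v}"
  have s0: "submodule_of A M M0"
    unfolding submodule_of_def
  proof (intro conjI fun_space.subspaceI ballI subsetI)
    fix x y assume "x \<in> M0" "y \<in> M0"
    then obtain k l where kl: "x \<in> ?C" "y \<in> ?C" "(f ^^ k) x = 0" "(f ^^ l) y = 0" by (auto simp: M0_def)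
    have "(f ^^ (k + l)) x = 0" "(f ^^ (k + l)) y = 0"
      using kl fadd[of l k x] fadd[of k l y] f0 by (simp_all add: add.commute)
    then have "(f ^^ (k + l)) (x + y) = 0" using mod_homD(2)[OF fk kl(1,2)] by simp
    then show "x + y \<in> M0" using kl linear_actionD(2)[OF M] by (auto simp: M0_def)
  next
    fix c x assume x: "x \<in> M0"
    then show "fscale c x \<in> M0"
      using mod_homD(3)[OF fk] linear_actionD(4)[OF M] by (fastforce simp: M0_def)
  next
    fix a x assume a: "a \<in> A" and x: "x \<in> M0"
    obtain k where k: "x \<in> ?C" "(f ^^ k) x = 0" using x by (auto simp: M0_def)
    have "(f ^^ k) (mod_act M a x) = mod_act M a 0" using mod_homD(4)[OF fk a k(1)] k(2) by simp
    also have "\<dots> = 0"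
      using linear_actionD(7)[OF M a linear_actionD(1)[OF M], of 0] by simp
    finally show "mod_act M a x \<in> M0"
      using linear_actionD(5)[OF M a k(1)] unfolding M0_def by blast
  qed (use f0 linear_actionD(1)[OF M] in \<open>auto simp: M0_def\<close>)
  have sk: "submodule_of A M ((f ^^ k) ` ?C)" for k
    using submodule_image[OF fk M] direct_summand_carrier[OF M] by (auto simp: direct_summand_def)
  have M1_eq: "M1 = (\<Inter>k. (f ^^ k) ` ?C)"
  proof (intro equalityI subsetI)
    fix x assume "x \<in> (\<Inter>k. (f ^^ k) ` ?C)"
    then have "x \<in> (f ^^ k) ` ?C" for k by blast
    moreover from this[of 0] have "x \<in> ?C" by simp
    ultimately show "x \<in> M1" by (auto simp: M1_def)
  qed (auto simp: M1_def)
  have s1: "submodule_of A M M1"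
    unfolding submodule_of_def
  proof (intro conjI)
    show "fun_space.subspace M1"
      unfolding M1_eq using sk by (intro fun_space.subspace_Inter) (auto simp: submodule_of_def)
    show "M1 \<subseteq> ?C" by (auto simp: M1_def)
    show "\<forall>a\<in>A. \<forall>u\<in>M1. mod_act M a u \<in> M1"
    proof (intro ballI)
      fix a u assume a: "a \<in> A" and u: "u \<in> M1"
      have "mod_act M a u \<in> (f ^^ k) ` ?C" for k
      proof -
        have "u \<in> (f ^^ k) ` ?C" using u by (simp add: M1_eq)
        then show ?thesis using sk[of k] a unfolding submodule_of_def by (meson bspec)
      qed
      then show "mod_act M a u \<in> M1" by (simp add: M1_eq)
    qed
  qed
  \<comment> \<open>The bound d is separated from y: in the proof that \<open>M0\<close> and
    \<open>M1\<close> meet in 0 it must be known before y is chosen.\<close>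
  define R where "R d y \<longleftrightarrow> (\<exists>j h. j \<le> d \<and> mod_hom A M M h \<and> (\<forall>v\<in>?C. h (f v) = f (h v)) \<and>
    (f ^^ j) y = (f ^^ j) (f (h y)))" for d y
  have unit: "\<exists>d. \<exists>a\<in>A. mod_act M a u = u \<and> (\<forall>y0\<in>?C. R d (mod_act M a y0))"
    if u: "u \<in> ?C" for u
  proof -
    obtain a T where aT: "a \<in> A" "finite T" "mod_act M a u = u"
      "\<And>v. v \<in> ?C \<Longrightarrow> mod_act M a v \<in> fun_space.span T"
      using lf u unfolding locally_finite_def by blast
    have rel: "R (card T) y"
      if y: "y0 \<in> ?C" "y = mod_act M a y0" for y0 y
    proof -
      obtain j h where "j \<le> card T" "mod_hom A M M h" "\<And>v. v \<in> ?C \<Longrightarrow> h (f v) = f (h v)"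
        "(f ^^ j) y = (f ^^ j) (f (h y))"
        using hom_relation[OF M f aT(2,1,4) y] by metis
      then show ?thesis unfolding R_def by (intro exI conjI ballI)
    qed
    show ?thesis
    proof (intro exI[of _ "card T"] bexI[of _ a] conjI)
      show "mod_act M a u = u" "a \<in> A" by fact+
    qed (use rel in blast)
  qed
  have iter: "(f ^^ l) ((h ^^ m) v) = (h ^^ m) ((f ^^ l) v) \<and> (h ^^ m) v \<in> ?C"
    if h: "mod_hom A M M h" "\<forall>v\<in>?C. h (f v) = f (h v)" and v: "v \<in> ?C" for h l m v
  proof -
    have hin: "(h ^^ m) v \<in> ?C" if "v \<in> ?C" for m v using mod_homD(1)[OF mod_hom_funpow[OF h(1)] that] .
    have "(f ^^ l) (h v) = h ((f ^^ l) v)" if "v \<in> ?C" for l v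
      using that h(2) fin by (induction l) auto
    then have "(f ^^ l) ((h ^^ m) v) = (h ^^ m) ((f ^^ l) v)"
      using v hin by (induction m) auto
    then show ?thesis using hin v by blast
  qed
  \<comment> \<open>On f^j y the polynomial h is inverse to f, so t further applications of f are
    undone by t applications of h.\<close>
  have stable: "(f ^^ j) y = (h ^^ t) ((f ^^ (j + t)) y)"
    if h: "mod_hom A M M h" "\<forall>v\<in>?C. h (f v) = f (h v)" and y: "y \<in> ?C"
      and rel: "(f ^^ j) y = (f ^^ j) (f (h y))" for h j t y
  proof (induction t)
    case (Suc t)
    have hy: "h y \<in> ?C" using mod_homD(1)[OF h(1) y] .
    have step: "(f ^^ j) y = h (f ((f ^^ j) y))"
    proof -
      have "(f ^^ j) (f (h y)) = (f ^^ Suc j) (h y)" by (simp add: funpow_swap1)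
      also have "\<dots> = h ((f ^^ Suc j) y)" using iter[OF h y, of "Suc j" 1] by simp
      finally show ?thesis using rel by simp
    qed
    have "(f ^^ (j + t)) y = (f ^^ t) ((f ^^ j) y)" using fadd[of t j y] by (simp add: add.commute)
    also have "\<dots> = (f ^^ t) (h (f ((f ^^ j) y)))" using step by simp
    also have "\<dots> = h ((f ^^ t) (f ((f ^^ j) y)))"
      using iter[OF h mod_homD(1)[OF f fin[OF y]], of t 1] by simp
    also have "(f ^^ t) (f ((f ^^ j) y)) = (f ^^ (j + Suc t)) y"
      using fadd[of "Suc t" j y] by (simp add: add.commute funpow_swap1)
    finally have e: "(f ^^ (j + t)) y = h ((f ^^ (j + Suc t)) y)" .
    show ?case unfolding funpow_Suc_right comp_apply e[symmetric] by (rule Suc)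
  qed simp
  have "M0 \<inter> M1 = {0}"
  proof (intro equalityI subsetI)
    fix u assume u: "u \<in> M0 \<inter> M1"
    then obtain k where k: "u \<in> ?C" "(f ^^ k) u = 0" by (auto simp: M0_def)
    obtain d a where a: "a \<in> A" "mod_act M a u = u"
      and d: "\<And>y0. y0 \<in> ?C \<Longrightarrow> R d (mod_act M a y0)"
      using unit[OF k(1)] by blast
    \<comment> \<open>The preimage is taken for the exponent d, whence the need for a bound
      independent of it. Replacing y0 by its image under \<open>a\<close> is harmless because
      \<open>a\<close> fixes u.\<close>
    obtain y0 where y0: "y0 \<in> ?C" "u = (f ^^ d) y0" using u by (auto simp: M1_def)
    define y where "y = mod_act M a y0"
    have y: "y \<in> ?C" unfolding y_def by (rule linear_actionD(5)[OF M a(1) y0(1)])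
    have uy: "u = (f ^^ d) y" using a(2) mod_homD(4)[OF fk a(1) y0(1)] by (simp add: y_def y0(2))
    obtain j h where j: "j \<le> d" and h: "mod_hom A M M h" "\<forall>v\<in>?C. h (f v) = f (h v)"
      and rel: "(f ^^ j) y = (f ^^ j) (f (h y))"
      using d[OF y0(1)] unfolding R_def y_def by blast
    have "u = (f ^^ (d - j)) ((h ^^ k) ((f ^^ (j + k)) y))"
      using uy fadd[of "d - j" j y] j stable[OF h y rel, of k] by simp
    also have "\<dots> = (h ^^ k) ((f ^^ (d - j)) ((f ^^ (j + k)) y))" using iter[OF h fin[OF y]] by blast
    also have "(f ^^ (d - j)) ((f ^^ (j + k)) y) = (f ^^ k) u"
      using fadd[of "d - j" "j + k" y] fadd[of k d y] uy j by (simp add: add.commute)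
    also have "(h ^^ k) ((f ^^ k) u) = 0" using k(2) mod_hom_zero[OF mod_hom_funpow[OF h(1)] M] by simp
    finally show "u \<in> {0}" by simp
  qed (use s0 s1 in \<open>auto simp: submodule_of_def fun_space.subspace_0\<close>)
  moreover have "?C = {u + c | u c. u \<in> M0 \<and> c \<in> M1}"
  proof (intro equalityI subsetI)
    fix u assume u: "u \<in> ?C"
    obtain d a where a: "a \<in> A" "mod_act M a u = u"
      and d: "\<And>y0. y0 \<in> ?C \<Longrightarrow> R d (mod_act M a y0)"
      using unit[OF u] by blast
    obtain j h where h: "mod_hom A M M h" "\<forall>v\<in>?C. h (f v) = f (h v)" and rel: "(f ^^ j) u = (f ^^ j) (f (h u))"
      using d[OF u] unfolding R_def a(2) by blast
    \<comment> \<open>The component of u in \<open>M1\<close>: by \<open>stable\<close> it is an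
      image of every power of f, and it agrees with u after f^j, so that u - w is in
      \<open>M0\<close>.\<close>
    define w where "w = (h ^^ j) ((f ^^ j) u)"
    have w: "w \<in> ?C" using iter[OF h fin[OF u]] by (simp add: w_def)
    have "w \<in> M1"
      unfolding M1_def
    proof (intro CollectI conjI allI w)
      fix k
      have "w = (h ^^ j) ((h ^^ k) ((f ^^ (j + k)) u))" unfolding w_def using stable[OF h u rel, of k] by simp
      also have "\<dots> = (h ^^ (j + k)) ((f ^^ k) ((f ^^ j) u))"
        using fadd[of k j u] by (simp add: funpow_add add.commute)
      also have "\<dots> = (f ^^ k) ((h ^^ (j + k)) ((f ^^ j) u))"
        using iter[OF h fin[OF u]] by simp
      finally show "\<exists>v\<in>?C. w = (f ^^ k) v" using iter[OF h fin[OF u]] by blast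
    qed
    moreover have "(f ^^ j) w = (f ^^ j) u"
    proof -
      have "(f ^^ j) w = (h ^^ j) ((f ^^ j) ((f ^^ j) u))"
        unfolding w_def using iter[OF h fin[OF u]] by blast
      also have "\<dots> = (h ^^ j) ((f ^^ (j + j)) u)" by (simp only: fadd)
      also have "\<dots> = (f ^^ j) u" by (rule stable[OF h u rel, symmetric])
      finally show ?thesis .
    qed
    then have "(f ^^ j) (u - w) = 0" using mod_hom_diff[OF fk M u w] by simp
    then have "u - w \<in> M0" using linear_actionD(3)[OF M u w] by (auto simp: M0_def)
    moreover have "u = (u - w) + w" by simp
    ultimately show "u \<in> {u + c | u c. u \<in> M0 \<and> c \<in> M1}" by blast
  next
    fix x assume "x \<in> {u + c | u c. u \<in> M0 \<and> c \<in> M1}"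
    then show "x \<in> ?C" using linear_actionD(2)[OF M] by (auto simp: M0_def M1_def)
  qed
  ultimately have "direct_summand A M M0"
    using s0 s1 unfolding direct_summand_def by blast
  then have "M0 = {0} \<or> M0 = ?C" using ind by (auto simp: indecomposable_def)
  then show ?thesis
  proof
    assume "M0 = ?C"
    then show ?thesis by (auto simp: M0_def)
  next
    assume M0: "M0 = {0}"
    have "M1 = ?C"
      using \<open>?C = {u + c | u c. u \<in> M0 \<and> c \<in> M1}\<close> M0 by auto
    have "inj_on f ?C"
    proof (rule inj_onI)
      fix x y assume xy: "x \<in> ?C" "y \<in> ?C" "f x = f y"
      then have "(f ^^ 1) (x - y) = 0" using mod_hom_diff[OF f M xy(1,2)] by simp
      then have "x - y \<in> M0" using linear_actionD(3)[OF M xy(1,2)] unfolding M0_def by blast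
      then show "x = y" using M0 by simp
    qed
    moreover have "f ` ?C = ?C"
    proof (intro equalityI subsetI)
      fix x assume "x \<in> ?C"
      then have "x \<in> M1" using \<open>M1 = ?C\<close> by simp
      then obtain v where "v \<in> ?C" "x = (f ^^ 1) v" unfolding M1_def by blast
      then show "x \<in> f ` ?C" by simp
    qed (use mod_homD(1)[OF f] in blast)
    ultimately show ?thesis by (simp add: bij_betw_def)
  qed
qed

text \<open>If g is not bijective, it is locally nilpotent by \<open>fitting\<close>. Then f = 1 - g
  is injective, because a vector killed by f is fixed by g, and surjective by a geometric series
  that is finite on each vector.\<close>

lemma local_endomorphisms:
  fixes M :: "('k::field, 'a, 'x) kmodule"
  assumes M: "linear_action A M" and lf: "locally_finite A M" and ind: "indecomposable A M"
    and f: "mod_hom A M M f" and g: "mod_hom A M M g"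
    and fg: "\<And>u. u \<in> mod_carrier M \<Longrightarrow> f u + g u = u"
  shows "bij_betw f (mod_carrier M) (mod_carrier M) \<or> bij_betw g (mod_carrier M) (mod_carrier M)"
proof (rule disjCI)
  let ?C = "mod_carrier M"
  assume nb: "\<not> bij_betw g ?C ?C"
  have nilg: "\<exists>k. (g ^^ k) u = 0" if "u \<in> ?C" for u
    using fitting[OF M lf ind g] nb that by blast
  have fu: "f u = u - g u" if "u \<in> ?C" for u using fg[OF that] by (metis add_diff_cancel_right')
  have "inj_on f ?C"
  proof (rule inj_onI)
    fix x y assume xy: "x \<in> ?C" "y \<in> ?C" "f x = f y"
    define z where "z = x - y"
    have z: "z \<in> ?C" using xy linear_actionD(3)[OF M] by (simp add: z_def)
    have "g z = z" using fu[OF z] mod_hom_diff[OF f M xy(1,2)] xy(3) by (simp add: z_def)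
    then have "(g ^^ k) z = z" for k by (induction k) auto
    then show "x = y" using nilg[OF z] by (simp add: z_def)
  qed
  moreover have "f ` ?C = ?C"
  proof (intro equalityI subsetI)
    fix x assume x: "x \<in> ?C"
    obtain k where k: "(g ^^ k) x = 0" using nilg[OF x] by blast
    define y where "y = (\<Sum>i<k. (g ^^ i) x)"
    have gi: "(g ^^ i) x \<in> ?C" for i using mod_homD(1)[OF mod_hom_funpow[OF g] x] .
    have y: "y \<in> ?C" unfolding y_def by (intro linear_action_sum[OF M] gi)
    have "g y = (\<Sum>i<k. (g ^^ Suc i) x)"
      unfolding y_def using mod_hom_sum[OF g M gi] by simp
    then have "f y = (\<Sum>i<k. (g ^^ i) x - (g ^^ Suc i) x)"
      using fu[OF y] by (simp add: y_def sum_subtractf)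
    also have "\<dots> = x" using sum_lessThan_telescope'[of "\<lambda>i. (g ^^ i) x" k] k by simp
    finally show "x \<in> f ` ?C" using y by blast
  qed (use mod_homD(1)[OF f] in blast)
  ultimately show "bij_betw f ?C ?C" by (simp add: bij_betw_def)
qed

text \<open>After division by c, the identity of \<open>Z\<close> is the sum of an endomorphism
  through \<open>P\<close> and one through \<open>Q\<close>. One of the two is bijective, and its
  inverse turns the factorisation into a retraction. This stands in for the exchange property of
  decompositions into indecomposables.\<close>

lemma retract_of_summand:
  fixes P Q :: "('k::field, 'a, 'y) kmodule"
  assumes Z: "linear_action A Z" and lf: "locally_finite A Z" and ind: "indecomposable A Z"
    and M: "linear_action A M" and ZM: "retract_of A Z M"
    and s: "mod_hom A M P s" "mod_hom A P M s'" and t: "mod_hom A M Q t" "mod_hom A Q M t'"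
    and c: "c \<noteq> 0" and st: "\<And>u. u \<in> mod_carrier M \<Longrightarrow> s' (s u) + t' (t u) = fscale c u"
  shows "retract_of A Z P \<or> retract_of A Z Q"
proof -
  obtain i r where i: "mod_hom A Z M i" and r: "mod_hom A M Z r" and ri: "\<And>u. u \<in> mod_carrier Z \<Longrightarrow> r (i u) = u"
    using ZM unfolding retract_of_def by blast
  have red: "retract_of A Z N"
    if s: "mod_hom A M N s" "mod_hom A N M s'" and bij: "bij_betw (\<lambda>u. fscale (1 / c) (r (s' (s (i u))))) (mod_carrier Z) (mod_carrier Z)"
      and hom: "mod_hom A Z Z (\<lambda>u. fscale (1 / c) (r (s' (s (i u)))))" for N :: "('k, 'a, 'y) kmodule" and s s'
    unfolding retract_of_def
  proof (intro exI conjI ballI)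
    let ?f = "\<lambda>u. fscale (1 / c) (r (s' (s (i u))))"
    let ?k = "inv_into (mod_carrier Z) ?f"
    show "mod_hom A Z N (\<lambda>u. s (i u))" by (rule mod_hom_comp[OF i s(1)])
    show "mod_hom A N Z (\<lambda>v. ?k (fscale (1 / c) (r (s' v))))"
      by (rule mod_hom_comp[OF mod_hom_scale[OF mod_hom_comp[OF s(2) r] Z] mod_hom_inv[OF hom Z bij]])
    fix u assume "u \<in> mod_carrier Z"
    then show "?k (fscale (1 / c) (r (s' (s (i u))))) = u" using bij_betw_inv_into_left[OF bij] by simp
  qed
  have hs: "mod_hom A Z Z (\<lambda>u. fscale (1 / c) (r (s' (s (i u)))))"
    by (rule mod_hom_scale[OF mod_hom_comp[OF mod_hom_comp[OF mod_hom_comp[OF i s(1)] s(2)] r] Z])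
  have ht: "mod_hom A Z Z (\<lambda>u. fscale (1 / c) (r (t' (t (i u)))))"
    by (rule mod_hom_scale[OF mod_hom_comp[OF mod_hom_comp[OF mod_hom_comp[OF i t(1)] t(2)] r] Z])
  have "fscale (1 / c) (r (s' (s (i u)))) + fscale (1 / c) (r (t' (t (i u)))) = u"
    if u: "u \<in> mod_carrier Z" for u
  proof -
    have iu: "i u \<in> mod_carrier M" using mod_homD(1)[OF i u] .
    have "r (s' (s (i u))) + r (t' (t (i u))) = r (s' (s (i u)) + t' (t (i u)))"
      using mod_homD(2)[OF r] mod_homD(1)[OF s(2) mod_homD(1)[OF s(1) iu]]
        mod_homD(1)[OF t(2) mod_homD(1)[OF t(1) iu]] by simp
    also have "\<dots> = fscale c u" using st[OF iu] mod_homD(3)[OF r iu] ri[OF u] by simp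
    finally show ?thesis using c by (simp add: fun_space.scale_right_distrib[symmetric])
  qed
  from local_endomorphisms[OF Z lf ind hs ht this]
  show ?thesis
  proof
    assume bij: "bij_betw (\<lambda>u. fscale (1 / c) (r (s' (s (i u))))) (mod_carrier Z) (mod_carrier Z)"
    show ?thesis using red[OF s bij hs] by simp
  next
    assume bij: "bij_betw (\<lambda>u. fscale (1 / c) (r (t' (t (i u))))) (mod_carrier Z) (mod_carrier Z)"
    show ?thesis using red[OF t bij ht] by simp
  qed
qed

lemma locally_finite_restrict:
  assumes "linear_action A M" "locally_finite A M" "submodule_of A M U"
  shows "locally_finite A (mod_restrict M U)"
  using assms unfolding locally_finite_def submodule_of_def by (simp add: subset_iff) meson

section \<open>Modules presented by words with coloured positions\<close>

text \<open>Positions with the same colour are symmetric for a colour \<open>Inl i\<close> and antisymmetric for a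
  colour \<open>Inr i\<close>.\<close>

definition colour_sign :: "nat + nat \<Rightarrow> 'k::field" where
  "colour_sign x = (case x of Inl _ \<Rightarrow> 1 | Inr _ \<Rightarrow> - 1)"

lemma colour_sign_simps [simp]: "colour_sign (Inl i) = 1" "colour_sign (Inr i) = - 1"
  by (simp_all add: colour_sign_def)

abbreviation swap :: "nat \<Rightarrow> nat \<Rightarrow> nat \<Rightarrow> nat" where
  "swap \<equiv> Transposition.transpose"

text \<open>
  \<open>W\<close> is a set of words on which the permutations of the set \<open>P\<close> of positions act from the right;
  an element \<open>a\<close> of \<open>A\<close> acts on the left by the matrix \<open>\<kappa> a\<close>, which commutes with that action.
\<close>

locale signed_words =
  fixes A :: "'a set" and W :: "'w set" and P :: "nat set"
    and ract :: "'w \<Rightarrow> (nat \<Rightarrow> nat) \<Rightarrow> 'w" and \<kappa> :: "'a \<Rightarrow> 'w \<Rightarrow> 'w \<Rightarrow> 'k::field"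
  assumes finite_P: "finite P"
    and ract_closed: "\<And>w \<sigma>. w \<in> W \<Longrightarrow> \<sigma> permutes P \<Longrightarrow> ract w \<sigma> \<in> W"
    and ract_id: "\<And>w. w \<in> W \<Longrightarrow> ract w id = w"
    and ract_comp: "\<And>w \<sigma> \<tau>. w \<in> W \<Longrightarrow> \<sigma> permutes P \<Longrightarrow> \<tau> permutes P \<Longrightarrow> ract (ract w \<sigma>) \<tau> = ract w (\<sigma> \<circ> \<tau>)"
    and \<kappa>_finite: "\<And>a w. a \<in> A \<Longrightarrow> w \<in> W \<Longrightarrow> finite {v \<in> W. \<kappa> a v w \<noteq> 0}"
    and \<kappa>_ract: "\<And>a v w \<sigma>. a \<in> A \<Longrightarrow> v \<in> W \<Longrightarrow> w \<in> W \<Longrightarrow> \<sigma> permutes P \<Longrightarrow>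
      \<kappa> a (ract v \<sigma>) (ract w \<sigma>) = \<kappa> a v w"
    and local_unit: "\<And>F. finite F \<Longrightarrow> F \<subseteq> W \<Longrightarrow> \<exists>a\<in>A. \<exists>T. finite T \<and> T \<subseteq> W \<and>
      (\<forall>w\<in>F. \<forall>v\<in>W. \<kappa> a v w = (if v = w then 1 else 0)) \<and>
      (\<forall>w\<in>W. \<forall>v\<in>W. \<kappa> a v w \<noteq> 0 \<longrightarrow> v \<in> T)"
begin

text \<open>The linear forms on the quotient, seen as functions on words. Scalar values are enough,
  as a vector-valued map is tested one coordinate at a time.\<close>

definition compatible :: "(nat \<Rightarrow> nat + nat) \<Rightarrow> ('w \<Rightarrow> 'k) \<Rightarrow> bool" where
  "compatible c G \<longleftrightarrow> (\<forall>w\<in>W. \<forall>i\<in>P. \<forall>j\<in>P. i \<noteq> j \<and> c i = c j \<longrightarrow>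
     G (ract w (swap i j)) = colour_sign (c i) * G w)"

text \<open>Instead of a universal property, which would quantify over all vector spaces, a set \<open>B\<close> of
  normal forms is required.\<close>

definition presents :: "(nat \<Rightarrow> nat + nat) \<Rightarrow> ('k, 'a, 'x) kmodule \<Rightarrow> ('w \<Rightarrow> ('x \<Rightarrow> 'k)) \<Rightarrow> bool" where
  "presents c K q \<longleftrightarrow> linear_action A K \<and>
     (\<forall>x. compatible c (\<lambda>w. q w x)) \<and> mod_carrier K = fun_space.span (q ` W) \<and>
     (\<exists>B\<subseteq>W. inj_on q B \<and> fun_space.independent (q ` B) \<and>
        (\<forall>w\<in>W. \<exists>b\<in>B. \<exists>s. \<forall>G. compatible c G \<longrightarrow> G w = s * G b)) \<and>
     (\<forall>a\<in>A. \<forall>w\<in>W. mod_act K a (q w) = (\<Sum>v | v \<in> W \<and> \<kappa> a v w \<noteq> 0. fscale (\<kappa> a v w) (q v)))"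

lemma presentsD:
  assumes "presents c K q"
  shows "linear_action A K" "compatible c (\<lambda>w. q w x)" "mod_carrier K = fun_space.span (q ` W)"
    "w \<in> W \<Longrightarrow> q w \<in> mod_carrier K"
    "a \<in> A \<Longrightarrow> w \<in> W \<Longrightarrow> mod_act K a (q w) = (\<Sum>v | v \<in> W \<and> \<kappa> a v w \<noteq> 0. fscale (\<kappa> a v w) (q v))"
  using assms fun_space.span_base unfolding presents_def by blast+

lemma presents_hom_eqI:
  assumes K: "presents c K q" and f: "mod_hom A' K N f" and g: "mod_hom A'' K N g"
    and eq: "\<And>w. w \<in> W \<Longrightarrow> f (q w) = g (q w)" and u: "u \<in> mod_carrier K"
  shows "f u = g u"
proof -
  note lin = presentsD(1)[OF K] 
  have lin0: "linear_action {} K" using lin by (simp add: linear_action_def)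
  have f0: "mod_hom {} K N f" and g0: "mod_hom {} K N g" using f g by (simp_all add: mod_hom_def)
  have "u \<in> mod_carrier K \<and> f u = g u"
    using u unfolding presentsD(3)[OF K]
  proof (induction rule: fun_space.span_induct_alt)
    case base
    have "0 \<in> fun_space.span (q ` W) \<and> f 0 = g 0"
      using mod_hom_zero[OF f0 lin0] mod_hom_zero[OF g0 lin0] fun_space.span_zero by metis
    then show ?case .
  next
    case (step c x y)
    then obtain w where w: "w \<in> W" "x = q w" by blast
    have x: "x \<in> mod_carrier K" using presentsD(4)[OF K w(1)] w(2) by simp
    have y: "y \<in> mod_carrier K" "f y = g y" using step presentsD(3)[OF K] by auto
    have cx: "fscale c x \<in> mod_carrier K" using linear_actionD(4)[OF lin x] .
    have "f (fscale c x + y) = g (fscale c x + y)"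
      using mod_homD(2)[OF f0 cx y(1)] mod_homD(2)[OF g0 cx y(1)] mod_homD(3)[OF f0 x] mod_homD(3)[OF g0 x]
        eq[OF w(1)] w(2) y(2) by simp
    then have "fscale c x + y \<in> fun_space.span (q ` W) \<and> f (fscale c x + y) = g (fscale c x + y)"
      using linear_actionD(2)[OF lin cx y(1)] presentsD(3)[OF K] by simp
    then show ?case .
  qed
  then show ?thesis by blast
qed

lemma presents_universal:
  fixes F :: "'w \<Rightarrow> ('y \<Rightarrow> 'k)" and q :: "'w \<Rightarrow> ('x \<Rightarrow> 'k)"
  assumes K: "presents c K q" and F: "\<And>x. compatible c (\<lambda>w. F w x)"
  obtains \<phi> where "Vector_Spaces.linear fscale fscale \<phi>" "\<And>w. w \<in> W \<Longrightarrow> \<phi> (q w) = F w"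
proof -
  obtain B where B: "B \<subseteq> W" "inj_on q B" "fun_space.independent (q ` B)"
    and nf: "\<forall>w\<in>W. \<exists>b\<in>B. \<exists>s. \<forall>G. compatible c G \<longrightarrow> G w = s * G b"
    using K unfolding presents_def by blast
  interpret vector_space_pair "fscale :: 'k \<Rightarrow> ('x \<Rightarrow> 'k) \<Rightarrow> _" "fscale :: 'k \<Rightarrow> ('y \<Rightarrow> 'k) \<Rightarrow> _" ..
  obtain \<phi> where \<phi>: "Vector_Spaces.linear fscale fscale \<phi>" "\<forall>x\<in>q ` B. \<phi> x = F (inv_into B q x)"
    using linear_independent_extend[OF B(3), of "\<lambda>x. F (inv_into B q x)"] by blast
  have "\<phi> (q w) = F w" if w: "w \<in> W" for w
  proof -
    obtain b s where b: "b \<in> B" and s: "\<And>G. compatible c G \<Longrightarrow> G w = s * G b" using nf w by blast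
    have "q w = fscale s (q b)" using s[OF presentsD(2)[OF K]] by (simp add: fun_eq_iff fscale_def)
    moreover have "F w = fscale s (F b)" using s[OF F] by (simp add: fun_eq_iff fscale_def)
    moreover have "\<phi> (q b) = F b" using \<phi>(2) b inv_into_f_f[OF B(2) b] by simp
    ultimately show ?thesis
      using \<phi>(1) by (simp add: Vector_Spaces.linear_iff)
  qed
  then show ?thesis using that \<phi>(1) by blast
qed

text \<open>Right translations commute with the left action, so a combination of them is a
  homomorphism once it respects the relations. The last hypothesis states this dually: compatible
  functions of the target pull back to compatible functions of the source. Combinations of
  transpositions with one fixed position \<open>b\<close> cover all maps of the Koszul
  identity.\<close>

lemma presents_hom:
  fixes q :: "'w \<Rightarrow> ('x \<Rightarrow> 'k)" and q' :: "'w \<Rightarrow> ('y \<Rightarrow> 'k)"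
  assumes K: "presents c K q" and K': "presents c' K' q'"
    and I: "finite I" "\<And>x. x \<in> I \<Longrightarrow> swap x b permutes P"
    and F: "\<And>G. compatible c' G \<Longrightarrow> compatible c (\<lambda>w. \<Sum>x\<in>I. \<theta> x * G (ract w (swap x b)))"
  obtains \<phi> where "mod_hom A K K' \<phi>"
    "\<And>w. w \<in> W \<Longrightarrow> \<phi> (q w) = (\<Sum>x\<in>I. fscale (\<theta> x) (q' (ract w (swap x b))))"
proof -
  let ?F = "\<lambda>w. \<Sum>x\<in>I. fscale (\<theta> x) (q' (ract w (swap x b)))"
  have ev: "?F w y = (\<Sum>x\<in>I. \<theta> x * q' (ract w (swap x b)) y)" for w y
    using I(1) by (induction I rule: finite_induct) (auto simp: fscale_def)
  have "compatible c (\<lambda>w. ?F w y)" for y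
    unfolding ev by (rule F[OF presentsD(2)[OF K']])
  then obtain \<phi> where lin: "Vector_Spaces.linear fscale fscale \<phi>" and \<phi>: "\<And>w. w \<in> W \<Longrightarrow> \<phi> (q w) = ?F w"
    using presents_universal[OF K, of ?F] by metis
  have add: "\<phi> (u + v) = \<phi> u + \<phi> v" and scale: "\<phi> (fscale s u) = fscale s (\<phi> u)" for u v s
    using lin by (auto simp: Vector_Spaces.linear_iff)
  have zero: "\<phi> 0 = 0" using scale[of 0 0] by simp
  have sum: "\<phi> (\<Sum>i\<in>J. g i) = (\<Sum>i\<in>J. \<phi> (g i))" for J and g :: "'w \<Rightarrow> _"
    using module_hom.sum[OF Vector_Spaces.linear.axioms(3)[OF lin]] .
  note l = presentsD(1)[OF K] and l' = presentsD(1)[OF K']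
  have Fin: "?F w \<in> mod_carrier K'" if "w \<in> W" for w
    using that ract_closed I(2)
    by (intro linear_action_sum[OF l'] linear_actionD(4)[OF l'] presentsD(4)[OF K']) auto
  have in': "\<phi> u \<in> mod_carrier K'" if "u \<in> mod_carrier K" for u
    using that unfolding presentsD(3)[OF K]
  proof (induction rule: fun_space.span_induct_alt)
    case base
    have "\<phi> 0 \<in> mod_carrier K'" using zero linear_actionD(1)[OF l'] by simp
    then show ?case .
  next
    case (step s x y)
    then obtain w where "w \<in> W" "x = q w" by blast
    then have "\<phi> (fscale s x + y) \<in> mod_carrier K'"
      using step \<phi> Fin add scale linear_actionD(2,4)[OF l'] by simp
    then show ?case .
  qed
  have comm: "\<phi> (mod_act K a u) = mod_act K' a (\<phi> u)" if a: "a \<in> A" and u: "u \<in> mod_carrier K" for a u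
  proof (rule presents_hom_eqI[OF K _ _ _ u, of "{}" _ "\<lambda>u. \<phi> (mod_act K a u)" "{}" "\<lambda>u. mod_act K' a (\<phi> u)"])
    show "mod_hom {} K K' (\<lambda>u. \<phi> (mod_act K a u))"
      using a in' by (auto simp: mod_hom_def add scale linear_actionD[OF l])
    show "mod_hom {} K K' (\<lambda>u. mod_act K' a (\<phi> u))"
      using a in' by (auto simp: mod_hom_def add scale linear_actionD[OF l'])
    fix w assume w: "w \<in> W"
    let ?V = "{v. v \<in> W \<and> \<kappa> a v w \<noteq> 0}"
    have "\<phi> (mod_act K a (q w)) = (\<Sum>v\<in>?V. fscale (\<kappa> a v w) (?F v))"
      using \<phi> by (simp add: presentsD(5)[OF K a w] sum scale)
    also have "\<dots> = (\<Sum>v\<in>?V. \<Sum>x\<in>I. fscale (\<theta> x) (fscale (\<kappa> a v w) (q' (ract v (swap x b)))))"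
      by (simp add: fun_space.scale_sum_right mult.commute)
    also have "\<dots> = (\<Sum>x\<in>I. \<Sum>v\<in>?V. fscale (\<theta> x) (fscale (\<kappa> a v w) (q' (ract v (swap x b)))))"
      by (rule sum.swap)
    also have "\<dots> = (\<Sum>x\<in>I. fscale (\<theta> x) (mod_act K' a (q' (ract w (swap x b)))))"
    proof (rule sum.cong)
      fix x assume x: "x \<in> I"
      let ?t = "swap x b"
      have t: "?t permutes P" using I(2)[OF x] .
      have tt: "ract (ract v ?t) ?t = v" if "v \<in> W" for v
        using ract_comp[OF that t t] ract_id[OF that] by simp
      \<comment> \<open>Translation by the involution \<open>?t\<close> permutes the words, and
        \<kappa> is invariant under simultaneous translation of both arguments.\<close>
      have "(\<Sum>v\<in>?V. fscale (\<kappa> a v w) (q' (ract v ?t))) =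
          (\<Sum>v | v \<in> W \<and> \<kappa> a v (ract w ?t) \<noteq> 0. fscale (\<kappa> a v (ract w ?t)) (q' v))"
      proof (rule sum.reindex_bij_witness[of _ "\<lambda>v. ract v ?t" "\<lambda>v. ract v ?t"])
        fix v assume "v \<in> {v. v \<in> W \<and> \<kappa> a v (ract w ?t) \<noteq> 0}"
        then show "ract v ?t \<in> ?V"
          using \<kappa>_ract[OF a _ ract_closed[OF w t] t, of v] tt[OF w] ract_closed t by simp
      qed (use \<kappa>_ract[OF a _ w t] ract_closed[OF _ t] tt in auto)
      then show "(\<Sum>v\<in>?V. fscale (\<theta> x) (fscale (\<kappa> a v w) (q' (ract v ?t)))) =
          fscale (\<theta> x) (mod_act K' a (q' (ract w ?t)))"
        by (simp add: presentsD(5)[OF K' a ract_closed[OF w t]] fun_space.scale_sum_right[symmetric] del: fun_space.scale_scale)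
    qed simp
    also have "\<dots> = mod_act K' a (\<phi> (q w))"
    proof -
      have h: "mod_hom {} K' K' (mod_act K' a)" "linear_action {} K'"
        using a l' by (auto simp: mod_hom_def linear_actionD[OF l']) (simp add: linear_action_def)
      have "mod_act K' a (?F w) = (\<Sum>x\<in>I. mod_act K' a (fscale (\<theta> x) (q' (ract w (swap x b)))))"
        using w ract_closed I(2) by (intro mod_hom_sum[OF h] linear_actionD(4)[OF l'] presentsD(4)[OF K']) auto
      then show ?thesis
        using w ract_closed I(2) by (simp add: \<phi> linear_actionD(7)[OF l' a presentsD(4)[OF K']])
    qed
    finally show "\<phi> (mod_act K a (q w)) = mod_act K' a (\<phi> (q w))" .
  qed
  have "mod_hom A K K' \<phi>" using in' comm by (simp add: mod_hom_def add scale)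
  then show ?thesis using that \<phi> by blast
qed

text \<open>A vector involves finitely many words. A local unit for these words fixes it, and the
  image of the local unit on the whole module is spanned by the images of the finitely many words in
  \<open>T\<close>.\<close>

lemma presents_locally_finite:
  assumes K: "presents c K q"
  shows "locally_finite A K"
  unfolding locally_finite_def
proof
  note l = presentsD(1)[OF K]
  fix u assume u: "u \<in> mod_carrier K"
  then obtain S r where S: "finite S" "S \<subseteq> q ` W" "u = (\<Sum>s\<in>S. fscale (r s) s)"
    unfolding presentsD(3)[OF K] fun_space.span_explicit by blast
  obtain F where F: "F \<subseteq> W" "finite F" "S = q ` F" using S(1,2) finite_subset_image by metis
  obtain a T where a: "a \<in> A" and T: "finite T" "T \<subseteq> W"
    and unit: "\<forall>w\<in>F. \<forall>v\<in>W. \<kappa> a v w = (if v = w then 1 else 0)"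
    and img: "\<forall>w\<in>W. \<forall>v\<in>W. \<kappa> a v w \<noteq> 0 \<longrightarrow> v \<in> T"
    using local_unit[OF F(2,1)] by blast
  have h: "mod_hom {} K K (mod_act K a)" "linear_action {} K"
    using a l by (auto simp: mod_hom_def linear_actionD[OF l]) (simp add: linear_action_def)
  have "mod_act K a s = s" if "s \<in> S" for s
  proof -
    obtain w where w: "w \<in> F" "s = q w" using \<open>s \<in> S\<close> F(3) by blast
    then have wW: "w \<in> W" using F(1) by blast
    have "{v. v \<in> W \<and> \<kappa> a v w \<noteq> 0} = {w}" using unit w(1) wW by (auto split: if_splits)
    then show ?thesis using presentsD(5)[OF K a wW] unit w wW by simp
  qed
  moreover have SK: "s \<in> mod_carrier K" if "s \<in> S" for s using that S(2) presentsD(4)[OF K] by blast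
  ultimately have "mod_act K a u = u"
    unfolding S(3) using mod_hom_sum[OF h, of S "\<lambda>s. fscale (r s) s"] linear_actionD(4,7)[OF l] a by simp
  moreover have "mod_act K a v \<in> fun_space.span (q ` T)" if "v \<in> mod_carrier K" for v
  proof -
    have "v \<in> mod_carrier K \<and> mod_act K a v \<in> fun_space.span (q ` T)"
      using that unfolding presentsD(3)[OF K]
    proof (induction rule: fun_space.span_induct_alt)
      case base
      have "0 \<in> fun_space.span (q ` W) \<and> mod_act K a 0 \<in> fun_space.span (q ` T)"
        using mod_hom_zero[OF h] fun_space.span_zero by metis
      then show ?case .
    next
      case (step s x y)
      then obtain w where w: "w \<in> W" "x = q w" by blast
      have x: "x \<in> mod_carrier K" and y: "y \<in> mod_carrier K"
        using w presentsD(4)[OF K] step presentsD(3)[OF K] by auto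
      have "mod_act K a x \<in> fun_space.span (q ` T)"
        unfolding w(2) presentsD(5)[OF K a w(1)] using img w(1)
        by (intro fun_space.span_sum fun_space.span_scale fun_space.span_base) auto
      then have "fscale s (mod_act K a x) + mod_act K a y \<in> fun_space.span (q ` T)"
        using step by (intro fun_space.span_add fun_space.span_scale) auto
      then have "fscale s x + y \<in> fun_space.span (q ` W) \<and> mod_act K a (fscale s x + y) \<in> fun_space.span (q ` T)"
        using linear_actionD(2)[OF l linear_actionD(4)[OF l x] y] presentsD(3)[OF K]
          linear_actionD(6)[OF l a linear_actionD(4)[OF l x] y] linear_actionD(7)[OF l a x] by simp
      then show ?case .
    qed
    then show ?thesis by blast
  qed
  ultimately show "\<exists>a\<in>A. \<exists>T. finite T \<and> mod_act K a u = u \<and> (\<forall>v\<in>mod_carrier K. mod_act K a v \<in> fun_space.span T)"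
    using a T(1) by (intro bexI[of _ a] exI[of _ "q ` T"]) auto
qed

section \<open>Dependence of the presented module on the colouring\<close>

lemma compatible_cong:
  assumes "\<And>i. i \<in> P \<Longrightarrow> c' i = f (c i)" "inj_on f (c ` P)" "\<And>i. i \<in> P \<Longrightarrow> (colour_sign (f (c i)) :: 'k) = colour_sign (c i)"
  shows "compatible c' G \<longleftrightarrow> compatible c G"
proof -
  have "c' i = c' j \<longleftrightarrow> c i = c j" if "i \<in> P" "j \<in> P" for i j
    using assms(1,2) that by (auto simp: inj_on_def)
  moreover have "(colour_sign (c' i) :: 'k) = colour_sign (c i)" if "i \<in> P" for i
    using assms(1,3) that by simp
  ultimately show ?thesis unfolding compatible_def by simp
qed

lemma presents_recolour:
  assumes "presents c K q"
    and "\<And>i. i \<in> P \<Longrightarrow> c' i = f (c i)" "inj_on f (c ` P)" "\<And>i. i \<in> P \<Longrightarrow> (colour_sign (f (c i)) :: 'k) = colour_sign (c i)"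
  shows "presents c' K q"
proof -
  have "compatible c' = compatible c" using compatible_cong[OF assms(2-4)] by blast
  then show ?thesis using assms(1) by (simp add: presents_def)
qed

text \<open>The module is unchanged; only colouring and quotient map are rewritten. Since the
  conjugate of a transposition exchanges the images of the two positions, precomposition with a
  translation exchanges the functions compatible with \<open>c\<close> and those compatible with
  \<open>c \<circ> \<rho>\<close>.\<close>

lemma presents_permute:
  assumes K: "presents c K q" and \<rho>: "\<rho> permutes P"
  shows "presents (c \<circ> \<rho>) K (\<lambda>w. q (ract w (inv_into UNIV \<rho>)))"
proof -
  have i: "inv_into UNIV \<rho> permutes P" using permutes_inv[OF \<rho>] .
  have bk: "ract (ract w (inv_into UNIV \<rho>)) \<rho> = w" "ract (ract w \<rho>) (inv_into UNIV \<rho>) = w" if "w \<in> W" for w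
    using ract_comp[OF that i \<rho>] ract_comp[OF that \<rho> i] ract_id[OF that]
      permutes_inv_o[OF \<rho>] by simp_all
  have resp: "compatible (c \<circ> \<rho>) (\<lambda>w. G (ract w (inv_into UNIV \<rho>)))" if G: "compatible c G" for G
    unfolding compatible_def
  proof (intro ballI impI)
    fix w j l assume w: "w \<in> W" and j: "j \<in> P" "l \<in> P" "j \<noteq> l \<and> (c \<circ> \<rho>) j = (c \<circ> \<rho>) l"
    have t: "swap j l permutes P" using j by (intro permutes_swap_id) auto
    have t': "swap (\<rho> j) (\<rho> l) permutes P" using j \<rho> by (intro permutes_swap_id) (auto simp: permutes_in_image)
    have "swap j l \<circ> inv_into UNIV \<rho> = inv_into UNIV \<rho> \<circ> swap (\<rho> j) (\<rho> l)"
    proof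
      fix x show "(swap j l \<circ> inv_into UNIV \<rho>) x = (inv_into UNIV \<rho> \<circ> swap (\<rho> j) (\<rho> l)) x"
        using permutes_inverses[OF \<rho>] by (auto simp: Transposition.transpose_def; metis permutes_inverses[OF \<rho>])
    qed
    then have "ract (ract w (swap j l)) (inv_into UNIV \<rho>) = ract (ract w (inv_into UNIV \<rho>)) (swap (\<rho> j) (\<rho> l))"
      using ract_comp w t t' i by simp
    moreover have "\<rho> j \<noteq> \<rho> l" using j(3) permutes_inj[OF \<rho>] by (auto dest: injD)
    moreover have "\<rho> j \<in> P" "\<rho> l \<in> P" using j \<rho> by (auto simp: permutes_in_image)
    ultimately show "G (ract (ract w (swap j l)) (inv_into UNIV \<rho>)) = colour_sign ((c \<circ> \<rho>) j) * G (ract w (inv_into UNIV \<rho>))"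
      using G ract_closed[OF w i] j(3) unfolding compatible_def by simp
  qed
  have resp': "compatible c (\<lambda>w. G (ract w \<rho>))" if G: "compatible (c \<circ> \<rho>) G" for G
    unfolding compatible_def
  proof (intro ballI impI)
    fix w j l assume w: "w \<in> W" and j: "j \<in> P" "l \<in> P" "j \<noteq> l \<and> c j = c l"
    let ?j = "inv_into UNIV \<rho> j" and ?l = "inv_into UNIV \<rho> l"
    have jl: "\<rho> ?j = j" "\<rho> ?l = l" using permutes_inverses[OF \<rho>] by auto
    have P: "?j \<in> P" "?l \<in> P" using j i by (auto simp: permutes_in_image)
    have t: "swap j l permutes P" using j by (intro permutes_swap_id) auto
    have t': "swap ?j ?l permutes P" using P by (intro permutes_swap_id) auto
    have "swap j l \<circ> \<rho> = \<rho> \<circ> swap ?j ?l"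
    proof
      fix x show "(swap j l \<circ> \<rho>) x = (\<rho> \<circ> swap ?j ?l) x"
        using permutes_inverses[OF \<rho>] by (auto simp: Transposition.transpose_def; metis permutes_inverses[OF \<rho>])
    qed
    then have "ract (ract w (swap j l)) \<rho> = ract (ract w \<rho>) (swap ?j ?l)"
      using ract_comp w t t' \<rho> by simp
    moreover have "?j \<noteq> ?l" using j(3) jl by auto
    ultimately show "G (ract (ract w (swap j l)) \<rho>) = colour_sign (c j) * G (ract w \<rho>)"
      using G ract_closed[OF w \<rho>] j(3) P jl unfolding compatible_def by simp
  qed
  obtain B where B: "B \<subseteq> W" "inj_on q B" "fun_space.independent (q ` B)"
    and nf: "\<forall>w\<in>W. \<exists>b\<in>B. \<exists>s. \<forall>G. compatible c G \<longrightarrow> G w = s * G b"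
    using K unfolding presents_def by blast
  let ?q = "\<lambda>w. q (ract w (inv_into UNIV \<rho>))" and ?B = "(\<lambda>b. ract b \<rho>) ` B"
  have qB: "?q (ract b \<rho>) = q b" if "b \<in> B" for b using bk(2) that B(1) by auto
  have W: "(\<lambda>w. ract w (inv_into UNIV \<rho>)) ` W = W"
    using bk(2) ract_closed[OF _ i] ract_closed[OF _ \<rho>] by (auto simp: image_iff) metis
  show ?thesis
    unfolding presents_def
  proof (intro conjI allI ballI)
    show "linear_action A K" by (rule presentsD(1)[OF K])
    show "compatible (c \<circ> \<rho>) (\<lambda>w. ?q w x)" for x by (rule resp[OF presentsD(2)[OF K]])
    have "?q ` W = q ` W" using W by (metis image_image)
    then show "mod_carrier K = fun_space.span (?q ` W)" using presentsD(3)[OF K] by simp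
    have "inj_on ?q ?B" using B(2) qB by (auto simp: inj_on_def)
    moreover have "?q ` ?B = q ` B" using qB by (force simp: image_iff)
    moreover have "?B \<subseteq> W" using B(1) ract_closed[OF _ \<rho>] by auto
    moreover have "\<exists>b\<in>?B. \<exists>s. \<forall>G. compatible (c \<circ> \<rho>) G \<longrightarrow> G w = s * G b" if w: "w \<in> W" for w
    proof -
      obtain b s where b: "b \<in> B" and s: "\<And>G. compatible c G \<Longrightarrow> G (ract w (inv_into UNIV \<rho>)) = s * G b"
        using nf ract_closed[OF w i] by blast
      have "G w = s * G (ract b \<rho>)" if "compatible (c \<circ> \<rho>) G" for G
        using s[OF resp'[OF that]] bk(1)[OF w] by simp
      then show ?thesis using b by blast
    qed
    ultimately show "\<exists>B\<subseteq>W. inj_on ?q B \<and> fun_space.independent (?q ` B) \<and>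
        (\<forall>w\<in>W. \<exists>b\<in>B. \<exists>s. \<forall>G. compatible (c \<circ> \<rho>) G \<longrightarrow> G w = s * G b)"
      using B(3) by (intro exI[of _ ?B]) simp
    fix a w assume a: "a \<in> A" and w: "w \<in> W"
    have "(\<Sum>v | v \<in> W \<and> \<kappa> a v (ract w (inv_into UNIV \<rho>)) \<noteq> 0. fscale (\<kappa> a v (ract w (inv_into UNIV \<rho>))) (q v)) =
      (\<Sum>v | v \<in> W \<and> \<kappa> a v w \<noteq> 0. fscale (\<kappa> a v w) (?q v))"
    proof (rule sum.reindex_bij_witness[of _ "\<lambda>v. ract v (inv_into UNIV \<rho>)" "\<lambda>v. ract v \<rho>"])
      fix v assume v: "v \<in> {v. v \<in> W \<and> \<kappa> a v (ract w (inv_into UNIV \<rho>)) \<noteq> 0}"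
      then have e: "\<kappa> a (ract v \<rho>) w = \<kappa> a v (ract w (inv_into UNIV \<rho>))"
        using \<kappa>_ract[OF a _ ract_closed[OF w i] \<rho>, of v] bk(1)[OF w] by simp
      then show "ract v \<rho> \<in> {v. v \<in> W \<and> \<kappa> a v w \<noteq> 0}" using v ract_closed[OF _ \<rho>] by simp
      show "fscale (\<kappa> a (ract v \<rho>) w) (?q (ract v \<rho>)) = fscale (\<kappa> a v (ract w (inv_into UNIV \<rho>))) (q v)"
        using e v bk(2) by simp
    qed (use bk \<kappa>_ract[OF a _ w i] ract_closed[OF _ i] in auto)
    then show "mod_act K a (?q w) = (\<Sum>v | v \<in> W \<and> \<kappa> a v w \<noteq> 0. fscale (\<kappa> a v w) (?q v))"
      using presentsD(5)[OF K a ract_closed[OF w i]] by simp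
  qed
qed

text \<open>Colourings with equally large classes differ by a permutation of the positions. Hence
  only the sizes of the colour classes matter.\<close>

lemma presents_mset:
  assumes K: "presents c K q"
    and "image_mset c' (mset_set P) = image_mset c (mset_set P)"
  obtains q' where "presents c' K q'"
proof -
  obtain \<rho> where \<rho>: "\<rho> permutes P" "\<forall>x\<in>P. c' x = c (\<rho> x)"
    using image_mset_eq_implies_permutes[OF finite_P assms(2)] by blast
  have "presents c' K (\<lambda>w. q (ract w (inv_into UNIV \<rho>)))"
    by (rule presents_recolour[OF presents_permute[OF K \<rho>(1)], of _ id]) (use \<rho>(2) in auto)
  then show ?thesis using that by blast
qed

lemma presents_retract:
  assumes K: "presents c K q" and K': "presents c K' q'"
  shows "retract_of A K K'"
proof -
  \<comment> \<open>The identity on words is written in the shape required by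
    \<open>presents_hom\<close>: transposing 0 with itself is the identity, whether or not 0 is a
    position.\<close>
  have F: "compatible c (\<lambda>w. \<Sum>x\<in>{0}. 1 * G (ract w (swap x 0)))" if "compatible c G" for G
    using that unfolding compatible_def by (simp add: ract_id ract_closed permutes_swap_id)
  obtain f where f: "mod_hom A K K' f" "\<And>w. w \<in> W \<Longrightarrow> f (q w) = (\<Sum>x\<in>{0}. fscale 1 (q' (ract w (swap x 0))))"
    using presents_hom[OF K K', of "{0}" 0 "\<lambda>_. 1"] F by (auto simp: permutes_id)
  obtain g where g: "mod_hom A K' K g" "\<And>w. w \<in> W \<Longrightarrow> g (q' w) = (\<Sum>x\<in>{0}. fscale 1 (q (ract w (swap x 0))))"
    using presents_hom[OF K' K, of "{0}" 0 "\<lambda>_. 1"] F by (auto simp: permutes_id)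
  have "g (f u) = u" if "u \<in> mod_carrier K" for u
    using presents_hom_eqI[OF K mod_hom_comp[OF f(1) g(1)] mod_hom_id _ that] f(2) g(2) ract_id by simp
  then show ?thesis unfolding retract_of_def using f(1) g(1) by (intro exI conjI ballI)
qed

end

section \<open>Signed sums over transpositions and the Koszul maps\<close>

context signed_words
begin

text \<open>Each transposition inside \<open>S\<close> contributes -1. \<open>S\<close> may be
  smaller than the colour class; it is applied to a class from which one position has been
  removed.\<close>

lemma compatible_sign:
  assumes G: "compatible c G" and S: "S \<subseteq> P" "\<And>x. x \<in> S \<Longrightarrow> c x = Inr k"
    and h: "h permutes S" and w: "w \<in> W"
  shows "G (ract w h) = of_int (sign h) * G w"
proof -
  have fS: "finite S" using S(1) finite_P finite_subset by blast
  show ?thesis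
    using fS h
  proof (induction rule: permutes_rev_induct)
    case id
    have "G (ract w id) = of_int (sign (id :: nat \<Rightarrow> nat)) * G w"
      unfolding ract_id[OF w] sign_id by simp
    then show ?case .
  next
    case (swap a b p)
    have p: "p permutes P" using permutes_subset[OF swap(4) S(1)] .
    have ab: "a \<in> P" "b \<in> P" using swap(1,2) S(1) by auto
    have t: "swap a b permutes P" using ab by (intro permutes_swap_id) auto
    have "permutation p" using swap(4) fS permutation_permutes by blast
    then have "sign (p \<circ> swap a b) = - sign p"
      using sign_compose[of p "swap a b"] permutation_swap_id[of a b] swap(3) by (simp add: sign_swap_id)
    moreover have "G (ract w (p \<circ> swap a b)) = - G (ract w p)"
      using G ract_closed[OF w p] ab swap(1-3) S(2) ract_comp[OF w p t]
      unfolding compatible_def by force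
    ultimately have "G (ract w (p \<circ> swap a b)) = of_int (sign (p \<circ> swap a b)) * G w"
      using swap(5) by simp
    then show ?case .
  qed
qed

text \<open>The sum over the coset representatives \<open>(x b)\<close> of the signed permutations of the colour class of
  \<open>b\<close> modulo the stabiliser of \<open>b\<close>: the map from the exterior power into the product with the natural
  module, and the Koszul differential.\<close>

lemma compatible_split:
  assumes G: "compatible (c(b := \<gamma>)) G" and b: "b \<in> P" "c b = Inr k"
    and B: "B = {x \<in> P. c x = c b}"
  shows "compatible c (\<lambda>w. \<Sum>x\<in>B. of_int (sign (swap x b)) * G (ract w (swap x b)))"
  unfolding compatible_def
proof (intro ballI impI)
  fix w i j assume w: "w \<in> W" and i: "i \<in> P" and j: "j \<in> P" and ij: "i \<noteq> j \<and> c i = c j"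
  have BP: "B \<subseteq> P" "b \<in> B" using b by (auto simp: B)
  have t: "swap x y permutes P" if "x \<in> P" "y \<in> P" for x y using that by (intro permutes_swap_id) auto
  let ?s = "\<lambda>x. of_int (sign (swap x b)) :: 'k" and ?ij = "swap i j"
  show "(\<Sum>x\<in>B. ?s x * G (ract (ract w ?ij) (swap x b))) =
    colour_sign (c i) * (\<Sum>x\<in>B. ?s x * G (ract w (swap x b)))"
  proof (cases "c i = c b")
    case False
    then have "i \<notin> B" "j \<notin> B" using ij by (auto simp: B)
    have "G (ract (ract w ?ij) (swap x b)) = colour_sign (c i) * G (ract w (swap x b))" if x: "x \<in> B" for x
    proof -
      have xP: "x \<in> P" using x BP by blast
      have "swap i j \<circ> swap x b = swap x b \<circ> swap i j"
        using x \<open>i \<notin> B\<close> \<open>j \<notin> B\<close> BP(2) by (auto simp: fun_eq_iff Transposition.transpose_def)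
      then have "ract (ract w ?ij) (swap x b) = ract (ract w (swap x b)) ?ij"
        using ract_comp[OF w t[OF i j] t[OF xP b(1)]] ract_comp[OF w t[OF xP b(1)] t[OF i j]] by simp
      moreover have "i \<noteq> b" "j \<noteq> b" using \<open>i \<notin> B\<close> \<open>j \<notin> B\<close> BP(2) by auto
      ultimately show ?thesis
        using G ract_closed[OF w t[OF xP b(1)]] i j ij unfolding compatible_def by (metis fun_upd_apply)
    qed
    then show ?thesis by (simp add: sum_distrib_left mult.left_commute)
  next
    case True
    then have ijB: "i \<in> B" "j \<in> B" using ij i j by (auto simp: B)
    \<comment> \<open>Left multiplication by (i j) permutes the cosets: (i j)(x b) = (x' b) h with
      x' = (i j) x, where h fixes b and hence acts on \<open>G\<close> by its sign. The signs
      combine to -1.\<close>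
    have key: "?s x * G (ract (ract w ?ij) (swap x b)) = - (?s (?ij x) * G (ract w (swap (?ij x) b)))"
      if x: "x \<in> B" for x
    proof -
      define x' where "x' = ?ij x"
      have x': "x' \<in> B" using x ijB by (auto simp: x'_def Transposition.transpose_def)
      have xP: "x \<in> P" "x' \<in> P" using x x' BP by auto
      define h where "h = swap x' b \<circ> (?ij \<circ> swap x b)"
      have tB: "swap y z permutes B" if "y \<in> B" "z \<in> B" for y z using that by (intro permutes_swap_id) auto
      have "h permutes B" unfolding h_def using x x' ijB BP by (intro permutes_compose tB)
      moreover have "h b = b" by (simp add: h_def x'_def)
      ultimately have hB: "h permutes B - {b}"
        unfolding permutes_def by (metis DiffI empty_iff insertE)
      have hP: "h permutes P" using permutes_subset[OF hB] BP by blast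
      have e: "?ij \<circ> swap x b = swap x' b \<circ> h"
        by (simp add: h_def o_assoc)
      have "ract (ract w ?ij) (swap x b) = ract (ract w (swap x' b)) h"
        using ract_comp[OF w t[OF i j] t[OF xP(1) b(1)]] ract_comp[OF w t[OF xP(2) b(1)] hP] e by simp
      moreover have "G (ract (ract w (swap x' b)) h) = of_int (sign h) * G (ract w (swap x' b))"
      proof (rule compatible_sign[OF G _ _ hB])
        show "B - {b} \<subseteq> P" using BP by blast
        show "(c(b := \<gamma>)) y = Inr k" if "y \<in> B - {b}" for y using that b by (auto simp: B)
      qed (rule ract_closed[OF w t[OF xP(2) b(1)]])
      moreover have "sign h = - sign (swap x' b) * sign (swap x b)"
        unfolding h_def using ij
        by (simp add: sign_compose permutation_swap_id permutation_compose sign_swap_id)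
      moreover have "?s x * ?s x = 1" by (simp add: sign_def)
      ultimately show ?thesis unfolding x'_def[symmetric] by (simp add: mult.assoc[symmetric])
    qed
    have "(\<Sum>x\<in>B. ?s x * G (ract (ract w ?ij) (swap x b))) = (\<Sum>x\<in>B. - (?s (?ij x) * G (ract w (swap (?ij x) b))))"
      using key by simp
    also have "\<dots> = (\<Sum>x\<in>B. - (?s x * G (ract w (swap x b))))"
      using ijB by (intro sum.reindex_bij_witness[of _ ?ij ?ij]) (auto simp: Transposition.transpose_def)
    also have "\<dots> = - (\<Sum>x\<in>B. ?s x * G (ract w (swap x b)))" by (simp add: sum_negf)
    finally show ?thesis using True b(2) by simp
  qed
qed

text \<open>In \<open>c(b := \<gamma>)\<close> the position b is alone with its colour, so all
  remaining relations already hold for \<open>c\<close>. In the Koszul identity this is the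
  multiplication of a vector into an exterior power; the sum over one element only fits it to
  \<open>presents_hom\<close>.\<close>

lemma compatible_merge:
  assumes G: "compatible c G" and \<gamma>: "\<gamma> \<notin> c ` P"
  shows "compatible (c(b := \<gamma>)) (\<lambda>w. \<Sum>x\<in>{b}. 1 * G (ract w (swap x b)))"
  unfolding compatible_def
proof (intro ballI impI)
  fix w i j assume w: "w \<in> W" and i: "i \<in> P" and j: "j \<in> P" and ij: "i \<noteq> j \<and> (c(b := \<gamma>)) i = (c(b := \<gamma>)) j"
  have "i \<noteq> b" "j \<noteq> b" using ij i j \<gamma> by (auto split: if_splits)
  then show "(\<Sum>x\<in>{b}. 1 * G (ract (ract w (swap i j)) (swap x b))) =
    colour_sign ((c(b := \<gamma>)) i) * (\<Sum>x\<in>{b}. 1 * G (ract w (swap x b)))"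
    using G w i j ij ract_id ract_closed[OF w permutes_swap_id[OF i j]] unfolding compatible_def by auto
qed

text \<open>With b and b' taken from an antisymmetric class, this is the Koszul map that sends xy
  \<otimes> \<omega> to the sum of x \<otimes> (y \<and> \<omega>) and y \<otimes> (x \<and>
  \<omega>).\<close>

lemma compatible_symmetrise:
  assumes G: "compatible (c(b := Inl l)) G" and \<gamma>: "Inl l \<notin> c ` P" and b: "b \<in> P" "b' \<in> P" "b \<noteq> b'"
  shows "compatible (c(b := Inl l, b' := Inl l)) (\<lambda>w. \<Sum>x\<in>{b, b'}. 1 * G (ract w (swap x b)))"
  unfolding compatible_def
proof (intro ballI impI)
  let ?c = "c(b := Inl l, b' := Inl l)"
  fix w i j assume w: "w \<in> W" and i: "i \<in> P" and j: "j \<in> P" and ij: "i \<noteq> j \<and> ?c i = ?c j"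
  have t: "swap x y permutes P" if "x \<in> P" "y \<in> P" for x y using that by (intro permutes_swap_id) auto
  have r: "ract (ract w (swap i j)) (swap b' b) = ract w (swap i j \<circ> swap b' b)" 
    using ract_comp[OF w t[OF i j] t[OF b(2,1)]] .
  consider "i \<notin> {b, b'}" "j \<notin> {b, b'}" | "{i, j} = {b, b'}"
  proof -
    have "c i \<noteq> Inl l" "c j \<noteq> Inl l" using i j \<gamma> by (metis imageI)+
    then show thesis using that ij by (auto split: if_splits)
  qed
  then show "(\<Sum>x\<in>{b, b'}. 1 * G (ract (ract w (swap i j)) (swap x b))) =
    colour_sign (?c i) * (\<Sum>x\<in>{b, b'}. 1 * G (ract w (swap x b)))"
  proof cases
    case 1
    have "swap i j \<circ> swap b' b = swap b' b \<circ> swap i j"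
      using 1 by (auto simp: fun_eq_iff Transposition.transpose_def)
    then have r2: "ract (ract w (swap i j)) (swap b' b) = ract (ract w (swap b' b)) (swap i j)"
      using r ract_comp[OF w t[OF b(2,1)] t[OF i j]] by simp
    have e: "G (ract v (swap i j)) = colour_sign (?c i) * G v" if "v \<in> W" for v
      using G that i j ij 1 unfolding compatible_def by auto
    show ?thesis
      using b(3) ract_id[OF w] ract_id[OF ract_closed[OF w t[OF i j]]] r2 e[OF w] e[OF ract_closed[OF w t[OF b(2,1)]]]
      by (simp add: distrib_left)
  next
    case 2
    then have "swap i j = swap b' b" by (auto simp: doubleton_eq_iff transpose_commute)
    moreover have "?c i = Inl l" using 2 by auto
    ultimately show ?thesis
      using b(3) ract_id[OF w] ract_id[OF ract_closed[OF w t[OF b(2,1)]]] ract_comp[OF w t[OF b(2,1)] t[OF b(2,1)]]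
      by (simp add: add.commute)
  qed
qed

text \<open>The Koszul identity: on \<open>E \<otimes> \<Lambda>\<^sup>m E\<close>, the composite through \<open>\<Lambda>\<^bsup>m+1\<^esup> E\<close> and the composite through
  \<open>S\<^sup>2 E \<otimes> \<Lambda>\<^bsup>m-1\<^esup> E\<close> add up to the multiplication by \<open>m + 1\<close>.\<close>

lemma koszul:
  fixes K :: "('k, 'a, 'x) kmodule" and M :: "('k, 'a, 'y) kmodule"
  assumes K: "presents c K q" and M: "presents (c(b := Inl l)) M q'"
    and b: "b \<in> P" "c b = Inr k" and l: "Inl l \<notin> c ` P" and m: "m = card {x \<in> P. c x = c b}"
  shows "\<exists>s s'. mod_hom A K M s \<and> mod_hom A M K s' \<and>
    (\<forall>u\<in>mod_carrier K. s' (s u) = fscale (of_nat m) u) \<and>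
    (m = 1 \<longrightarrow> (\<forall>u\<in>mod_carrier M. s (s' u) = u)) \<and>
    (\<forall>b' (N :: ('k, 'a, 'z) kmodule) q''.
      presents (c(b := Inl l, b' := Inl l)) N q'' \<and> b' \<in> P \<and> b' \<noteq> b \<and> c b' = c b \<longrightarrow>
      (\<exists>t t'. mod_hom A M N t \<and> mod_hom A N M t' \<and>
        (\<forall>u\<in>mod_carrier M. s (s' u) + t' (t u) = fscale (of_nat m) u)))"
proof -
  define B where "B = {x \<in> P. c x = c b}"
  have BP: "B \<subseteq> P" "b \<in> B" and fB: "finite B" using b finite_P by (auto simp: B_def)
  have t: "swap x y permutes P" if "x \<in> P" "y \<in> P" for x y using that by (intro permutes_swap_id) auto
  let ?sg = "\<lambda>x y. of_int (sign (swap x y)) :: 'k"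
  obtain s where s: "mod_hom A K M s"
    and sq: "\<And>w. w \<in> W \<Longrightarrow> s (q w) = (\<Sum>x\<in>B. fscale (?sg x b) (q' (ract w (swap x b))))"
  proof -
    have tB: "\<And>x. x \<in> B \<Longrightarrow> swap x b permutes P" using t BP by blast
    show thesis by (rule presents_hom[OF K M fB tB compatible_split[OF _ b B_def]]) (auto intro: that)
  qed
  obtain s' where s': "mod_hom A M K s'"
    and s'q: "\<And>w. w \<in> W \<Longrightarrow> s' (q' w) = (\<Sum>x\<in>{b}. fscale 1 (q (ract w (swap x b))))"
    using presents_hom[OF M K, of "{b}" b "\<lambda>_. 1"] compatible_merge[OF _ l] by (auto simp: permutes_id)
  have s'q: "s' (q' w) = q w" if "w \<in> W" for w using s'q[OF that] ract_id[OF that] by simp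
  have anti: "F (ract w (swap i j)) = - F w"
    if "\<And>x. compatible c' (\<lambda>w. F w x)" "w \<in> W" "i \<in> P" "j \<in> P" "i \<noteq> j" "c' i = Inr k" "c' j = Inr k"
    for F :: "'w \<Rightarrow> 'v \<Rightarrow> 'k" and c' w i j
    using that unfolding compatible_def fun_eq_iff by force
  note K' = presentsD(1)[OF K] and M' = presentsD(1)[OF M]
  show ?thesis
  proof (intro exI[of _ s] exI[of _ s'] conjI ballI allI impI s s')
    fix u assume u: "u \<in> mod_carrier K"
    show "s' (s u) = fscale (of_nat m) u"
    proof (rule presents_hom_eqI[OF K mod_hom_comp[OF s s'] mod_hom_scale[OF mod_hom_id K'] _ u])
      fix w assume w: "w \<in> W"
      have "s' (s (q w)) = (\<Sum>x\<in>B. s' (fscale (?sg x b) (q' (ract w (swap x b)))))"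
        unfolding sq[OF w] using t BP b w ract_closed
        by (intro mod_hom_sum[OF s' M'] linear_actionD(4)[OF M'] presentsD(4)[OF M]) auto
      \<comment> \<open>The sign attached to (x b) cancels the sign produced by the antisymmetry of
        \<open>q\<close>, so all m terms are equal.\<close>
      also have "\<dots> = (\<Sum>x\<in>B. q w)"
      proof (rule sum.cong)
        fix x assume x: "x \<in> B"
        then have xP: "x \<in> P" using BP by blast
        have "s' (fscale (?sg x b) (q' (ract w (swap x b)))) = fscale (?sg x b) (q (ract w (swap x b)))"
          using mod_homD(3)[OF s' presentsD(4)[OF M]] s'q ract_closed[OF w t[OF xP b(1)]] by simp
        also have "\<dots> = q w"
        proof (cases "x = b")
          case False
          then show ?thesis
            using anti[of c q, OF presentsD(2)[OF K] w xP b(1)] x b(2) by (simp add: B_def sign_swap_id)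
        qed (simp add: ract_id[OF w] sign_id)
        finally show "s' (fscale (?sg x b) (q' (ract w (swap x b)))) = q w" .
      qed simp
      also have "\<dots> = fscale (of_nat m) (q w)"
        by (simp add: fun_eq_iff fscale_def m B_def)
      finally show "s' (s (q w)) = fscale (of_nat m) (q w)" .
    qed
  next
    fix u assume m1: "m = 1" and u: "u \<in> mod_carrier M"
    \<comment> \<open>For m = 1 what remains besides b is an exterior power of degree 0, and the two
      maps are mutually inverse. No second position b' exists in this case.\<close>
    obtain x where x: "B = {x}" using m1 card_1_singletonE unfolding m B_def by metis
    have "B = {b}" using BP(2) unfolding x by simp
    then have "s (s' (q' w)) = q' w" if "w \<in> W" for w
      using sq[OF that] s'q[OF that] ract_id[OF that] by (simp add: sign_id)
    then show "s (s' u) = u"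
      using presents_hom_eqI[OF M mod_hom_comp[OF s' s] mod_hom_id _ u] by simp
  next
    fix b' and N :: "('k, 'a, 'z) kmodule" and q''
    assume "presents (c(b := Inl l, b' := Inl l)) N q'' \<and> b' \<in> P \<and> b' \<noteq> b \<and> c b' = c b"
    then have N: "presents (c(b := Inl l, b' := Inl l)) N q''" and b': "b' \<in> P" "b' \<noteq> b" "c b' = c b"
      by blast+
    let ?c = "c(b := Inl l)" and ?B = "B - {b}"
    have cb': "?c b' = Inr k" using b' b by simp
    have B': "?B = {x \<in> P. ?c x = ?c b'}" using b b' by (auto simp: B_def)
    obtain t1 where t1: "mod_hom A M N t1"
      and t1q: "\<And>w. w \<in> W \<Longrightarrow> t1 (q' w) = (\<Sum>x\<in>?B. fscale (?sg x b') (q'' (ract w (swap x b'))))"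
    proof -
      have tB: "\<And>x. x \<in> ?B \<Longrightarrow> swap x b' permutes P" using t BP b' by blast
      show thesis by (rule presents_hom[OF M N _ tB compatible_split[where c = ?c and b = b' and \<gamma> = "Inl l", OF _ b'(1) cb' B']]) (use fB in \<open>auto intro: that\<close>)
    qed
    obtain t2 where t2: "mod_hom A N M t2"
      and t2q: "\<And>w. w \<in> W \<Longrightarrow> t2 (q'' w) = (\<Sum>x\<in>{b, b'}. fscale 1 (q' (ract w (swap x b))))"
    proof -
      have tB: "\<And>x. x \<in> {b, b'} \<Longrightarrow> swap x b permutes P" using t b b' by blast
      show thesis
        by (rule presents_hom[OF N M _ tB compatible_symmetrise[OF _ l b(1) b'(1) b'(2)[symmetric]]])
          (auto simp only: finite.intros intro: that)
    qed
    have t2q: "t2 (q'' w) = q' w + q' (ract w (swap b' b))" if "w \<in> W" for w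
      using t2q[OF that] b'(2) ract_id[OF that] by simp
    have qM: "q' (ract w (swap i j)) = - q' w" if "w \<in> W" "i \<in> ?B" "j \<in> ?B" "i \<noteq> j" for w i j
      using anti[of ?c q', OF presentsD(2)[OF M] that(1) _ _ that(4)] that b BP by (auto simp: B_def)
    have "s (s' u) + t2 (t1 u) = fscale (of_nat m) u" if u: "u \<in> mod_carrier M" for u
    proof -
      have hom: "mod_hom {} M M (\<lambda>u. s (s' u) + t2 (t1 u))"
        using mod_hom_comp[OF s' s] mod_hom_comp[OF t1 t2] linear_actionD[OF M']
        by (auto simp: mod_hom_def fun_space.scale_right_distrib)
      show ?thesis
      proof (rule presents_hom_eqI[OF M hom mod_hom_scale[OF mod_hom_id M'] _ u])
        fix w assume w: "w \<in> W"
        have b'B: "b' \<in> ?B" using b' by (simp add: B_def)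
        \<comment> \<open>The cross terms: one composite gives \<open>q' w\<close> minus
          \<open>X\<close>, the other gives m - 1 times \<open>q' w\<close> plus
          \<open>X\<close>.\<close>
        define X where "X = (\<Sum>x\<in>?B. q' (ract w (swap x b)))"
        have "s (s' (q' w)) = (\<Sum>x\<in>B. fscale (?sg x b) (q' (ract w (swap x b))))"
          using sq[OF w] s'q[OF w] by simp
        also have "\<dots> = q' w + (\<Sum>x\<in>?B. fscale (?sg x b) (q' (ract w (swap x b))))"
          by (subst sum.remove[OF fB BP(2)]) (simp add: sign_id ract_id[OF w])
        also have "(\<Sum>x\<in>?B. fscale (?sg x b) (q' (ract w (swap x b)))) = - X"
          unfolding X_def sum_negf[symmetric] by (intro sum.cong) (auto simp: sign_swap_id)
        finally have 1: "s (s' (q' w)) = q' w + - X" .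
        have wx: "ract w (swap x y) \<in> W" if "x \<in> P" "y \<in> P" for x y using ract_closed[OF w t[OF that]] .
        have "t2 (t1 (q' w)) = (\<Sum>x\<in>?B. t2 (fscale (?sg x b') (q'' (ract w (swap x b')))))"
          unfolding t1q[OF w] using BP b' wx
          by (intro mod_hom_sum[OF t2 presentsD(1)[OF N]] linear_actionD(4)[OF presentsD(1)[OF N]] presentsD(4)[OF N]) auto
        also have "\<dots> = (\<Sum>x\<in>?B. q' w + q' (ract w (swap x b)))"
        proof (rule sum.cong)
          fix x assume x: "x \<in> ?B"
          then have xP: "x \<in> P" "x \<noteq> b" using BP by auto
          have "t2 (fscale (?sg x b') (q'' (ract w (swap x b')))) =
              fscale (?sg x b') (q' (ract w (swap x b')) + q' (ract (ract w (swap x b')) (swap b' b)))"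
            using mod_homD(3)[OF t2 presentsD(4)[OF N]] wx[OF xP(1) b'(1)] t2q by simp
          also have "\<dots> = q' w + q' (ract w (swap x b))"
          proof (cases "x = b'")
            case True
            then show ?thesis by (simp add: sign_id ract_id[OF w])
          next
            case False
            \<comment> \<open>Rewritten so that (x b'), a transposition of two antisymmetric
              positions of \<open>M\<close>, is applied last; its sign cancels the
              coefficient.\<close>
            have "swap x b' \<circ> swap b' b = swap x b \<circ> swap x b'"
              using False b'(2) xP(2) by (auto simp: fun_eq_iff Transposition.transpose_def)
            then have "ract (ract w (swap x b')) (swap b' b) = ract (ract w (swap x b)) (swap x b')"
              using ract_comp[OF w t[OF xP(1) b'(1)] t[OF b'(1) b(1)]] ract_comp[OF w t[OF xP(1) b(1)] t[OF xP(1) b'(1)]]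
              by simp
            then show ?thesis
              using qM[OF w x b'B False] qM[OF wx[OF xP(1) b(1)] x b'B False] False by (simp add: sign_swap_id)
          qed
          finally show "t2 (fscale (?sg x b') (q'' (ract w (swap x b')))) = q' w + q' (ract w (swap x b))" .
        qed simp
        also have "\<dots> = fscale (of_nat (card ?B)) (q' w) + X"
          by (simp add: sum.distrib X_def) (simp add: fun_eq_iff fscale_def)
        finally have 2: "t2 (t1 (q' w)) = fscale (of_nat (card ?B)) (q' w) + X" .
        have "m = Suc (card ?B)" using card.remove[OF fB BP(2)] by (simp add: m B_def)
        then show "s (s' (q' w)) + t2 (t1 (q' w)) = fscale (of_nat m) (q' w)"
          unfolding 1 2 by (simp add: fun_eq_iff fscale_def algebra_simps)
      qed
    qed
    then show "\<exists>t t'. mod_hom A M N t \<and> mod_hom A N M t' \<and>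
        (\<forall>u\<in>mod_carrier M. s (s' u) + t' (t u) = fscale (of_nat m) u)"
      using t1 t2 by (intro exI conjI ballI)
  qed
qed

end

section \<open>Families of signed modules and their labels\<close>

text \<open>Colours beyond the lists get 0. Hence the colour after the last part of \<alpha> is free
  for a new part, and zero parts leave no trace.\<close>

fun colour_count :: "nat list \<Rightarrow> nat list \<Rightarrow> nat + nat \<Rightarrow> nat" where
  "colour_count \<alpha> \<beta> (Inl i) = (if i < length \<alpha> then \<alpha> ! i else 0)"
| "colour_count \<alpha> \<beta> (Inr i) = (if i < length \<beta> then \<beta> ! i else 0)"

lemma mset_filter_nonzero:
  obtains z where "mset \<beta> = mset (filter (\<lambda>x. x \<noteq> 0) \<beta> @ replicate z (0::nat))"
proof -
  have "\<exists>z. mset \<beta> = mset (filter (\<lambda>x. x \<noteq> 0) \<beta> @ replicate z (0::nat))"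
  proof (induction \<beta>)
    case (Cons b \<beta>)
    then obtain z where "mset \<beta> = mset (filter (\<lambda>x. x \<noteq> 0) \<beta> @ replicate z (0::nat))" by blast
    then show ?case by (intro exI[of _ "if b = 0 then Suc z else z"]) auto
  qed simp
  then show ?thesis using that by blast
qed

lemma sum_list_filter_nonzero: "sum_list (filter (\<lambda>x. x \<noteq> 0) \<beta>) = sum_list (\<beta> :: nat list)"
  by (induction \<beta>) auto

lemma sum_list_update_add: "j < length xs \<Longrightarrow> sum_list (xs[j := k]) + xs ! j = sum_list xs + (k::nat)"
  using sum_list_update[of j xs k] elem_le_sum_list[of j xs] by simp

locale signed_family = signed_words A W P ract \<kappa>
  for A :: "'a set" and W :: "'w set" and P ract and \<kappa> :: "'a \<Rightarrow> 'w \<Rightarrow> 'w \<Rightarrow> 'k::field" +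
  fixes K :: "nat list \<Rightarrow> nat list \<Rightarrow> ('k, 'a, 'x) kmodule" and n :: nat
  assumes family: "\<And>\<alpha> \<beta>. sum_list \<alpha> + sum_list \<beta> = n \<Longrightarrow>
    \<exists>c q. presents c (K \<alpha> \<beta>) q \<and> (\<forall>x. card {y \<in> P. c y = x} = colour_count \<alpha> \<beta> x)"
begin

lemma family_linear: "sum_list \<alpha> + sum_list \<beta> = n \<Longrightarrow> linear_action A (K \<alpha> \<beta>)"
  using family presentsD(1) by blast

lemma family_locally_finite: "sum_list \<alpha> + sum_list \<beta> = n \<Longrightarrow> locally_finite A (K \<alpha> \<beta>)"
  using family presents_locally_finite by blast

text \<open>Which positions carry a colour is irrelevant by \<open>presents_mset\<close>. So a
  presentation of one module, recoloured at a few positions, yields a colouring that presents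
  another module of the family.\<close>

lemma family_presents:
  assumes "sum_list \<alpha> + sum_list \<beta> = n" and c: "\<And>x. card {y \<in> P. c y = x} = colour_count \<alpha> \<beta> x"
  obtains q where "presents c (K \<alpha> \<beta>) q"
proof -
  obtain c' q where q: "presents c' (K \<alpha> \<beta>) q" "\<forall>x. card {y \<in> P. c' y = x} = colour_count \<alpha> \<beta> x"
    using family[OF assms(1)] by blast
  have ct: "count (image_mset f (mset_set P)) x = card {y \<in> P. f y = x}" for f and x :: "nat + nat"
  proof -
    have "{y \<in> P. f y = x} = f -` {x} \<inter> P" by auto
    then show ?thesis using finite_P by (simp add: count_image_mset)
  qed
  have "image_mset c (mset_set P) = image_mset c' (mset_set P)"
    by (rule multiset_eqI) (simp add: ct c q(2))
  from presents_mset[OF q(1) this] show ?thesis using that by blast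
qed

text \<open>Reordering the parts renames the colours injectively and within each of the two kinds,
  so a presentation of one module has the colour counts of the other.\<close>

lemma family_retract_permute:
  assumes n: "sum_list \<alpha> + sum_list \<beta> = n" and \<alpha>: "mset \<alpha> = mset \<alpha>'" and \<beta>: "mset \<beta> = mset \<beta>'"
  shows "retract_of A (K \<alpha> \<beta>) (K \<alpha>' \<beta>')"
proof -
  obtain c q where q: "presents c (K \<alpha> \<beta>) q" and c: "\<forall>x. card {y \<in> P. c y = x} = colour_count \<alpha> \<beta> x"
    using family[OF n] by blast
  obtain f where f: "f permutes {..<length \<alpha>}" "permute_list f \<alpha> = \<alpha>'"
    using mset_eq_permutation[OF \<alpha>[symmetric]] by blast
  obtain g where g: "g permutes {..<length \<beta>}" "permute_list g \<beta> = \<beta>'"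
    using mset_eq_permutation[OF \<beta>[symmetric]] by blast
  have l: "length \<alpha>' = length \<alpha>" "length \<beta>' = length \<beta>" using f g by auto
  have nn: "sum_list \<alpha>' + sum_list \<beta>' = n" using n \<alpha> \<beta> by (metis sum_mset_sum_list)
  let ?h = "map_sum (inv_into UNIV f) (inv_into UNIV g)"
  have hx: "?h z = x \<longleftrightarrow> z = map_sum f g x" for z x
    using permutes_inverses[OF f(1)] permutes_inverses[OF g(1)] by (cases z; cases x) auto
  have cnt: "colour_count \<alpha>' \<beta>' x = colour_count \<alpha> \<beta> (map_sum f g x)" for x
  proof (cases x)
    case (Inl i)
    have "f i < length \<alpha> \<longleftrightarrow> i < length \<alpha>" using permutes_in_image[OF f(1), of i] by simp
    then show ?thesis using f Inl l by (auto simp: permute_list_nth)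
  next
    case (Inr i)
    have "g i < length \<beta> \<longleftrightarrow> i < length \<beta>" using permutes_in_image[OF g(1), of i] by simp
    then show ?thesis using g Inr l by (auto simp: permute_list_nth)
  qed
  have "inj ?h" by (rule injI) (metis hx)
  then have "presents (?h \<circ> c) (K \<alpha> \<beta>) q"
    by (intro presents_recolour[OF q, of _ ?h]) (auto intro: inj_on_subset simp: colour_sign_def split: sum.splits)
  moreover have "card {y \<in> P. (?h \<circ> c) y = x} = colour_count \<alpha>' \<beta>' x" for x
    using c by (simp add: hx cnt)
  from family_presents[OF nn this] obtain q' where "presents (?h \<circ> c) (K \<alpha>' \<beta>') q'" .
  ultimately show ?thesis by (rule presents_retract)
qed

text \<open>A zero part is a colour without positions; when the zeros are moved to the end, removing
  them changes no colour count.\<close>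

lemma family_retract_nonzero:
  assumes n: "sum_list \<alpha> + sum_list \<beta> = n" 
  shows "retract_of A (K \<alpha> \<beta>) (K \<alpha> (filter (\<lambda>x. x \<noteq> 0) \<beta>))"
    "retract_of A (K \<alpha> (filter (\<lambda>x. x \<noteq> 0) \<beta>)) (K \<alpha> \<beta>)"
proof -
  let ?\<beta> = "filter (\<lambda>x. x \<noteq> 0) \<beta>"
  obtain z where z: "mset \<beta> = mset (?\<beta> @ replicate z 0)" using mset_filter_nonzero .
  let ?\<gamma> = "?\<beta> @ replicate z 0"
  have n1: "sum_list \<alpha> + sum_list ?\<beta> = n" using n sum_list_filter_nonzero by simp
  then have n2: "sum_list \<alpha> + sum_list ?\<gamma> = n" by (simp add: sum_list_replicate)
  have "colour_count \<alpha> ?\<gamma> x = colour_count \<alpha> ?\<beta> x" for x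
    by (cases x) (auto simp: nth_append)
  moreover obtain c q where q: "presents c (K \<alpha> ?\<beta>) q" "\<forall>x. card {y \<in> P. c y = x} = colour_count \<alpha> ?\<beta> x"
    using family[OF n1] by blast
  ultimately have "card {y \<in> P. c y = x} = colour_count \<alpha> ?\<gamma> x" for x by simp
  from family_presents[OF n2 this] obtain q' where q': "presents c (K \<alpha> ?\<gamma>) q'" .
  note r = family_retract_permute[OF n refl z] family_retract_permute[OF n2 refl z[symmetric]]
  show "retract_of A (K \<alpha> \<beta>) (K \<alpha> ?\<beta>)"
    by (rule retract_of_trans[OF r(1) presents_retract[OF q' q(1)]])
  show "retract_of A (K \<alpha> ?\<beta>) (K \<alpha> \<beta>)"
    by (rule retract_of_trans[OF presents_retract[OF q(1) q'] r(2)])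
qed

lemma family_retract:
  assumes n: "sum_list \<alpha> + sum_list \<beta> = n" and \<alpha>: "mset \<alpha> = mset \<alpha>'"
    and \<beta>: "mset (filter (\<lambda>x. x \<noteq> 0) \<beta>) = mset (filter (\<lambda>x. x \<noteq> 0) \<beta>')"
  shows "retract_of A (K \<alpha> \<beta>) (K \<alpha>' \<beta>')"
proof -
  let ?\<beta> = "filter (\<lambda>x. x \<noteq> 0) \<beta>" and ?\<beta>' = "filter (\<lambda>x. x \<noteq> 0) \<beta>'"
  have n1: "sum_list \<alpha> + sum_list ?\<beta> = n" using n sum_list_filter_nonzero by simp
  then have "sum_list \<alpha>' + sum_list ?\<beta>' = n" using \<alpha> \<beta> by (metis sum_mset_sum_list)
  then have n': "sum_list \<alpha>' + sum_list \<beta>' = n" using sum_list_filter_nonzero by simp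
  show ?thesis
    by (rule retract_of_trans[OF family_retract_nonzero(1)[OF n]
        retract_of_trans[OF family_retract_permute[OF n1 \<alpha> \<beta>] family_retract_nonzero(2)[OF n']]])
qed

text \<open>One position b of the j-th antisymmetric class receives a fresh symmetric colour. The
  composite through the larger module is m + 1, and dividing by it gives the retraction; the Koszul
  sum gives the alternative for \<open>Z\<close>.\<close>

lemma family_step:
  assumes n: "sum_list \<alpha> + sum_list \<beta> = n" and j: "j < length \<beta>" "\<beta> ! j = Suc m"
    and m: "(of_nat (Suc m) :: 'k) \<noteq> 0"
  shows "retract_of A (K \<alpha> \<beta>) (K (\<alpha> @ [1]) (\<beta>[j := m]))"
    and "\<lbrakk>linear_action A Z; locally_finite A Z; indecomposable A Z; retract_of A Z (K (\<alpha> @ [1]) (\<beta>[j := m]))\<rbrakk> \<Longrightarrow>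
      retract_of A Z (K \<alpha> \<beta>) \<or> m > 0 \<and> retract_of A Z (K (\<alpha> @ [2]) (\<beta>[j := m - 1]))"
proof -
  obtain c q where q: "presents c (K \<alpha> \<beta>) q" and c: "\<And>x. card {y \<in> P. c y = x} = colour_count \<alpha> \<beta> x"
    using family[OF n] by blast
  let ?l = "length \<alpha>"
  define B where "B = {y \<in> P. c y = Inr j}"
  have cB: "card B = Suc m" unfolding B_def c using j by simp
  then obtain b where bB: "b \<in> B" by (metis card.empty equals0I nat.distinct(1))
  have b: "b \<in> P" "c b = Inr j" using bB by (auto simp: B_def)
  have fB: "finite B" using cB card.infinite by fastforce
  have "card {y \<in> P. c y = Inl ?l} = 0" using c by simp
  then have l0: "{y \<in> P. c y = Inl ?l} = {}" using finite_P by simp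
  then have l: "Inl ?l \<notin> c ` P" by auto
  let ?M = "K (\<alpha> @ [1]) (\<beta>[j := m])" and ?N = "K (\<alpha> @ [2]) (\<beta>[j := m - 1])"
  have sb: "sum_list (\<beta>[j := k]) + Suc m = sum_list \<beta> + k" for k
    using sum_list_update_add[OF j(1), of k] j(2) by simp
  have nM: "sum_list (\<alpha> @ [1]) + sum_list (\<beta>[j := m]) = n" using sb[of m] n by simp
  let ?c = "c(b := Inl ?l)"
  have c1: "card {y \<in> P. ?c y = x} = colour_count (\<alpha> @ [1]) (\<beta>[j := m]) x" for x
  proof -
    have s: "{y \<in> P. ?c y = x} = (if x = Inl ?l then {b} else if x = Inr j then B - {b} else {y \<in> P. c y = x})"
      using b l0 by (auto simp: B_def)
    show ?thesis unfolding s using c[of x] cB bB fB j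
      by (cases x) (auto simp: nth_append nth_list_update)
  qed
  obtain q' where q': "presents ?c ?M q'" using family_presents[OF nM c1] .
  have mm: "Suc m = card {x \<in> P. c x = c b}" using cB b by (simp add: B_def)
  obtain s s' where s: "mod_hom A (K \<alpha> \<beta>) ?M s" "mod_hom A ?M (K \<alpha> \<beta>) s'" 
    and ss: "\<forall>u\<in>mod_carrier (K \<alpha> \<beta>). s' (s u) = fscale (of_nat (Suc m)) u"
    and m0: "Suc m = 1 \<longrightarrow> (\<forall>u\<in>mod_carrier ?M. s (s' u) = u)"
    and N: "\<forall>b' (N :: ('k, 'a, 'x) kmodule) q''.
      presents (c(b := Inl ?l, b' := Inl ?l)) N q'' \<and> b' \<in> P \<and> b' \<noteq> b \<and> c b' = c b \<longrightarrow>
      (\<exists>t t'. mod_hom A ?M N t \<and> mod_hom A N ?M t' \<and>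
        (\<forall>u\<in>mod_carrier ?M. s (s' u) + t' (t u) = fscale (of_nat (Suc m)) u))"
    using koszul[OF q q' b l mm] by (elim exE conjE) (rule that)
  show "retract_of A (K \<alpha> \<beta>) ?M"
    unfolding retract_of_def
  proof (intro exI conjI ballI)
    show "mod_hom A ?M (K \<alpha> \<beta>) (\<lambda>u. fscale (1 / of_nat (Suc m)) (s' u))"
      by (rule mod_hom_scale[OF s(2) presentsD(1)[OF q]])
    fix u assume "u \<in> mod_carrier (K \<alpha> \<beta>)"
    then show "fscale (1 / of_nat (Suc m)) (s' (s u)) = u" using ss m by simp
  qed (rule s(1))
  assume Z: "linear_action A Z" "locally_finite A Z" "indecomposable A Z" and ZM: "retract_of A Z ?M"
  show "retract_of A Z (K \<alpha> \<beta>) \<or> m > 0 \<and> retract_of A Z ?N"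
  proof (cases "m = 0")
    case True
    \<comment> \<open>A part 1 is the same whether symmetric or antisymmetric, so both modules are
      isomorphic and there is no complement.\<close>
    have "retract_of A ?M (K \<alpha> \<beta>)"
      unfolding retract_of_def using s m0 True by (intro exI[of _ s'] exI[of _ s] conjI ballI) simp_all
    from retract_of_trans[OF ZM this] show ?thesis by blast
  next
    case False
    have "card (B - {b}) \<noteq> 0" using cB bB fB False by simp
    then obtain b' where b': "b' \<in> B" "b' \<noteq> b" by (metis Diff_iff card.empty equals0I singletonI)
    have nN: "sum_list (\<alpha> @ [2]) + sum_list (\<beta>[j := m - 1]) = n" using sb[of "m - 1"] n False by simp
    let ?c2 = "c(b := Inl ?l, b' := Inl ?l)"
    have c2: "card {y \<in> P. ?c2 y = x} = colour_count (\<alpha> @ [2]) (\<beta>[j := m - 1]) x" for x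
    proof -
      have s: "{y \<in> P. ?c2 y = x} = (if x = Inl ?l then {b, b'} else if x = Inr j then B - {b, b'} else {y \<in> P. c y = x})"
        using b b' l0 by (auto simp: B_def)
      have "card (B - {b, b'}) = m - 1" using card_Diff_subset[of "{b, b'}" B] bB b' cB by simp
      then show ?thesis unfolding s using c[of x] b' j
        by (cases x) (auto simp: nth_append nth_list_update)
    qed
    obtain q'' where q'': "presents ?c2 ?N q''" using family_presents[OF nN c2] .
    obtain t t' where t: "mod_hom A ?M ?N t" "mod_hom A ?N ?M t'"
      and st: "\<forall>u\<in>mod_carrier ?M. s (s' u) + t' (t u) = fscale (of_nat (Suc m)) u"
    proof -
      have "presents ?c2 ?N q'' \<and> b' \<in> P \<and> b' \<noteq> b \<and> c b' = c b" using q'' b b' by (auto simp: B_def)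
      from N[rule_format, OF this] show thesis using that by blast
    qed
    have "retract_of A Z (K \<alpha> \<beta>) \<or> retract_of A Z ?N"
      by (rule retract_of_summand[OF Z(1-3) presentsD(1)[OF q'] ZM s(2,1) t m st[rule_format]])
    then show ?thesis using False by blast
  qed
qed

end

section \<open>Labels of summands and the excess of a partition\<close>

lemma labels_summandsD:
  assumes L: "labels_summands p n A K Z"
  shows "x \<in> partition_pairs p n \<Longrightarrow> indecomposable A (Z x)"
    and "x \<in> partition_pairs p n \<Longrightarrow> y \<in> partition_pairs p n \<Longrightarrow> mod_iso A (Z x) (Z y) \<Longrightarrow> x = y"
    and "(la, mu) \<in> partition_pairs p n \<Longrightarrow> multiplicity_in A (K la (map ((*) p) mu)) (Z (la, mu)) = 1"
    and "\<lbrakk>(la, mu) \<in> partition_pairs p n; direct_summand A (K la (map ((*) p) mu)) U;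
        indecomposable A (mod_restrict (K la (map ((*) p) mu)) U);
        \<not> mod_iso A (mod_restrict (K la (map ((*) p) mu)) U) (Z (la, mu))\<rbrakk> \<Longrightarrow>
      \<exists>x\<in>partition_pairs p n. strictly_dominates p x (la, mu) \<and>
        mod_iso A (mod_restrict (K la (map ((*) p) mu)) U) (Z x)"
proof -
  note c = L[unfolded labels_summands_def Let_def]
  show "x \<in> partition_pairs p n \<Longrightarrow> indecomposable A (Z x)" using c[THEN conjunct1] by (rule bspec)
  show "x \<in> partition_pairs p n \<Longrightarrow> y \<in> partition_pairs p n \<Longrightarrow> mod_iso A (Z x) (Z y) \<Longrightarrow> x = y"
    by (rule c[THEN conjunct2, THEN conjunct1, rule_format])
  note d = c[THEN conjunct2, THEN conjunct2, THEN conjunct2, THEN bspec[of _ _ "(la, mu)"], unfolded prod.case]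
  show "(la, mu) \<in> partition_pairs p n \<Longrightarrow> multiplicity_in A (K la (map ((*) p) mu)) (Z (la, mu)) = 1"
    by (rule d[THEN conjunct1])
  show "\<lbrakk>(la, mu) \<in> partition_pairs p n; direct_summand A (K la (map ((*) p) mu)) U;
        indecomposable A (mod_restrict (K la (map ((*) p) mu)) U);
        \<not> mod_iso A (mod_restrict (K la (map ((*) p) mu)) U) (Z (la, mu))\<rbrakk> \<Longrightarrow>
      \<exists>x\<in>partition_pairs p n. strictly_dominates p x (la, mu) \<and>
        mod_iso A (mod_restrict (K la (map ((*) p) mu)) U) (Z x)"
    by (rule d[THEN conjunct2, rule_format]) (intro conjI | assumption)+
qed

text \<open>In a decreasing list the parts above 1 form an initial segment, and the other parts have
  no excess. With \<open>sum_take_le_excess\<close>, the excess is thus the maximum over q of the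
  sum of the first q parts minus q, which makes it monotone for dominance.\<close>

lemma sum_take_excess:
  assumes "sorted_wrt (\<ge>) la" 
  shows "sum_list (take (length (filter (\<lambda>x. 1 < x) la)) la) =
    length (filter (\<lambda>x. 1 < x) la) + sum_list (map (\<lambda>x. x - (1::nat)) la)"
  using assms
proof (induction la)
  case (Cons x la)
  show ?case
  proof (cases "1 < x")
    case False
    then have "\<forall>y\<in>set la. y \<le> 1" using Cons(2) by fastforce
    then have "filter (\<lambda>x. 1 < x) la = []" "sum_list (map (\<lambda>x. x - 1) la) = 0"
      by (auto simp: filter_empty_conv)
    then show ?thesis using False by simp
  qed (use Cons in simp)
qed simp

lemma sum_take_le_excess: "sum_list (take q la) \<le> q + sum_list (map (\<lambda>x. x - (1::nat)) la)"
proof (induction la arbitrary: q)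
  case (Cons x la)
  show ?case
  proof (cases q)
    case (Suc k)
    then show ?thesis using Cons[of k] by simp
  qed simp
qed simp

lemma mset_sum_list_map:
  assumes "mset xs = mset ys"
  shows "sum_list (map f xs) = (sum_list (map f ys) :: nat)"
  using assms by (metis mset_map sum_mset_sum_list)

lemma partition_of_mset:
  assumes "composition xs"
  obtains la where "is_partition la" "mset la = mset xs"
proof
  show "is_partition (rev (sort xs))"
    using assms by (auto simp: is_partition_def composition_def sorted_wrt_rev)
qed simp

lemma sum_list_div_mod: "sum_list (map (\<lambda>b. b mod p) \<beta>) + p * sum_list (map (\<lambda>b. b div p) \<beta>) = sum_list (\<beta> :: nat list)"
  by (induction \<beta>) (auto simp: algebra_simps)

text \<open>A relation between lists in which \<beta> may have zero parts, so that it also applies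
  to the intermediate pairs of the induction.\<close>

definition label_of :: "nat \<Rightarrow> nat list \<Rightarrow> nat list \<Rightarrow> nat list \<Rightarrow> nat list \<Rightarrow> bool" where
  "label_of p \<alpha> \<beta> la mu \<longleftrightarrow> is_partition la \<and> is_partition mu \<and>
     mset la = mset (\<alpha> @ replicate (sum_list (map (\<lambda>b. b mod p) \<beta>)) 1) \<and>
     mset mu = mset (filter (\<lambda>x. x \<noteq> 0) (map (\<lambda>b. b div p) \<beta>))"

lemma label_of_exists:
  assumes "composition \<alpha>"
  obtains la mu where "label_of p \<alpha> \<beta> la mu"
proof -
  have "composition (\<alpha> @ replicate (sum_list (map (\<lambda>b. b mod p) \<beta>)) 1)" using assms by (auto simp: composition_def)
  moreover have "composition (filter (\<lambda>x. x \<noteq> 0) (map (\<lambda>b. b div p) \<beta>))" by (auto simp: composition_def)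
  ultimately show ?thesis using that partition_of_mset unfolding label_of_def by metis
qed

text \<open>Division with remainder, summed over the parts of \<beta>, shows that the degree is
  preserved.\<close>

lemma label_of_partition_pairs:
  assumes "label_of p \<alpha> \<beta> la mu"
  shows "(la, mu) \<in> partition_pairs p (sum_list \<alpha> + sum_list \<beta>)"
proof -
  have "sum_list la = sum_list \<alpha> + sum_list (map (\<lambda>b. b mod p) \<beta>)"
    using assms by (metis label_of_def mult_1_right of_nat_id sum_list.append sum_list_replicate sum_mset_sum_list)
  moreover have "sum_list mu = sum_list (map (\<lambda>b. b div p) \<beta>)"
    using assms sum_list_filter_nonzero by (metis label_of_def sum_mset_sum_list)
  ultimately show ?thesis
    using assms sum_list_div_mod[of p \<beta>] by (auto simp: label_of_def partition_pairs_def)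
qed

section \<open>Retracts and summands belonging to the label of a pair of compositions\<close>

context signed_family
begin

text \<open>If p does not divide m + 1, then m and m + 1 have the same quotient by p and the residue
  drops by 1; the new part 1 of the first composition makes up for it.\<close>

lemma label_step:
  assumes "label_of p \<alpha> \<beta> la mu" and j: "j < length \<beta>" "\<beta> ! j = Suc m" "Suc m mod p \<noteq> 0"
  shows "label_of p (\<alpha> @ [1]) (\<beta>[j := m]) la mu"
    and "sum_list (map (\<lambda>b. b mod p) \<beta>) = Suc (sum_list (map (\<lambda>b. b mod p) (\<beta>[j := m])))"
proof -
  have d: "m div p = Suc m div p" and r: "Suc (m mod p) = Suc m mod p"
    using j(3) by (auto simp: mod_Suc div_Suc split: if_splits)
  have e: "map (\<lambda>b. b div p) (\<beta>[j := m]) = map (\<lambda>b. b div p) \<beta>"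
    using j d by (simp add: map_update list_update_same_conv)
  show e2: "sum_list (map (\<lambda>b. b mod p) \<beta>) = Suc (sum_list (map (\<lambda>b. b mod p) (\<beta>[j := m])))"
    using sum_list_update_add[of j "map (\<lambda>b. b mod p) \<beta>" "m mod p"] j(1,2) r by (simp add: map_update)
  show "label_of p (\<alpha> @ [1]) (\<beta>[j := m]) la mu"
    using assms(1) unfolding label_of_def e e2 by simp
qed

lemma exists_residue:
  assumes "sum_list (map (\<lambda>b. b mod p) \<beta>) = Suc r"
  obtains j m where "j < length \<beta>" "\<beta> ! j = Suc m" "Suc m mod p \<noteq> 0"
proof -
  obtain b where b: "b \<in> set \<beta>" "b mod p \<noteq> 0"
  proof -
    have "sum_list (map (\<lambda>b. b mod p) \<beta>) \<noteq> 0" using assms by simp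
    then show thesis using that by (auto simp: sum_list_eq_0_iff)
  qed
  obtain m where m: "b = Suc m" using b(2) by (cases b) auto
  obtain j where "j < length \<beta>" "\<beta> ! j = b" using b(1) by (auto simp: in_set_conv_nth)
  then show ?thesis using that[of j m] b(2) m by simp
qed

text \<open>When all residues vanish, every part of \<beta> is p times its quotient, so the pair is
  (\<lambda>|p\<mu>) up to order and zero parts.\<close>

lemma label_base:
  assumes "label_of p \<alpha> \<beta> la mu" "sum_list (map (\<lambda>b. b mod p) \<beta>) = 0" "p > 0"
  shows "mset \<alpha> = mset la" "mset (filter (\<lambda>x. x \<noteq> 0) \<beta>) = mset (filter (\<lambda>x. x \<noteq> 0) (map ((*) p) mu))"
proof -
  show "mset \<alpha> = mset la" using assms by (simp add: label_of_def)
  have "\<forall>b\<in>set \<beta>. b mod p = 0" using assms(2) by (simp add: sum_list_eq_0_iff)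
  then have "filter (\<lambda>x. x \<noteq> 0) \<beta> = map ((*) p) (filter (\<lambda>x. x \<noteq> 0) (map (\<lambda>b. b div p) \<beta>))"
    by (induction \<beta>) (use assms(3) in \<open>auto simp: dvd_div_eq_0_iff mod_eq_0_iff_dvd\<close>)
  then have "mset (filter (\<lambda>x. x \<noteq> 0) \<beta>) = mset (map ((*) p) mu)"
    using assms(1) by (simp add: label_of_def)
  moreover have "filter (\<lambda>x. x \<noteq> 0) (map ((*) p) mu) = map ((*) p) mu"
    using assms by (auto simp: label_of_def is_partition_def composition_def filter_id_conv)
  ultimately show "mset (filter (\<lambda>x. x \<noteq> 0) \<beta>) = mset (filter (\<lambda>x. x \<noteq> 0) (map ((*) p) mu))" by simp
qed

context
  fixes p :: nat
  assumes p: "CHAR('k) = p" "p > 0"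
begin

text \<open>Induction on the sum of the residues. A part with nonzero residue is a nonzero scalar in
  characteristic p, so \<open>family_step\<close> applies to it and the label is kept.\<close>

lemma retract_label:
  assumes "sum_list \<alpha> + sum_list \<beta> = n" "label_of p \<alpha> \<beta> la mu"
  shows "retract_of A (K \<alpha> \<beta>) (K la (map ((*) p) mu))"
  using assms
proof (induction "sum_list (map (\<lambda>b. b mod p) \<beta>)" arbitrary: \<alpha> \<beta>)
  case 0
  from label_base[OF 0(3) 0(1)[symmetric] p(2)] family_retract[OF 0(2)] show ?case by simp
next
  case (Suc r)
  obtain j m where j: "j < length \<beta>" "\<beta> ! j = Suc m" "Suc m mod p \<noteq> 0"
    using exists_residue[OF Suc(2)[symmetric]] .
  have c: "(of_nat (Suc m) :: 'k) \<noteq> 0" unfolding of_nat_eq_0_iff_char_dvd p(1) using j(3) by (simp add: mod_eq_0_iff_dvd)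
  note ls = label_step[OF Suc(4) j]
  have "sum_list (\<beta>[j := m]) + Suc m = sum_list \<beta> + m"
    using sum_list_update_add[OF j(1), of m] j(2) by simp
  then have "sum_list (\<alpha> @ [1]) + sum_list (\<beta>[j := m]) = n" using Suc(3) by simp
  then have "retract_of A (K (\<alpha> @ [1]) (\<beta>[j := m])) (K la (map ((*) p) mu))"
    using Suc(1)[of "\<beta>[j := m]" "\<alpha> @ [1]"] ls Suc(2) by simp
  from retract_of_trans[OF family_step(1)[OF Suc(3) j(1,2) c] this] show ?case .
qed

context
  fixes Z :: "nat list \<times> nat list \<Rightarrow> ('k, 'a, 'y) kmodule"
  assumes Z: "labels_summands p n A K Z" and Zlin: "\<And>x. x \<in> partition_pairs p n \<Longrightarrow> linear_action A (Z x)"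
begin

lemma pair_sum: "(la, mu) \<in> partition_pairs p n \<Longrightarrow> sum_list la + sum_list (map ((*) p) mu) = n"
  by (simp add: partition_pairs_def sum_list_const_mult)

lemma multiplicity_label:
  assumes "(la, mu) \<in> partition_pairs p n"
  shows "multiplicity_in A (K la (map ((*) p) mu)) (Z (la, mu)) = 1"
  by (rule labels_summandsD(3)[OF Z assms])

text \<open>A retract isomorphic to \<open>Z x\<close> gives an indecomposable summand, which by
  hypothesis either is labelled (\<lambda>|p\<mu>) or has a strictly dominating label.\<close>

lemma dominates_label:
  assumes x: "x \<in> partition_pairs p n" and y: "(la, mu) \<in> partition_pairs p n"
    and r: "retract_of A (Z x) (K la (map ((*) p) mu))"
  shows "dominates p x (la, mu)"
proof -
  let ?M = "K la (map ((*) p) mu)"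
  note lin = family_linear[OF pair_sum[OF y]]
  have "has_summand A ?M (Z x)" using r has_summand_iff_retract[OF lin Zlin[OF x]] by simp
  then obtain U where U: "direct_summand A ?M U" "mod_iso A (mod_restrict ?M U) (Z x)"
    unfolding has_summand_def by blast
  have Ulin: "linear_action A (mod_restrict ?M U)"
    using linear_action_restrict[OF lin] U(1) by (simp add: direct_summand_def)
  have Ui: "indecomposable A (mod_restrict ?M U)"
    by (rule indecomposable_iso[OF U(2) Ulin Zlin[OF x] labels_summandsD(1)[OF Z x]])
  \<comment> \<open>The labelled modules are pairwise non-isomorphic, so any label found for the
    summand \<open>U\<close> must be x.\<close>
  have inj: "x = x'" if "x' \<in> partition_pairs p n" "mod_iso A (mod_restrict ?M U) (Z x')" for x'
  proof -
    have "mod_iso A (Z x) (Z x')" using mod_iso_trans[OF mod_iso_sym[OF U(2) Ulin] that(2)] .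
    from labels_summandsD(2)[OF Z x that(1) this] show ?thesis .
  qed
  show ?thesis
  proof (cases "mod_iso A (mod_restrict ?M U) (Z (la, mu))")
    case True
    then show ?thesis using inj[OF y] by (simp add: dominates_def)
  next
    case False
    obtain x' where "x' \<in> partition_pairs p n" "strictly_dominates p x' (la, mu)" "mod_iso A (mod_restrict ?M U) (Z x')"
      using labels_summandsD(4)[OF Z y U(1) Ui False] by blast
    then show ?thesis using inj by (simp add: strictly_dominates_def)
  qed
qed

text \<open>If \<open>Z\<close> did not survive in the exterior summand of a Koszul step, it would occur in the other one,
  whose label has a strictly larger excess \<open>\<Sum>(\<lambda>\<^sub>i - 1)\<close>; but the excess is monotone for dominance.\<close>

lemma label_summand:
  assumes "composition \<alpha>" "sum_list \<alpha> + sum_list \<beta> = n" "label_of p \<alpha> \<beta> la mu"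
  shows "retract_of A (Z (la, mu)) (K \<alpha> \<beta>)"
proof -
  have y: "(la, mu) \<in> partition_pairs p n" using label_of_partition_pairs[OF assms(3)] assms(2) by simp
  let ?M = "K la (map ((*) p) mu)"
  note lin = family_linear[OF pair_sum[OF y]]
  have hs: "has_summand A ?M (Z (la, mu))" by (rule multiplicity_1_has_summand[OF multiplicity_label[OF y]])
  then obtain U where U: "direct_summand A ?M U" "mod_iso A (mod_restrict ?M U) (Z (la, mu))"
    unfolding has_summand_def by blast
  let ?U = "mod_restrict ?M U"
  have Us: "submodule_of A ?M U" using U(1) by (simp add: direct_summand_def)
  have Ulin: "linear_action A ?U" using linear_action_restrict[OF lin Us] .
  have Ui: "indecomposable A ?U"
    by (rule indecomposable_iso[OF U(2) Ulin Zlin[OF y] labels_summandsD(1)[OF Z y]])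
  \<comment> \<open>Local finiteness is known for the modules of the family and passes to
    submodules; hence the induction is run with the isomorphic copy \<open>U\<close> inside
    \<open>?M\<close> in place of the given representative.\<close>
  have Ulf: "locally_finite A ?U"
    by (rule locally_finite_restrict[OF lin family_locally_finite[OF pair_sum[OF y]] Us])
  have "retract_of A ?U (K \<alpha> \<beta>)"
    using assms
  proof (induction "sum_list (map (\<lambda>b. b mod p) \<beta>)" arbitrary: \<alpha> \<beta>)
    case 0
    have "retract_of A ?M (K \<alpha> \<beta>)"
      by (rule family_retract[OF pair_sum[OF y] label_base[OF 0(4) 0(1)[symmetric] p(2), symmetric]])
    from retract_of_trans[OF direct_summand_retract[OF lin U(1)] this] show ?case .
  next
    case (Suc r)
    obtain j m where j: "j < length \<beta>" "\<beta> ! j = Suc m" "Suc m mod p \<noteq> 0"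
      using exists_residue[OF Suc(2)[symmetric]] .
    have c: "(of_nat (Suc m) :: 'k) \<noteq> 0" unfolding of_nat_eq_0_iff_char_dvd p(1) using j(3) by (simp add: mod_eq_0_iff_dvd)
    note ls = label_step[OF Suc(5) j]
    have sb: "sum_list (\<beta>[j := k]) + Suc m = sum_list \<beta> + k" for k
      using sum_list_update_add[OF j(1), of k] j(2) by simp
    have nM: "sum_list (\<alpha> @ [1]) + sum_list (\<beta>[j := m]) = n" using Suc(4) sb[of m] by simp
    have "retract_of A ?U (K (\<alpha> @ [1]) (\<beta>[j := m]))"
      using Suc(1)[of "\<beta>[j := m]" "\<alpha> @ [1]"] ls Suc(2,3) nM by (simp add: composition_def)
    from family_step(2)[OF Suc(4) j(1,2) c Ulin Ulf Ui this]
    show ?case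
    proof (elim disjE conjE)
      assume m: "0 < m" and UN: "retract_of A ?U (K (\<alpha> @ [2]) (\<beta>[j := m - 1]))"
      let ?\<alpha> = "\<alpha> @ [2]" and ?\<beta> = "\<beta>[j := m - 1]"
      have comp: "composition ?\<alpha>" using Suc(3) by (simp add: composition_def)
      have nN: "sum_list ?\<alpha> + sum_list ?\<beta> = n" using Suc(4) sb[of "m - 1"] m by simp
      obtain la' mu' where l': "label_of p ?\<alpha> ?\<beta> la' mu'" using label_of_exists[OF comp] .
      have y': "(la', mu') \<in> partition_pairs p n" using label_of_partition_pairs[OF l'] nN by simp
      \<comment> \<open>The complement is in turn a retract of the module of its own label, so
        dominance can be read off there.\<close>
      have "retract_of A (Z (la, mu)) (K la' (map ((*) p) mu'))"
        by (rule retract_of_trans[OF mod_iso_retract(2)[OF U(2) Ulin] retract_of_trans[OF UN retract_label[OF nN l']]])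
      then have dom: "dominates p (la, mu) (la', mu')" by (rule dominates_label[OF y y'])
      let ?e = "\<lambda>xs. sum_list (map (\<lambda>x. x - (1::nat)) xs)"
      have ms: "mset la = mset (\<alpha> @ replicate (sum_list (map (\<lambda>b. b mod p) \<beta>)) 1)"
        "mset la' = mset (?\<alpha> @ replicate (sum_list (map (\<lambda>b. b mod p) ?\<beta>)) 1)"
        using Suc(5) l' by (simp_all add: label_of_def)
      have e: "?e la = ?e \<alpha>" "?e la' = ?e \<alpha> + 1"
        using mset_sum_list_map[OF ms(1), of "\<lambda>x. x - 1"] mset_sum_list_map[OF ms(2), of "\<lambda>x. x - 1"]
        by (simp_all add: sum_list_replicate)
      let ?q = "length (filter (\<lambda>x. 1 < x) la')"
      \<comment> \<open>The part 2 ensures q \<ge> 1, as dominance compares partial sums of positive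
        length only.\<close>
      have "2 \<in> set la'" using mset_eq_setD[OF ms(2)] by simp
      then have "2 \<in> set (filter (\<lambda>x. 1 < x) la')" by simp
      from length_pos_if_in_set[OF this] have q: "?q \<ge> 1" by (simp only: Suc_le_eq One_nat_def)
      have "?q + ?e la' = sum_list (take ?q la')"
        using sum_take_excess[of la'] l' by (simp add: label_of_def is_partition_def)
      also have "\<dots> \<le> sum_list (take ?q la)" using dom q by (simp add: dominates_def)
      also have "\<dots> \<le> ?q + ?e la" by (rule sum_take_le_excess)
      finally show ?thesis using e by simp
    qed
  qed
  from retract_of_trans[OF mod_iso_retract(2)[OF U(2) Ulin] this] show ?thesis .
qed

text \<open>The module is a retract of the one of (\<lambda>|p\<mu>): this bounds the multiplicity
  by 1 and makes all labels dominate. That the label itself occurs is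
  \<open>label_summand\<close>.\<close>

theorem family_theorem:
  assumes \<alpha>: "composition \<alpha>" and n: "sum_list \<alpha> + sum_list \<beta> = n" and l: "label_of p \<alpha> \<beta> la mu"
  shows "has_summand A (K \<alpha> \<beta>) (Z (la, mu)) \<and> multiplicity_in A (K \<alpha> \<beta>) (Z (la, mu)) = 1 \<and>
    (\<forall>(de, th)\<in>partition_pairs p n. has_summand A (K \<alpha> \<beta>) (Z (de, th)) \<longrightarrow> dominates p (de, th) (la, mu))"
proof -
  have y: "(la, mu) \<in> partition_pairs p n" using label_of_partition_pairs[OF l] n by simp
  note lin = family_linear[OF n]
  have hs: "has_summand A (K \<alpha> \<beta>) (Z (la, mu))"
    using has_summand_iff_retract[OF lin Zlin[OF y]] label_summand[OF \<alpha> n l] by simp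
  have r: "retract_of A (K \<alpha> \<beta>) (K la (map ((*) p) mu))" by (rule retract_label[OF n l])
  have "multiplicity_in A (K \<alpha> \<beta>) (Z (la, mu)) \<le> 1"
    using multiplicity_mono[OF r lin family_linear[OF pair_sum[OF y]]] multiplicity_label[OF y] by metis
  then have m: "multiplicity_in A (K \<alpha> \<beta>) (Z (la, mu)) = 1" using multiplicity_ge_1[OF hs] by (rule antisym)
  have "dominates p x (la, mu)" if "x \<in> partition_pairs p n" "has_summand A (K \<alpha> \<beta>) (Z x)" for x
    using that(2) unfolding has_summand_iff_retract[OF lin Zlin[OF that(1)]]
    by (intro dominates_label[OF that(1) y] retract_of_trans[OF _ r])
  then show ?thesis using hs m by auto
qed

end

end

end

section \<open>Signed Young permutation modules\<close>

lemma sum_fun_apply: "(\<Sum>i\<in>I. f i) x = (\<Sum>i\<in>I. f i x :: 'k::comm_monoid_add)"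
  by (induction I rule: infinite_finite_induct) auto

text \<open>Positions are counted from 0. A zero part is skipped but keeps its index; positions past
  the end get the length of the list.\<close>

fun block_of :: "nat list \<Rightarrow> nat \<Rightarrow> nat" where
  "block_of [] x = 0"
| "block_of (g # \<gamma>) x = (if x < g then 0 else Suc (block_of \<gamma> (x - g)))"

lemma block_of_less: "x < sum_list \<gamma> \<Longrightarrow> block_of \<gamma> x < length \<gamma>"
  by (induction \<gamma> arbitrary: x) auto

lemma block_of_eq_iff:
  assumes "x < sum_list \<gamma>" "i < length \<gamma>"
  shows "block_of \<gamma> x = i \<longleftrightarrow> sum_list (take i \<gamma>) \<le> x \<and> x < sum_list (take (Suc i) \<gamma>)"
  using assms
proof (induction \<gamma> arbitrary: x i)
  case (Cons g \<gamma>)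
  show ?case
  proof (cases i)
    case (Suc k)
    then show ?thesis using Cons(1)[of "x - g" k] Cons(2,3) by auto
  qed simp
qed simp

lemma sum_list_take_le: "sum_list (take i \<gamma>) \<le> sum_list (\<gamma> :: nat list)"
  by (metis append_take_drop_id le_add1 sum_list.append)

lemma card_block_of:
  assumes "i < length \<gamma>"
  shows "card {x. x < sum_list \<gamma> \<and> block_of \<gamma> x = i} = \<gamma> ! i"
proof -
  have "{x. x < sum_list \<gamma> \<and> block_of \<gamma> x = i} = {sum_list (take i \<gamma>)..<sum_list (take (Suc i) \<gamma>)}"
    using block_of_eq_iff[OF _ assms] sum_list_take_le[of "Suc i" \<gamma>] by fastforce
  then show ?thesis using assms by (simp add: take_Suc_conv_app_nth)
qed

text \<open>Used directly on the positions 0, ..., n - 1 of a tensor and shifted by one on the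
  points 1, ..., n.\<close>

definition word_colour :: "nat list \<Rightarrow> nat list \<Rightarrow> nat \<Rightarrow> nat + nat" where
  "word_colour \<alpha> \<beta> x = (let i = block_of (\<alpha> @ \<beta>) x in if i < length \<alpha> then Inl i else Inr (i - length \<alpha>))"

lemma word_colour_eq_iff: "word_colour \<alpha> \<beta> x = word_colour \<alpha> \<beta> y \<longleftrightarrow> block_of (\<alpha> @ \<beta>) x = block_of (\<alpha> @ \<beta>) y"
  by (auto simp: word_colour_def Let_def)

lemma card_word_colour: 
  "card {x. x < sum_list \<alpha> + sum_list \<beta> \<and> word_colour \<alpha> \<beta> x = y} = colour_count \<alpha> \<beta> y"
proof -
  let ?\<gamma> = "\<alpha> @ \<beta>"
  have less: "block_of ?\<gamma> x < length \<alpha> + length \<beta>" if "x < sum_list \<alpha> + sum_list \<beta>" for x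
    using block_of_less[of x ?\<gamma>] that by simp
  show ?thesis
  proof (cases y)
    case (Inl i)
    show ?thesis
    proof (cases "i < length \<alpha>")
      case True
      then have "{x. x < sum_list \<alpha> + sum_list \<beta> \<and> word_colour \<alpha> \<beta> x = y} = {x. x < sum_list ?\<gamma> \<and> block_of ?\<gamma> x = i}"
        using Inl by (auto simp: word_colour_def Let_def split: if_splits)
      then show ?thesis using card_block_of[of i ?\<gamma>] True Inl by (simp add: nth_append)
    next
      case False
      then have "{x. x < sum_list \<alpha> + sum_list \<beta> \<and> word_colour \<alpha> \<beta> x = y} = {}"
        using Inl by (auto simp: word_colour_def Let_def split: if_splits)
      then show ?thesis using False Inl by simp
    qed
  next
    case (Inr i)
    show ?thesis
    proof (cases "i < length \<beta>")
      case True
      then have "{x. x < sum_list \<alpha> + sum_list \<beta> \<and> word_colour \<alpha> \<beta> x = y} = {x. x < sum_list ?\<gamma> \<and> block_of ?\<gamma> x = length \<alpha> + i}"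
        using Inr by (auto simp: word_colour_def Let_def split: if_splits)
      then show ?thesis using card_block_of[of "length \<alpha> + i" ?\<gamma>] True Inr by (simp add: nth_append)
    next
      case False
      then have "{x. x < sum_list \<alpha> + sum_list \<beta> \<and> word_colour \<alpha> \<beta> x = y} = {}"
        using Inr less by (fastforce simp: word_colour_def Let_def split: if_splits)
      then show ?thesis using False Inr by simp
    qed
  qed
qed

lemma block_of_less_iff: "block_of (\<alpha> @ \<beta>) x < length \<alpha> \<longleftrightarrow> x < sum_list \<alpha>"
proof (induction \<alpha> arbitrary: x)
  case (Cons g \<alpha>)
  show ?case
  proof (cases "x < g")
    case False
    then show ?thesis using Cons[of "x - g"] by auto
  qed simp
qed simp

text \<open>The words are the group elements: the group acts by left multiplication, while positions
  are permuted by right multiplication. The entry is that of the left regular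
  representation.\<close>

definition perm_matrix :: "(nat \<Rightarrow> nat) \<Rightarrow> (nat \<Rightarrow> nat) \<Rightarrow> (nat \<Rightarrow> nat) \<Rightarrow> 'k::field" where
  "perm_matrix a v w = (if v = a \<circ> w then 1 else 0)"

lemma signed_words_sym_group:
  "signed_words (carrier (sym_group n)) (carrier (sym_group n)) {1..n} (\<circ>) (perm_matrix :: _ \<Rightarrow> _ \<Rightarrow> _ \<Rightarrow> 'k::field)"
proof
  let ?C = "carrier (sym_group n)"
  have fin: "finite ?C" using finite_permutations[of "{1..n}"] by (simp add: sym_group_def)
  show "w \<circ> \<sigma> \<in> ?C" if "w \<in> ?C" "\<sigma> permutes {1..n}" for w \<sigma>
    using that permutes_compose[of \<sigma> "{1..n}" w] by (simp add: sym_group_carrier)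
  show "finite {v \<in> ?C. (perm_matrix a v w :: 'k) \<noteq> 0}" for a w using fin by simp
  show "(perm_matrix a (v \<circ> \<sigma>) (w \<circ> \<sigma>) :: 'k) = perm_matrix a v w" if "\<sigma> permutes {1..n}" for a v w \<sigma>
  proof -
    have "v \<circ> \<sigma> = a \<circ> (w \<circ> \<sigma>) \<longleftrightarrow> v = a \<circ> w"
    proof
      assume "v \<circ> \<sigma> = a \<circ> (w \<circ> \<sigma>)"
      then have "v (\<sigma> y) = a (w (\<sigma> y))" for y by (metis comp_apply)
      then show "v = a \<circ> w" using permutes_surj[OF that] by (metis comp_apply ext surjD)
    qed (simp add: o_assoc)
    then show ?thesis by (simp add: perm_matrix_def)
  qed
  show "\<exists>a\<in>?C. \<exists>T. finite T \<and> T \<subseteq> ?C \<and>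
      (\<forall>w\<in>F. \<forall>v\<in>?C. (perm_matrix a v w :: 'k) = (if v = w then 1 else 0)) \<and>
      (\<forall>w\<in>?C. \<forall>v\<in>?C. (perm_matrix a v w :: 'k) \<noteq> 0 \<longrightarrow> v \<in> T)" for F
    using fin by (intro bexI[of _ id] exI[of _ ?C]) (auto simp: perm_matrix_def sym_group_def permutes_id)
qed (auto simp: o_assoc)

section \<open>Presentation of one signed Young permutation module by group elements\<close>

context
  fixes \<alpha> \<beta> :: "nat list" and n :: nat and c :: "nat \<Rightarrow> nat + nat" and H :: "(nat \<Rightarrow> nat) set"
    and \<chi> :: "(nat \<Rightarrow> nat) \<Rightarrow> 'k::field"
  defines "n \<equiv> sum_list \<alpha> + sum_list \<beta>" and "c \<equiv> \<lambda>x. word_colour \<alpha> \<beta> (x - 1)"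
    and "H \<equiv> young_subgroup (\<alpha> @ \<beta>)"
    and "\<chi> \<equiv> \<lambda>\<sigma>. of_int (sign_on {sum_list \<alpha> + 1 .. n} \<sigma>)"
begin

abbreviation (input) iv :: "(nat \<Rightarrow> nat) \<Rightarrow> nat \<Rightarrow> nat" where "iv \<equiv> inv_into UNIV"

lemma young_block_eq:
  assumes "i < length (\<alpha> @ \<beta>)"
  shows "young_block (\<alpha> @ \<beta>) i = {x \<in> {1..n}. block_of (\<alpha> @ \<beta>) (x - 1) = i}"
proof -
  have n: "sum_list (\<alpha> @ \<beta>) = n" by (simp add: n_def)
  have iff: "block_of (\<alpha> @ \<beta>) (x - 1) = i \<longleftrightarrow> sum_list (take i (\<alpha> @ \<beta>)) \<le> x - 1 \<and> x - 1 < sum_list (take (Suc i) (\<alpha> @ \<beta>))"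
    if "x \<in> {1..n}" for x
    using block_of_eq_iff[OF _ assms, of "x - 1"] n that by auto
  have le: "sum_list (take (Suc i) (\<alpha> @ \<beta>)) \<le> n" using sum_list_take_le[of "Suc i" "\<alpha> @ \<beta>"] n by simp
  have "x \<in> {sum_list (take i (\<alpha> @ \<beta>)) + 1..sum_list (take (Suc i) (\<alpha> @ \<beta>))} \<longleftrightarrow>
    x \<in> {1..n} \<and> block_of (\<alpha> @ \<beta>) (x - 1) = i" for x
  proof (cases "x \<in> {1..n}")
    case True
    have "x \<ge> 1" using True by simp
    then show ?thesis unfolding iff[OF True] using True by (simp only: atLeastAtMost_iff) linarith
  next
    case False
    then have "\<not> (sum_list (take i (\<alpha> @ \<beta>)) + 1 \<le> x \<and> x \<le> sum_list (take (Suc i) (\<alpha> @ \<beta>)))"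
      using le by (simp only: atLeastAtMost_iff) linarith
    then show ?thesis using False by (simp only: atLeastAtMost_iff) blast
  qed
  then show ?thesis unfolding young_block_def by blast
qed

text \<open>Pointwise invariance of colours is easier to check for products, inverses and
  transpositions than invariance of blocks. Conversely, an injective map of a finite block into
  itself is onto.\<close>

lemma H_eq: "H = {\<sigma>. \<sigma> permutes {1..n} \<and> (\<forall>x\<in>{1..n}. c (\<sigma> x) = c x)}"
proof -
  let ?\<gamma> = "\<alpha> @ \<beta>"
  have n: "sum_list ?\<gamma> = n" by (simp add: n_def)
  have "(\<forall>i<length ?\<gamma>. \<sigma> ` young_block ?\<gamma> i = young_block ?\<gamma> i) \<longleftrightarrow> (\<forall>x\<in>{1..n}. c (\<sigma> x) = c x)"
    if \<sigma>: "\<sigma> permutes {1..n}" for \<sigma>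
  proof
    assume l: "\<forall>i<length ?\<gamma>. \<sigma> ` young_block ?\<gamma> i = young_block ?\<gamma> i"
    show "\<forall>x\<in>{1..n}. c (\<sigma> x) = c x"
    proof
      fix x assume x: "x \<in> {1..n}"
      define i where "i = block_of ?\<gamma> (x - 1)"
      have i: "i < length ?\<gamma>" using block_of_less[of "x - 1" ?\<gamma>] x n unfolding i_def by auto
      have "x \<in> young_block ?\<gamma> i" using young_block_eq[OF i] x by (simp add: i_def)
      then have "\<sigma> x \<in> young_block ?\<gamma> i" using l i by blast
      then show "c (\<sigma> x) = c x" using young_block_eq[OF i] by (simp add: c_def word_colour_eq_iff i_def)
    qed
  next
    assume r: "\<forall>x\<in>{1..n}. c (\<sigma> x) = c x"
    show "\<forall>i<length ?\<gamma>. \<sigma> ` young_block ?\<gamma> i = young_block ?\<gamma> i"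
    proof (intro allI impI)
      fix i assume i: "i < length ?\<gamma>"
      have "\<sigma> ` young_block ?\<gamma> i \<subseteq> young_block ?\<gamma> i"
        using r permutes_in_image[OF \<sigma>] unfolding young_block_eq[OF i] by (auto simp: c_def word_colour_eq_iff)
      then show "\<sigma> ` young_block ?\<gamma> i = young_block ?\<gamma> i"
        by (intro endo_inj_surj) (auto simp: young_block_def intro: inj_on_subset[OF permutes_inj[OF \<sigma>]])
    qed
  qed
  then show ?thesis unfolding H_def young_subgroup_def n by blast
qed

lemma H_permutes: "h \<in> H \<Longrightarrow> h permutes {1..n}" by (simp add: H_eq)

lemma H_comp:
  assumes "g \<in> H" "h \<in> H"
  shows "g \<circ> h \<in> H"
  using assms permutes_compose[of h "{1..n}" g] permutes_in_image[of h "{1..n}"] by (simp add: H_eq)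

lemma H_inv:
  assumes "h \<in> H"
  shows "iv h \<in> H"
proof -
  have h: "h permutes {1..n}" using H_permutes[OF assms] .
  have "c (iv h x) = c x" if x: "x \<in> {1..n}" for x
  proof -
    have "iv h x \<in> {1..n}" using permutes_in_image[OF permutes_inv[OF h]] x by simp
    then have "c (h (iv h x)) = c (iv h x)" using assms by (simp add: H_eq)
    then show ?thesis using permutes_inverses[OF h] by simp
  qed
  then show ?thesis using permutes_inv[OF h] by (simp add: H_eq)
qed

lemma H_id: "id \<in> H" by (simp add: H_eq permutes_id)

text \<open>Multiplicativity of \<open>sign_on\<close> asks for bijections of the underlying set.
  Elements of \<open>H\<close> preserve it since it consists of the points with an antisymmetric
  colour.\<close>

lemma H_bij:
  assumes "h \<in> H"
  shows "bij_betw h {sum_list \<alpha> + 1..n} {sum_list \<alpha> + 1..n}"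
proof -
  have h: "h permutes {1..n}" using H_permutes[OF assms] .
  have sg: "x \<in> {sum_list \<alpha> + 1..n} \<longleftrightarrow> x \<in> {1..n} \<and> (\<exists>j. c x = Inr j)" for x
  proof -
    have "(\<exists>j. c x = Inr j) \<longleftrightarrow> \<not> x - 1 < sum_list \<alpha>"
      using block_of_less_iff[of \<alpha> \<beta> "x - 1"] by (auto simp: c_def word_colour_def Let_def)
    then show ?thesis by auto
  qed
  have "h ` {sum_list \<alpha> + 1..n} \<subseteq> {sum_list \<alpha> + 1..n}"
  proof
    fix y assume "y \<in> h ` {sum_list \<alpha> + 1..n}"
    then obtain x where x: "x \<in> {sum_list \<alpha> + 1..n}" "y = h x" by blast
    then have "x \<in> {1..n}" "\<exists>j. c x = Inr j" using sg by blast+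
    moreover have "c y = c x" "y \<in> {1..n}" using assms x(2) \<open>x \<in> {1..n}\<close> permutes_in_image[OF h] by (auto simp: H_eq)
    ultimately have "\<exists>j. c y = Inr j" "y \<in> {1..n}" by simp_all
    then show "y \<in> {sum_list \<alpha> + 1..n}" unfolding sg by blast
  qed
  then have "h ` {sum_list \<alpha> + 1..n} = {sum_list \<alpha> + 1..n}"
    by (intro endo_inj_surj) (auto intro: inj_on_subset[OF permutes_inj[OF h]])
  then show ?thesis using inj_on_subset[OF permutes_inj[OF h]] by (simp add: bij_betw_def)
qed

lemma \<chi>_comp: "g \<in> H \<Longrightarrow> h \<in> H \<Longrightarrow> \<chi> (g \<circ> h) = \<chi> g * \<chi> h"
  unfolding \<chi>_def by (simp only: sign_on_compose[OF H_bij H_bij finite_atLeastAtMost] of_int_mult)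

lemma \<chi>_square: "\<chi> h * \<chi> h = 1"
  by (simp add: \<chi>_def sign_on_def sign_def)

text \<open>The values are 1 and -1, so the inverse in the definition of the induced module
  disappears.\<close>

lemma inverse_\<chi>: "inverse (\<chi> h) = \<chi> h"
  using \<chi>_square by (metis inverse_unique)

lemma \<chi>_id: "\<chi> id = 1"
  by (simp add: \<chi>_def)

lemma swap_H:
  assumes "i \<in> {1..n}" "j \<in> {1..n}" "i \<noteq> j" "c i = c j"
  shows "swap i j \<in> H" "\<chi> (swap i j) = colour_sign (c i)"
proof -
  show "swap i j \<in> H" using assms by (auto simp: H_eq permutes_swap_id Transposition.transpose_def)
  have "c x = Inl l \<Longrightarrow> x - 1 < sum_list \<alpha>" "c x = Inr l \<Longrightarrow> \<not> x - 1 < sum_list \<alpha>" for x l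
    using block_of_less_iff[of \<alpha> \<beta> "x - 1"] by (auto simp: c_def word_colour_def Let_def split: if_splits)
  note l = this
  show "\<chi> (swap i j) = colour_sign (c i)"
  proof (cases "c i")
    case (Inl k)
    then have "i \<notin> {sum_list \<alpha> + 1..n}" "j \<notin> {sum_list \<alpha> + 1..n}" using l(1)[of i] l(1)[of j] assms by auto
    then have "sign_on {sum_list \<alpha> + 1..n} (swap i j) = sign_on {sum_list \<alpha> + 1..n} id"
      by (intro sign_on_cong) (auto simp: Transposition.transpose_def)
    then show ?thesis using Inl by (simp add: \<chi>_def)
  next
    case (Inr k)
    then have "i \<in> {sum_list \<alpha> + 1..n}" "j \<in> {sum_list \<alpha> + 1..n}" using l(2)[of i] l(2)[of j] assms by auto
    then show ?thesis using Inr assms(3) by (simp add: \<chi>_def sign_on_transpose)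
  qed
qed

text \<open>The relations concern transpositions within a block, and these generate
  \<open>H\<close>. If h moves x, then (x h(x)) lies in \<open>H\<close>, and composing it after h
  fixes x as well as all fixed points of h; hence induction on the number of moved points.\<close>

lemma compatible_H:
  assumes G: "signed_words.compatible (carrier (sym_group n)) {1..n} (\<circ>) c (G :: (nat \<Rightarrow> nat) \<Rightarrow> 'k)"
    and h: "h \<in> H" and w: "w \<in> carrier (sym_group n)"
  shows "G (w \<circ> h) = \<chi> h * G w"
  using h w
proof (induction "card {x \<in> {1..n}. h x \<noteq> x}" arbitrary: h w rule: less_induct)
  case less
  note comp = signed_words.compatible_def[OF signed_words_sym_group[where 'k = 'k]]
  have h: "h permutes {1..n}" using H_permutes[OF less(2)] .
  show ?case
  proof (cases "h = id")
    case True
    then show ?thesis by (simp add: \<chi>_id)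
  next
    case False
    then obtain x where hx: "h x \<noteq> x" by (auto simp: fun_eq_iff)
    then have x: "x \<in> {1..n}" using permutes_not_in[OF h] by blast
    have x': "h x \<in> {1..n}" using permutes_in_image[OF h] x by simp
    have cx: "c (h x) = c x" using less(2) x by (simp add: H_eq)
    let ?t = "swap x (h x)"
    note t = swap_H[OF x x' hx[symmetric] cx[symmetric]]
    define h' where "h' = ?t \<circ> h"
    have h': "h' \<in> H" unfolding h'_def by (rule H_comp[OF t(1) less(2)])
    have e: "h = ?t \<circ> h'" by (simp add: h'_def fun_eq_iff)
    have "{y \<in> {1..n}. h' y \<noteq> y} \<subset> {y \<in> {1..n}. h y \<noteq> y}"
    proof
      show "{y \<in> {1..n}. h' y \<noteq> y} \<subseteq> {y \<in> {1..n}. h y \<noteq> y}"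
      proof
        fix y assume "y \<in> {y \<in> {1..n}. h' y \<noteq> y}"
        then have y: "y \<in> {1..n}" "h' y \<noteq> y" by auto
        have "h y \<noteq> y"
        proof
          assume hy: "h y = y"
          have "y \<noteq> x" using hx hy by blast
          moreover have "y \<noteq> h x" using hx hy permutes_inj[OF h] by (metis injD)
          ultimately have "h' y = y" using hy by (simp add: h'_def)
          then show False using y(2) by blast
        qed
        then show "y \<in> {y \<in> {1..n}. h y \<noteq> y}" using y(1) by blast
      qed
      have "h' x = x" by (simp add: h'_def)
      then show "{y \<in> {1..n}. h' y \<noteq> y} \<noteq> {y \<in> {1..n}. h y \<noteq> y}" using x hx by blast
    qed
    then have "card {y \<in> {1..n}. h' y \<noteq> y} < card {y \<in> {1..n}. h y \<noteq> y}" by (intro psubset_card_mono) auto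
    moreover have wt: "w \<circ> ?t \<in> carrier (sym_group n)"
      using less(3) permutes_compose[OF H_permutes[OF t(1)], of w] by (simp add: sym_group_carrier)
    ultimately have "G ((w \<circ> ?t) \<circ> h') = \<chi> h' * G (w \<circ> ?t)" using less(1)[OF _ h'] by blast
    moreover have "G (w \<circ> ?t) = \<chi> ?t * G w"
      using G less(3) x x' hx cx unfolding comp t(2) by metis
    moreover have "(w \<circ> ?t) \<circ> h' = w \<circ> h" using e by (simp add: o_assoc[symmetric])
    moreover have "\<chi> h = \<chi> ?t * \<chi> h'" using \<chi>_comp[OF t(1) h'] e by simp
    ultimately show ?thesis by simp
  qed
qed

text \<open>The element w \<otimes> 1 of the induced module, a function supported on the coset of
  w.\<close>

definition coset_fun :: "(nat \<Rightarrow> nat) \<Rightarrow> (nat \<Rightarrow> nat) \<Rightarrow> 'k" where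
  "coset_fun w x = (if x \<in> carrier (sym_group n) \<and> iv w \<circ> x \<in> H then \<chi> (iv w \<circ> x) else 0)"

text \<open>Normal forms are representatives of the left cosets of \<open>H\<close>;
  \<open>compatible_H\<close> reduces an arbitrary group element to the representative of its
  coset.\<close>

lemma presents_signed_perm_module:
  "signed_words.presents (carrier (sym_group n)) (carrier (sym_group n)) {1..n} (\<circ>) perm_matrix
     c (signed_perm_module \<alpha> \<beta> :: ('k, nat \<Rightarrow> nat, nat \<Rightarrow> nat) kmodule) coset_fun"
proof -
  let ?C = "carrier (sym_group n)"
  let ?M = "signed_perm_module \<alpha> \<beta> :: ('k, nat \<Rightarrow> nat, nat \<Rightarrow> nat) kmodule"
  interpret S: signed_words ?C ?C "{1..n}" "(\<circ>)" "perm_matrix :: _ \<Rightarrow> _ \<Rightarrow> _ \<Rightarrow> 'k"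
    by (rule signed_words_sym_group)
  have carr: "mod_carrier ?M = {\<phi>. (\<forall>g. g \<notin> ?C \<longrightarrow> \<phi> g = 0) \<and> (\<forall>g\<in>?C. \<forall>h\<in>H. \<phi> (g \<circ> h) = \<chi> h * \<phi> g)}"
  proof -
    have "inverse (of_int (sign_on {Suc (sum_list \<alpha>)..n} h)) = \<chi> h" for h
      using inverse_\<chi>[of h] by (simp add: \<chi>_def)
    then show ?thesis
      by (simp add: signed_perm_module_def induced_module_def Let_def sym_group_mult H_def n_def[symmetric])
  qed
  have act: "mod_act ?M g \<phi> x = (if x \<in> ?C then \<phi> (iv g \<circ> x) else 0)" if "g \<in> ?C" for g \<phi> x
    using sym_group_inv_equality[OF that]
    by (simp add: signed_perm_module_def induced_module_def Let_def sym_group_mult n_def[symmetric])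
  have inv1: "iv g \<circ> g = id" "g \<circ> iv g = id" "iv g \<in> ?C" if "g \<in> ?C" for g
    using that permutes_inv_o[of g "{1..n}"] permutes_inv[of g "{1..n}"] by (auto simp: sym_group_carrier)
  have C_comp: "g \<circ> h \<in> ?C" if "g \<in> ?C" "h \<in> ?C" for g h
    using that permutes_compose[of h "{1..n}" g] by (simp add: sym_group_carrier)
  have HC: "h \<in> ?C" if "h \<in> H" for h using H_permutes[OF that] by (simp add: sym_group_carrier)
  have fin: "finite ?C" using finite_permutations[of "{1..n}"] by (simp add: sym_group_def)
  have inv_comp: "iv (g \<circ> h) = iv h \<circ> iv g" if "g \<in> ?C" "h \<in> ?C" for g h
    using that permutes_bij by (auto simp: sym_group_carrier intro!: o_inv_distrib)
  have qin: "coset_fun w \<in> mod_carrier ?M" if w: "w \<in> ?C" for w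
  proof -
    have "coset_fun w (g \<circ> h) = \<chi> h * coset_fun w g" if g: "g \<in> ?C" and h: "h \<in> H" for g h
    proof -
      have e: "iv w \<circ> (g \<circ> h) = (iv w \<circ> g) \<circ> h" by (simp add: o_assoc)
      have "(iv w \<circ> g) \<circ> h \<in> H \<longleftrightarrow> iv w \<circ> g \<in> H"
      proof
        assume "(iv w \<circ> g) \<circ> h \<in> H"
        from H_comp[OF this H_inv[OF h]] show "iv w \<circ> g \<in> H"
          using inv1(2)[OF HC[OF h]] by (simp add: o_assoc[symmetric])
      qed (rule H_comp[OF _ h])
      then show ?thesis
        using \<chi>_comp[OF _ h] C_comp[OF g HC[OF h]] g unfolding coset_fun_def e by simp
    qed
    then show ?thesis by (simp add: carr) (simp add: coset_fun_def)
  qed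
  have sub: "fun_space.subspace (mod_carrier ?M)"
    unfolding carr by (rule fun_space.subspaceI) (auto simp: fscale_def algebra_simps)
  have actin: "mod_act ?M a u \<in> mod_carrier ?M" if a: "a \<in> ?C" and u: "u \<in> mod_carrier ?M" for a u
  proof -
    have "mod_act ?M a u (g \<circ> h) = \<chi> h * mod_act ?M a u g" if "g \<in> ?C" "h \<in> H" for g h
      using that u C_comp[OF that(1) HC[OF that(2)]] C_comp[OF inv1(3)[OF a] that(1)]
      by (simp add: act[OF a] carr o_assoc)
    then show ?thesis by (simp add: carr) (simp add: act[OF a])
  qed
  have lin: "linear_action ?C ?M"
    unfolding linear_action_def using sub actin by (auto simp: act fscale_def fun_eq_iff)
  define rep where "rep w = (SOME v. v \<in> ?C \<and> iv v \<circ> w \<in> H)" for w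
  have rep: "rep w \<in> ?C" "iv (rep w) \<circ> w \<in> H" if "w \<in> ?C" for w
    using someI[of "\<lambda>v. v \<in> ?C \<and> iv v \<circ> w \<in> H" w] that inv1(1)[OF that] H_id unfolding rep_def by auto
  \<comment> \<open>Elements of one coset satisfy the same defining predicate, so the choice
    operator returns the same representative.\<close>
  have rep_eq: "rep w = rep v" if v: "v \<in> ?C" and w: "w \<in> ?C" and "iv v \<circ> w \<in> H" for v w
  proof -
    have "iv u \<circ> w \<in> H \<longleftrightarrow> iv u \<circ> v \<in> H" for u
    proof
      assume "iv u \<circ> w \<in> H"
      from H_comp[OF this H_inv[OF that(3)]] show "iv u \<circ> v \<in> H"
        using inv_comp[OF inv1(3)[OF v] w] inv1[OF v] inv1[OF w] by (metis comp_id inv_inv_eq o_assoc permutes_bij sym_group_carrier v)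
    next
      assume "iv u \<circ> v \<in> H"
      from H_comp[OF this that(3)] show "iv u \<circ> w \<in> H"
        using inv1(2)[OF v] by (metis comp_id o_assoc)
    qed
    then show ?thesis unfolding rep_def by simp
  qed
  let ?B = "rep ` ?C"
  have repB: "iv b \<circ> b' \<in> H \<longleftrightarrow> b = b'" if b: "b \<in> ?B" and b': "b' \<in> ?B" for b b'
  proof
    obtain w w' where w: "w \<in> ?C" "b = rep w" and w': "w' \<in> ?C" "b' = rep w'" using b b' by blast
    have bb: "rep b = b" "rep b' = b'"
      using rep_eq[OF rep(1) _ rep(2)] w w' rep(1) by metis+
    assume "iv b \<circ> b' \<in> H"
    then show "b = b'" using rep_eq[of b b'] bb w w' rep(1) by metis
  next
    assume "b = b'"
    then show "iv b \<circ> b' \<in> H" using inv1(1)[of b] b rep(1) H_id by auto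
  qed
  have BC: "?B \<subseteq> ?C" using rep(1) by blast
  \<comment> \<open>Evaluation at the representatives is dual to the functions of the
    representatives, which gives injectivity and independence.\<close>
  have qB: "coset_fun b b' = (if b = b' then 1 else 0)" if "b \<in> ?B" "b' \<in> ?B" for b b'
    using that repB[OF that] BC inv1(1) \<chi>_id by (auto simp: coset_fun_def)
  have inj: "inj_on coset_fun ?B"
  proof (rule inj_onI)
    fix b b' assume b: "b \<in> ?B" "b' \<in> ?B" "coset_fun b = coset_fun b'"
    then have "coset_fun b b' = 1" using qB[OF b(2,2)] by simp
    then show "b = b'" using qB[OF b(1,2)] by (metis zero_neq_one)
  qed
  have finB: "finite ?B" using fin by simp
  have ind: "fun_space.independent (coset_fun ` ?B)"
  proof (rule fun_space.independent_if_scalars_zero)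
    fix f x assume s: "(\<Sum>x\<in>coset_fun ` ?B. fscale (f x) x) = 0" and x: "x \<in> coset_fun ` ?B"
    obtain b' where b': "b' \<in> ?B" "x = coset_fun b'" using x by blast
    have "(\<Sum>b\<in>?B. fscale (f (coset_fun b)) (coset_fun b)) = 0" using s by (simp add: sum.reindex[OF inj])
    then have "(\<Sum>b\<in>?B. fscale (f (coset_fun b)) (coset_fun b)) b' = 0" by simp
    then have "(\<Sum>b\<in>?B. f (coset_fun b) * coset_fun b b') = 0" by (simp add: sum_fun_apply fscale_def)
    moreover have "(\<Sum>b\<in>?B. f (coset_fun b) * coset_fun b b') = (\<Sum>b\<in>?B. if b = b' then f (coset_fun b) else 0)"
      using qB[OF _ b'(1)] by (intro sum.cong) auto
    ultimately show "f x = 0" using b' finB by simp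
  qed (use finB in simp)
  have nf: "\<exists>b\<in>?B. \<exists>s. \<forall>G. S.compatible c G \<longrightarrow> G w = s * G b" if w: "w \<in> ?C" for w
  proof (intro bexI[of _ "rep w"] exI[of _ "\<chi> (iv (rep w) \<circ> w)"] allI impI)
    fix G :: "(nat \<Rightarrow> nat) \<Rightarrow> 'k" assume "S.compatible c G"
    from compatible_H[OF this rep(2)[OF w] rep(1)[OF w]]
    show "G w = \<chi> (iv (rep w) \<circ> w) * G (rep w)"
      using inv1(2)[OF rep(1)[OF w]] by (simp add: o_assoc)
  qed (use w in simp)
  have resp: "S.compatible c (\<lambda>w. coset_fun w x)" for x
    unfolding S.compatible_def
  proof (intro ballI impI)
    fix w i j assume w: "w \<in> ?C" and ij: "i \<in> {1..n}" "j \<in> {1..n}" "i \<noteq> j \<and> c i = c j"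
    let ?t = "swap i j"
    have t: "?t \<in> H" "\<chi> ?t = colour_sign (c i)" using swap_H[OF ij(1,2)] ij(3) by blast+
    have tt: "?t \<circ> (?t \<circ> f) = f" for f by (simp add: fun_eq_iff)
    have e: "iv (w \<circ> ?t) \<circ> x = ?t \<circ> (iv w \<circ> x)"
      using inv_comp[OF w HC[OF t(1)]] by (simp add: o_assoc)
    have "?t \<circ> (iv w \<circ> x) \<in> H \<longleftrightarrow> iv w \<circ> x \<in> H"
      using H_comp[OF t(1)] tt by metis
    then show "coset_fun (w \<circ> ?t) x = colour_sign (c i) * coset_fun w x"
      using \<chi>_comp[OF t(1)] t(2) unfolding coset_fun_def e by simp
  qed
  have span: "mod_carrier ?M = fun_space.span (coset_fun ` ?C)"
  proof (intro equalityI subsetI)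
    fix u assume u: "u \<in> mod_carrier ?M"
    \<comment> \<open>A function in the induced module is determined by its values at the
      representatives, and these are the coefficients.\<close>
    have "u = (\<Sum>b\<in>?B. fscale (u b) (coset_fun b))"
    proof
      fix x
      show "u x = (\<Sum>b\<in>?B. fscale (u b) (coset_fun b)) x"
      proof (cases "x \<in> ?C")
        case False
        then show ?thesis using u by (simp add: carr sum_fun_apply fscale_def coset_fun_def)
      next
        case x: True
        have eq: "iv b \<circ> x \<in> H \<longleftrightarrow> b = rep x" if b: "b \<in> ?B" for b
        proof
          assume "iv b \<circ> x \<in> H"
          then have "rep x = rep b" using rep_eq[of b x] b BC x by blast
          moreover have "rep b = b" using b rep_eq[OF rep(1) _ rep(2)] by auto
          ultimately show "b = rep x" by simp
        qed (use rep(2)[OF x] in simp)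
        have "(\<Sum>b\<in>?B. fscale (u b) (coset_fun b)) x = (\<Sum>b\<in>?B. if b = rep x then u b * \<chi> (iv b \<circ> x) else 0)"
          using x eq by (simp add: sum_fun_apply fscale_def coset_fun_def if_distrib cong: if_cong sum.cong)
        also have "\<dots> = u (rep x) * \<chi> (iv (rep x) \<circ> x)" using x finB by simp
        also have "\<dots> = u (rep x \<circ> (iv (rep x) \<circ> x))"
          using u rep[OF x] unfolding carr by (simp add: mult.commute)
        also have "\<dots> = u x" using inv1(2)[OF rep(1)[OF x]] by (simp add: o_assoc)
        finally show ?thesis by simp
      qed
    qed
    also have "\<dots> \<in> fun_space.span (coset_fun ` ?C)"
      using BC by (intro fun_space.span_sum fun_space.span_scale fun_space.span_base) auto
    finally show "u \<in> fun_space.span (coset_fun ` ?C)" .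
  next
    fix u assume "u \<in> fun_space.span (coset_fun ` ?C)"
    then show "u \<in> mod_carrier ?M" using fun_space.span_minimal[OF _ sub] qin by blast
  qed
  have actq: "mod_act ?M a (coset_fun w) = (\<Sum>v | v \<in> ?C \<and> (perm_matrix a v w :: 'k) \<noteq> 0. fscale (perm_matrix a v w) (coset_fun v))"
    if a: "a \<in> ?C" and w: "w \<in> ?C" for a w
  proof -
    have "{v. v \<in> ?C \<and> (perm_matrix a v w :: 'k) \<noteq> 0} = {a \<circ> w}"
      using C_comp[OF a w] by (auto simp: perm_matrix_def)
    moreover have "mod_act ?M a (coset_fun w) x = coset_fun (a \<circ> w) x" for x
      using inv_comp[OF a w] C_comp[OF inv1(3)[OF a]] by (auto simp: act[OF a] coset_fun_def o_assoc)
    ultimately show ?thesis by (simp add: perm_matrix_def fun_eq_iff)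
  qed
  show ?thesis
    unfolding S.presents_def
  proof (intro conjI allI ballI)
    show "\<exists>B\<subseteq>?C. inj_on coset_fun B \<and> fun_space.independent (coset_fun ` B) \<and>
        (\<forall>w\<in>?C. \<exists>b\<in>B. \<exists>s. \<forall>G. S.compatible c G \<longrightarrow> G w = s * G b)"
      using nf by (intro exI[of _ ?B] conjI BC inj ind ballI)
  qed (use lin resp span actq in simp_all)
qed

end

lemma signed_family_sym_group:
  "signed_family (carrier (sym_group n)) (carrier (sym_group n)) {1..n} (\<circ>) (perm_matrix :: _ \<Rightarrow> _ \<Rightarrow> _ \<Rightarrow> 'k::field)
     (signed_perm_module :: _ \<Rightarrow> _ \<Rightarrow> ('k, nat \<Rightarrow> nat, nat \<Rightarrow> nat) kmodule) n"
proof (rule signed_family.intro[OF signed_words_sym_group], unfold_locales)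
  interpret signed_words "carrier (sym_group n)" "carrier (sym_group n)" "{1..n}" "(\<circ>)"
    "perm_matrix :: _ \<Rightarrow> _ \<Rightarrow> _ \<Rightarrow> 'k"
    by (rule signed_words_sym_group)
  fix \<alpha> \<beta> assume n: "sum_list \<alpha> + sum_list \<beta> = n"
  have "card {y \<in> {1..n}. word_colour \<alpha> \<beta> (y - 1) = x} = colour_count \<alpha> \<beta> x" for x
  proof -
    have "{y \<in> {1..n}. word_colour \<alpha> \<beta> (y - 1) = x} = Suc ` {y. y < n \<and> word_colour \<alpha> \<beta> y = x}"
      by (force simp: image_iff)
    then show ?thesis using card_word_colour[of \<alpha> \<beta> x] n by (simp add: card_image)
  qed
  then show "\<exists>c q. presents c (signed_perm_module \<alpha> \<beta>) q \<and>
      (\<forall>x. card {y \<in> {1..n}. c y = x} = colour_count \<alpha> \<beta> x)"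
    using presents_signed_perm_module[of \<alpha> \<beta>, where 'k = 'k] unfolding n by blast
qed

section \<open>Orbits of pairs of words\<close>

text \<open>An orbit amounts to the multiset of letter pairs of any of its members. Equality of
  orbits and concatenation thereby become questions about multisets.\<close>

lemma orbit_of_iff:
  assumes l: "length i = length j"
  shows "(i', j') \<in> orbit_of i j \<longleftrightarrow> length i' = length i \<and> length j' = length i \<and> mset (zip i' j') = mset (zip i j)"
proof
  assume "(i', j') \<in> orbit_of i j"
  then obtain \<sigma> where \<sigma>: "\<sigma> permutes {..<length i}" "i' = permute_list \<sigma> i" "j' = permute_list \<sigma> j"
    unfolding orbit_of_def by blast
  have "zip i' j' = permute_list \<sigma> (zip i j)"
    using permute_list_zip[OF \<sigma>(1) refl l] \<sigma>(2,3) by simp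
  moreover have "\<sigma> permutes {..<length (zip i j)}" using \<sigma>(1) l by simp
  ultimately show "length i' = length i \<and> length j' = length i \<and> mset (zip i' j') = mset (zip i j)"
    using \<sigma>(2,3) l by simp
next
  assume r: "length i' = length i \<and> length j' = length i \<and> mset (zip i' j') = mset (zip i j)"
  obtain \<sigma> where \<sigma>: "\<sigma> permutes {..<length (zip i j)}" "permute_list \<sigma> (zip i j) = zip i' j'"
    using mset_eq_permutation r by metis
  have s: "\<sigma> permutes {..<length i}" using \<sigma>(1) l by simp
  have "zip (permute_list \<sigma> i) (permute_list \<sigma> j) = zip i' j'"
    using permute_list_zip[OF s refl l] \<sigma>(2) by simp
  then have "map fst (zip (permute_list \<sigma> i) (permute_list \<sigma> j)) = map fst (zip i' j')"
    "map snd (zip (permute_list \<sigma> i) (permute_list \<sigma> j)) = map snd (zip i' j')" by simp_all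
  then have "permute_list \<sigma> i = i'" "permute_list \<sigma> j = j'" using r l by simp_all
  then show "(i', j') \<in> orbit_of i j" unfolding orbit_of_def using s by blast
qed

lemma orbit_of_self: "(i, j) \<in> orbit_of i j"
  unfolding orbit_of_def using permutes_id by (fastforce intro!: exI[of _ id])

lemma orbit_of_eq_iff:
  assumes "length i = length j" "length i' = length j'"
  shows "orbit_of i j = orbit_of i' j' \<longleftrightarrow> (i, j) \<in> orbit_of i' j'"
proof
  assume "(i, j) \<in> orbit_of i' j'"
  then have e: "length i = length i'" "mset (zip i j) = mset (zip i' j')"
    using orbit_of_iff[OF assms(2)] by auto
  have "(x, y) \<in> orbit_of i j \<longleftrightarrow> (x, y) \<in> orbit_of i' j'" for x y
    unfolding orbit_of_iff[OF assms(1)] orbit_of_iff[OF assms(2)] using e by simp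
  then show "orbit_of i j = orbit_of i' j'" by auto
qed (metis orbit_of_self)

lemma word_orbitsD:
  assumes "f \<in> word_orbits r" "(v, w) \<in> f"
  shows "v \<in> words r" "w \<in> words r" "f = orbit_of v w"
proof -
  obtain i j where ij: "i \<in> words r" "j \<in> words r" "f = orbit_of i j" using assms(1) by (auto simp: word_orbits_def)
  have l: "length i = length j" using ij by (simp add: words_def)
  obtain \<sigma> where \<sigma>: "\<sigma> permutes {..<length i}" "v = permute_list \<sigma> i" "w = permute_list \<sigma> j"
    using assms(2) ij(3) by (auto simp: orbit_of_def)
  have "\<sigma> permutes {..<length j}" using \<sigma>(1) l by simp
  then show vw: "v \<in> words r" "w \<in> words r" using \<sigma> ij by (auto simp: words_def)
  show "f = orbit_of v w"
    using orbit_of_eq_iff[of v w i j] assms(2) ij l vw by (simp add: words_def)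
qed

lemma word_orbitsI: "v \<in> words r \<Longrightarrow> w \<in> words r \<Longrightarrow> orbit_of v w \<in> word_orbits r"
  by (auto simp: word_orbits_def)

lemma finite_word_orbit: "f \<in> word_orbits r \<Longrightarrow> finite f"
proof -
  assume "f \<in> word_orbits r"
  then obtain i j where "f = orbit_of i j" by (auto simp: word_orbits_def)
  moreover have "orbit_of i j = (\<lambda>\<sigma>. (permute_list \<sigma> i, permute_list \<sigma> j)) ` {\<sigma>. \<sigma> permutes {..<length i}}"
    by (auto simp: orbit_of_def)
  ultimately show ?thesis by (simp add: finite_permutations)
qed

lemma finite_orbit_column: "f \<in> word_orbits r \<Longrightarrow> finite {v. (v, w) \<in> f}"
proof -
  assume "f \<in> word_orbits r"
  moreover have "{v. (v, w) \<in> f} \<subseteq> fst ` f" by force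
  ultimately show ?thesis using finite_word_orbit finite_surj by blast
qed

lemma orbit_append_eq:
  assumes l: "length i = length j" "length p = length q"
  shows "orbit_append (orbit_of i j) (orbit_of p q) = orbit_of (i @ p) (j @ q)"
proof -
  have eq: "orbit_of (i' @ p') (j' @ q') = orbit_of (i @ p) (j @ q)"
    if "(i', j') \<in> orbit_of i j" "(p', q') \<in> orbit_of p q" for i' j' p' q'
  proof -
    have "length i' = length i" "length j' = length i" "mset (zip i' j') = mset (zip i j)"
      "length p' = length p" "length q' = length p" "mset (zip p' q') = mset (zip p q)"
      using that orbit_of_iff[OF l(1)] orbit_of_iff[OF l(2)] by auto
    then show ?thesis
      using l by (subst orbit_of_eq_iff) (simp_all add: orbit_of_iff)
  qed
  show ?thesis
  proof (intro equalityI subsetI)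
    fix x assume "x \<in> orbit_append (orbit_of i j) (orbit_of p q)"
    then obtain a b where ab: "a \<in> orbit_of i j" "b \<in> orbit_of p q" "x \<in> orbit_of (fst a @ fst b) (snd a @ snd b)"
      unfolding orbit_append_def split_def by blast
    then show "x \<in> orbit_of (i @ p) (j @ q)" using eq[of "fst a" "snd a" "fst b" "snd b"] by simp
  next
    fix x assume "x \<in> orbit_of (i @ p) (j @ q)"
    then show "x \<in> orbit_append (orbit_of i j) (orbit_of p q)"
      unfolding orbit_append_def split_def
      using orbit_of_self[of i j] orbit_of_self[of p q]
      by (intro UN_I[of "(i, j)"] UN_I[of "(p, q)"]) simp_all
  qed
qed

lemma permute_list_words: "w \<in> words r \<Longrightarrow> \<sigma> permutes {..<r} \<Longrightarrow> permute_list \<sigma> w \<in> words r"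
  by (auto simp: words_def)

lemma orbit_of_permute:
  assumes "v \<in> words r" "w \<in> words r" "\<sigma> permutes {..<r}"
  shows "orbit_of (permute_list \<sigma> v) (permute_list \<sigma> w) = orbit_of v w"
  using assms by (subst orbit_of_eq_iff) (auto simp: words_def orbit_of_def)

text \<open>On the tensor power, \<xi>_f sends the basis vector of a word w to the sum of those of
  all v with (v, w) in f. So the entry at (v, w) is the coefficient of the one orbit through that
  pair.\<close>

definition orbit_matrix :: "(word_orbit \<Rightarrow> 'k) \<Rightarrow> nat list \<Rightarrow> nat list \<Rightarrow> 'k::field" where
  "orbit_matrix a v w = a (orbit_of v w)"

abbreviation permute_word :: "nat list \<Rightarrow> (nat \<Rightarrow> nat) \<Rightarrow> nat list" where
  "permute_word w \<sigma> \<equiv> permute_list \<sigma> w"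

lemma signed_words_schur:
  "signed_words (schur_algebra n) (words n) {..<n} permute_word (orbit_matrix :: _ \<Rightarrow> _ \<Rightarrow> _ \<Rightarrow> 'k::field)"
proof
  show "permute_list \<sigma> w \<in> words n" if "w \<in> words n" "\<sigma> permutes {..<n}" for w \<sigma>
    by (rule permute_list_words[OF that])
  show "permute_list \<tau> (permute_list \<sigma> w) = permute_list (\<sigma> \<circ> \<tau>) w"
    if "w \<in> words n" "\<sigma> permutes {..<n}" "\<tau> permutes {..<n}" for w \<sigma> \<tau>
    using permute_list_compose[of \<tau> w \<sigma>] that by (simp add: words_def)
  show "finite {v \<in> words n. (orbit_matrix a v w :: 'k) \<noteq> 0}" if "a \<in> schur_algebra n" "w \<in> words n" for a w
  proof (rule finite_subset)
    show "{v \<in> words n. (orbit_matrix a v w :: 'k) \<noteq> 0} \<subseteq> (\<Union>f\<in>{f. a f \<noteq> 0}. {v. (v, w) \<in> f})"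
      using orbit_of_self by (auto simp: orbit_matrix_def)
    show "finite (\<Union>f\<in>{f. a f \<noteq> 0}. {v. (v, w) \<in> f})"
      using that(1) finite_orbit_column[of _ n] by (auto simp: schur_algebra_def)
  qed
  show "(orbit_matrix a (permute_list \<sigma> v) (permute_list \<sigma> w) :: 'k) = orbit_matrix a v w"
    if "v \<in> words n" "w \<in> words n" "\<sigma> permutes {..<n}" for a v w \<sigma>
    using orbit_of_permute[OF that] by (simp add: orbit_matrix_def)
  show "\<exists>a\<in>schur_algebra n. \<exists>T. finite T \<and> T \<subseteq> words n \<and>
      (\<forall>w\<in>F. \<forall>v\<in>words n. (orbit_matrix a v w :: 'k) = (if v = w then 1 else 0)) \<and>
      (\<forall>w\<in>words n. \<forall>v\<in>words n. (orbit_matrix a v w :: 'k) \<noteq> 0 \<longrightarrow> v \<in> T)"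
    if F: "finite F" "F \<subseteq> words n" for F
  proof -
    \<comment> \<open>The local unit is the sum of the idempotents belonging to the pairs (i, i), i
      in \<open>F\<close>; its image is spanned by the rearrangements of these words.\<close>
    define D where "D = (\<lambda>i. orbit_of i i) ` F"
    define a :: "word_orbit \<Rightarrow> 'k" where "a f = (if f \<in> D then 1 else 0)" for f
    define T where "T = (\<Union>i\<in>F. (\<lambda>\<sigma>. permute_list \<sigma> i) ` {\<sigma>. \<sigma> permutes {..<n}})"
    have "{f. a f \<noteq> 0} = D" by (auto simp: a_def)
    moreover have "D \<subseteq> word_orbits n" using F(2) word_orbitsI by (auto simp: D_def)
    ultimately have a: "a \<in> schur_algebra n" using F(1) by (simp add: schur_algebra_def D_def)
    have T: "finite T" "T \<subseteq> words n"
      using F permute_list_words by (auto simp: T_def finite_permutations)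
    have mem: "v = w \<and> v \<in> T" if vD: "orbit_of v w \<in> D" for v w
    proof -
      obtain i where i: "i \<in> F" "orbit_of v w = orbit_of i i" using vD by (auto simp: D_def)
      then have "(v, w) \<in> orbit_of i i" using orbit_of_self by metis
      then show ?thesis using i(1) F(2) by (auto simp: orbit_of_def T_def words_def)
    qed
    have "orbit_of w w \<in> D" if "w \<in> F" for w using that by (simp add: D_def)
    then have "orbit_matrix a v w = (if v = w then 1 else 0)" if "w \<in> F" "v \<in> words n" for v w
      using mem[of v w] that F(2) by (auto simp: orbit_matrix_def a_def)
    moreover have "v \<in> T" if "w \<in> words n" "v \<in> words n" "orbit_matrix a v w \<noteq> 0" for v w
      using mem[of v w] that by (auto simp: orbit_matrix_def a_def split: if_splits)
    ultimately show ?thesis using a T by (intro bexI[of _ a] exI[of _ T]) auto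
  qed
qed auto

section \<open>Quotients of tensor powers\<close>

definition fsupp :: "('x \<Rightarrow> 'k::field) \<Rightarrow> bool" where
  "fsupp v \<longleftrightarrow> finite {x. v x \<noteq> 0}"

lemma linear_extension_eq:
  assumes "finite S" "{x. v x \<noteq> 0} \<subseteq> S"
  shows "linear_extension F v = (\<Sum>x\<in>S. fscale (v x) (F x))"
  unfolding linear_extension_def using assms by (intro sum.mono_neutral_left) auto

lemma supp_unit_fun: "{x. (unit_fun b x :: 'k::field) \<noteq> 0} = {b}"
  by (auto simp: unit_fun_def)

lemma linear_extension_unit: "linear_extension F (unit_fun b :: _ \<Rightarrow> 'k::field) = F b"
  by (subst linear_extension_eq[of "{b}"]) (auto simp: supp_unit_fun, simp add: unit_fun_def)

lemma linear_extension_add: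
  assumes "fsupp u" "fsupp v"
  shows "linear_extension F (u + v) = linear_extension F u + linear_extension F v"
proof -
  let ?S = "{x. u x \<noteq> 0} \<union> {x. v x \<noteq> 0}"
  have f: "finite ?S" using assms by (simp add: fsupp_def)
  show ?thesis
    by (subst (1 2 3) linear_extension_eq[OF f])
      (auto simp: sum.distrib[symmetric] fun_space.scale_left_distrib)
qed

lemma linear_extension_scale:
  assumes "fsupp u"
  shows "linear_extension F (fscale c u) = fscale c (linear_extension F u)"
proof -
  have f: "finite {x. u x \<noteq> 0}" using assms by (simp add: fsupp_def)
  show ?thesis
    by (subst (1 2) linear_extension_eq[OF f]) (auto simp: fscale_def fun_space.scale_sum_right sum_fun_apply sum_distrib_left mult.assoc)
qed

lemma linear_extension_sum:
  assumes "\<And>i. i \<in> I \<Longrightarrow> fsupp (g i)"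
  shows "linear_extension F (\<Sum>i\<in>I. g i) = (\<Sum>i\<in>I. linear_extension F (g i))"
proof (cases "finite I")
  case True
  let ?S = "\<Union>i\<in>I. {x. g i x \<noteq> 0}"
  have f: "finite ?S" using True assms by (auto simp: fsupp_def)
  have s: "{x. (\<Sum>i\<in>I. g i) x \<noteq> 0} \<subseteq> ?S"
    by (auto simp: sum_fun_apply intro: sum.neutral)
  have "linear_extension F (g i) = (\<Sum>x\<in>?S. fscale (g i x) (F x))" if "i \<in> I" for i
    using that by (intro linear_extension_eq[OF f]) auto
  then have "(\<Sum>i\<in>I. linear_extension F (g i)) = (\<Sum>i\<in>I. \<Sum>x\<in>?S. fscale (g i x) (F x))" by simp
  also have "\<dots> = (\<Sum>x\<in>?S. \<Sum>i\<in>I. fscale (g i x) (F x))" by (rule sum.swap)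
  also have "\<dots> = linear_extension F (\<Sum>i\<in>I. g i)"
    by (simp add: linear_extension_eq[OF f s] sum_fun_apply fun_space.scale_sum_left)
  finally show ?thesis by simp
qed (simp add: linear_extension_def)

text \<open>\<open>Q\<close> is the quotient map from the tensor power, given by the images of the words.\<close>

definition represents :: "nat \<Rightarrow> ('k::field, 'x) based_module \<Rightarrow> (nat list \<Rightarrow> ('x \<Rightarrow> 'k)) \<Rightarrow> bool" where
  "represents r B Q \<longleftrightarrow>
     (\<forall>w\<in>words r. fsupp (Q w) \<and> {x. Q w x \<noteq> 0} \<subseteq> basis B) \<and>
     (\<forall>b\<in>basis B. \<exists>w\<in>words r. Q w = unit_fun b) \<and>
     (\<forall>t. \<forall>f\<in>word_orbits t. \<forall>w\<in>words r. linear_extension (basis_act B f) (Q w) = (\<Sum>v | (v, w) \<in> f. Q v))"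

lemma representsD:
  assumes "represents r B Q"
  shows "w \<in> words r \<Longrightarrow> fsupp (Q w)" "w \<in> words r \<Longrightarrow> Q w x \<noteq> 0 \<Longrightarrow> x \<in> basis B"
    "b \<in> basis B \<Longrightarrow> \<exists>w\<in>words r. Q w = unit_fun b"
    "f \<in> word_orbits t \<Longrightarrow> w \<in> words r \<Longrightarrow> linear_extension (basis_act B f) (Q w) = (\<Sum>v | (v, w) \<in> f. Q v)"
  using assms unfolding represents_def by blast+

text \<open>An orbit with a pair ending in w has the degree of w. Thus orbits of other degrees have
  an empty column and act as zero, as the sum over all g and h in the tensor product
  requires.\<close>

lemma word_orbits_column:
  assumes "f \<in> word_orbits t" "w \<in> words r" "(v, w) \<in> f"
  shows "v \<in> words r" "f = orbit_of v w" "t = r"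
  using word_orbitsD[OF assms(1,3)] assms(2) by (auto simp: words_def)

lemma represents_cong:
  assumes B: "represents r B Q" and eq: "\<And>w. w \<in> words r \<Longrightarrow> Q w = Q' w"
  shows "represents r B Q'"
  unfolding represents_def
proof (intro conjI allI ballI)
  fix t f w assume f: "f \<in> word_orbits t" and w: "w \<in> words r"
  have "(\<Sum>v | (v, w) \<in> f. Q v) = (\<Sum>v | (v, w) \<in> f. Q' v)"
    using word_orbits_column[OF f w] eq by (intro sum.cong) auto
  then show "linear_extension (basis_act B f) (Q' w) = (\<Sum>v | (v, w) \<in> f. Q' v)"
    using representsD(4)[OF B f w] eq[OF w] by simp
next
  fix w assume w: "w \<in> words r"
  show "fsupp (Q' w)" using representsD(1)[OF B w] eq[OF w] by simp
  show "{x. Q' w x \<noteq> 0} \<subseteq> basis B" using representsD(2)[OF B w] eq[OF w] by auto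
next
  fix b assume "b \<in> basis B"
  then show "\<exists>w\<in>words r. Q' w = unit_fun b" using representsD(3)[OF B] eq by metis
qed

section \<open>The natural module and tensor products\<close>

lemma represents_natural: "represents 1 (natural_module :: ('k::field, nat) based_module) (\<lambda>w. unit_fun (hd w))"
  unfolding represents_def
proof (intro conjI allI ballI)
  fix w assume "w \<in> words 1"
  then obtain j where j: "w = [j]" "1 \<le> j" by (auto simp: words_def length_Suc_conv)
  show "fsupp (unit_fun (hd w) :: _ \<Rightarrow> 'k)" by (simp add: fsupp_def supp_unit_fun)
  show "{x. (unit_fun (hd w) x :: 'k) \<noteq> 0} \<subseteq> basis natural_module"
    using j by (simp add: supp_unit_fun natural_module_def)
  fix t and f assume f: "f \<in> word_orbits t"
  have o: "orbit_of [i] [j] = {([i], [j])}" for i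
    using orbit_of_iff[of "[i]" "[j]"] by (auto simp: length_Suc_conv)
  have col: "{v. (v, w) \<in> f} = {v. \<exists>i. v = [i] \<and> f = {([i], [j])}}"
  proof (intro Set.set_eqI iffI)
    fix v assume "v \<in> {v. (v, w) \<in> f}"
    then have v: "v \<in> words 1" "f = orbit_of v w" using word_orbits_column[OF f \<open>w \<in> words 1\<close>] by auto
    then obtain i where "v = [i]" by (auto simp: words_def length_Suc_conv)
    then show "v \<in> {v. \<exists>i. v = [i] \<and> f = {([i], [j])}}" using v o j by simp
  qed (use j in auto)
  have "linear_extension (basis_act natural_module f) (unit_fun (hd w) :: _ \<Rightarrow> 'k) = basis_act natural_module f j"
    using j by (simp add: linear_extension_unit)
  also have "\<dots> = (\<Sum>v | (v, w) \<in> f. unit_fun (hd v))"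
  proof (cases "\<exists>i. f = {([i], [j])}")
    case True
    then obtain i where i: "f = {([i], [j])}" by blast
    then have "{v. (v, w) \<in> f} = {[i]}" using j by auto
    then show ?thesis using i by (auto simp: natural_module_def unit_fun_def fun_eq_iff)
  next
    case False
    then have "{v. (v, w) \<in> f} = {}" unfolding col by blast
    then show ?thesis using False by (auto simp: natural_module_def fun_eq_iff)
  qed
  finally show "linear_extension (basis_act natural_module f) (unit_fun (hd w) :: _ \<Rightarrow> 'k) = (\<Sum>v | (v, w) \<in> f. unit_fun (hd v))" .
next
  fix b assume "b \<in> basis (natural_module :: ('k, nat) based_module)"
  then show "\<exists>w\<in>words 1. unit_fun (hd w) = (unit_fun b :: _ \<Rightarrow> 'k)"
    by (intro bexI[of _ "[b]"]) (auto simp: words_def natural_module_def)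
qed

lemma represents_unit: "represents 0 (unit_module :: ('k::field, 'x list) based_module) (\<lambda>w. unit_fun [])"
  unfolding represents_def
proof (intro conjI allI ballI)
  fix w assume "w \<in> words 0"
  then have w: "w = []" by (auto simp: words_def)
  show "fsupp (unit_fun ([] :: 'x list) :: _ \<Rightarrow> 'k)" by (simp add: fsupp_def supp_unit_fun)
  show "{x. (unit_fun ([] :: 'x list) x :: 'k) \<noteq> 0} \<subseteq> basis unit_module"
    by (simp add: supp_unit_fun unit_module_def)
  fix t and f assume f: "f \<in> word_orbits t"
  have o: "orbit_of [] [] = {([], [])}" using orbit_of_iff[of "[]" "[]"] by auto
  have "{v. (v, w) \<in> f} = (if f = {([], [])} then {[]} else {})"
  proof (cases "f = {([], [])}")
    case False
    have "(v, w) \<notin> f" for v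
      using word_orbits_column[OF f \<open>w \<in> words 0\<close>, of v] False o w by (auto simp: words_def)
    then show ?thesis using False by simp
  qed (use w in auto)
  then show "linear_extension (basis_act unit_module f) (unit_fun ([] :: 'x list) :: _ \<Rightarrow> 'k) = (\<Sum>v | (v, w) \<in> f. unit_fun [])"
    by (simp add: linear_extension_unit unit_module_def)
next
  fix b assume "b \<in> basis (unit_module :: ('k, 'x list) based_module)"
  then show "\<exists>w\<in>words 0. unit_fun [] = (unit_fun b :: _ \<Rightarrow> 'k)"
    by (intro bexI[of _ "[]"]) (auto simp: words_def unit_module_def)
qed

lemma pure_tensor_unit: "pure_tensor (unit_fun x) (unit_fun xs :: _ \<Rightarrow> 'k::field) = unit_fun (x # xs)"
  by (auto simp: pure_tensor_def unit_fun_def fun_eq_iff split: list.splits)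

lemma supp_pure_tensor: "{z. pure_tensor a b z \<noteq> 0} = (\<lambda>(x, xs). x # xs) ` ({x. a x \<noteq> 0} \<times> {xs. b xs \<noteq> 0})"
proof (rule Set.set_eqI)
  fix z show "z \<in> {z. pure_tensor a b z \<noteq> 0} \<longleftrightarrow> z \<in> (\<lambda>(x, xs). x # xs) ` ({x. a x \<noteq> 0} \<times> {xs. b xs \<noteq> 0})"
    by (cases z) (auto simp: pure_tensor_def)
qed

lemma pure_tensor_scale: "pure_tensor (fscale s a) (fscale t b) = fscale (s * t) (pure_tensor a b)"
  by (auto simp: pure_tensor_def fscale_def fun_eq_iff split: list.splits)

lemma fsupp_pure_tensor: "fsupp a \<Longrightarrow> fsupp b \<Longrightarrow> fsupp (pure_tensor a b)"
  unfolding fsupp_def supp_pure_tensor by simp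

lemma pure_tensor_sum: "pure_tensor (\<Sum>i\<in>I. a i) (\<Sum>j\<in>J. b j) = (\<Sum>(i, j)\<in>I \<times> J. pure_tensor (a i) (b j))"
proof
  fix z show "pure_tensor (\<Sum>i\<in>I. a i) (\<Sum>j\<in>J. b j) z = (\<Sum>(i, j)\<in>I \<times> J. pure_tensor (a i) (b j)) z"
    by (cases z) (auto simp: pure_tensor_def sum_fun_apply sum_product sum.cartesian_product split_def)
qed

lemma words_append_iff: "w \<in> words (r + s) \<longleftrightarrow> take r w \<in> words r \<and> drop r w \<in> words s \<and> length w = r + s"
proof
  assume "w \<in> words (r + s)"
  then show "take r w \<in> words r \<and> drop r w \<in> words s \<and> length w = r + s"
    by (auto simp: words_def dest: in_set_takeD in_set_dropD)
next
  assume a: "take r w \<in> words r \<and> drop r w \<in> words s \<and> length w = r + s"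
  have "set w = set (take r w) \<union> set (drop r w)" by (metis append_take_drop_id set_append)
  then show "w \<in> words (r + s)" using a by (auto simp: words_def)
qed

text \<open>A decomposition of f is obtained by cutting some member of f at some place, and f has
  finitely many members.\<close>

lemma finite_orbit_decompositions:
  assumes f: "f \<in> word_orbits t"
  shows "finite {(g, h). g \<in> (\<Union>r. word_orbits r) \<and> h \<in> (\<Union>r. word_orbits r) \<and> orbit_append g h = f}"
proof (rule finite_subset)
  let ?F = "\<lambda>((x, y), k). (orbit_of (take k x) (take k y), orbit_of (drop k x) (drop k y))"
  show "finite (?F ` (f \<times> {..t}))" using finite_word_orbit[OF f] by simp
  show "{(g, h). g \<in> (\<Union>r. word_orbits r) \<and> h \<in> (\<Union>r. word_orbits r) \<and> orbit_append g h = f} \<subseteq> ?F ` (f \<times> {..t})"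
  proof
    fix gh assume "gh \<in> {(g, h). g \<in> (\<Union>r. word_orbits r) \<and> h \<in> (\<Union>r. word_orbits r) \<and> orbit_append g h = f}"
    then obtain g h r s where gh: "gh = (g, h)" "g \<in> word_orbits r" "h \<in> word_orbits s" "orbit_append g h = f" by auto
    obtain i j where ij: "i \<in> words r" "j \<in> words r" "g = orbit_of i j" using gh(2) by (auto simp: word_orbits_def)
    obtain p q where pq: "p \<in> words s" "q \<in> words s" "h = orbit_of p q" using gh(3) by (auto simp: word_orbits_def)
    have l: "length i = r" "length j = r" "length p = s" "length q = s" using ij pq by (auto simp: words_def)
    have "f = orbit_of (i @ p) (j @ q)" using gh(4) orbit_append_eq[of i j p q] ij pq l by simp
    then have in_f: "(i @ p, j @ q) \<in> f" using orbit_of_self by simp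
    have "r \<le> t" using word_orbitsD(1)[OF f in_f] l by (simp add: words_def)
    moreover have "gh = ?F ((i @ p, j @ q), r)" using gh(1) ij pq l by simp
    ultimately show "gh \<in> ?F ` (f \<times> {..t})" using in_f by (intro image_eqI[of _ _ "((i @ p, j @ q), r)"]) auto
  qed
qed

text \<open>Expanding bilinearly, the comultiplication gives a sum over decompositions of f and over
  columns of both factors, which is reindexed by the column of f.\<close>

lemma represents_tensor:
  fixes V :: "('k::field, 'x) based_module"
  assumes V: "represents r V Q" and T: "represents s T Q'"
  shows "represents (r + s) (tensor_module V T) (\<lambda>w. pure_tensor (Q (take r w)) (Q' (drop r w)))"
  unfolding represents_def
proof (intro conjI allI ballI)
  fix w assume w: "w \<in> words (r + s)"
  let ?w1 = "take r w" and ?w2 = "drop r w"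
  have w12: "?w1 \<in> words r" "?w2 \<in> words s" "length w = r + s" using w words_append_iff by blast+
  let ?a = "Q ?w1" and ?b = "Q' ?w2"
  have fin: "fsupp ?a" "fsupp ?b" using representsD(1)[OF V w12(1)] representsD(1)[OF T w12(2)] .
  show "fsupp (pure_tensor ?a ?b)" by (rule fsupp_pure_tensor[OF fin])
  show "{x. pure_tensor ?a ?b x \<noteq> 0} \<subseteq> basis (tensor_module V T)"
    unfolding supp_pure_tensor using representsD(2)[OF V w12(1)] representsD(2)[OF T w12(2)]
    by (auto simp: tensor_module_def)
  fix t f assume f: "f \<in> word_orbits t"
  let ?D = "{(g, h). g \<in> (\<Union>r. word_orbits r) \<and> h \<in> (\<Union>r. word_orbits r) \<and> orbit_append g h = f}"
  let ?A = "{x. ?a x \<noteq> 0}" and ?B = "{x. ?b x \<noteq> 0}"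
  have fA: "finite ?A" "finite ?B" using fin by (simp_all add: fsupp_def)
  have inj: "inj_on (\<lambda>(x, xs). x # xs) (?A \<times> ?B)" by (auto simp: inj_on_def)
  have act: "basis_act (tensor_module V T) f (x # xs) = (\<Sum>(g, h)\<in>?D. pure_tensor (basis_act V g x) (basis_act T h xs))" for x xs
    by (simp add: tensor_module_def)
  have "linear_extension (basis_act (tensor_module V T) f) (pure_tensor ?a ?b) =
      (\<Sum>z\<in>(\<lambda>(x, xs). x # xs) ` (?A \<times> ?B). fscale (pure_tensor ?a ?b z) (basis_act (tensor_module V T) f z))"
    using fA by (intro linear_extension_eq) (auto simp: supp_pure_tensor)
  also have "\<dots> = (\<Sum>(x, xs)\<in>?A \<times> ?B. \<Sum>(g, h)\<in>?D. fscale (?a x * ?b xs) (pure_tensor (basis_act V g x) (basis_act T h xs)))"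
    unfolding sum.reindex[OF inj] by (intro sum.cong) (auto simp: act fun_space.scale_sum_right pure_tensor_def[of ?a] split_def)
  also have "\<dots> = (\<Sum>(x, xs)\<in>?A \<times> ?B. \<Sum>(g, h)\<in>?D. pure_tensor (fscale (?a x) (basis_act V g x)) (fscale (?b xs) (basis_act T h xs)))"
    by (simp add: pure_tensor_scale)
  also have "\<dots> = (\<Sum>(g, h)\<in>?D. \<Sum>(x, xs)\<in>?A \<times> ?B. pure_tensor (fscale (?a x) (basis_act V g x)) (fscale (?b xs) (basis_act T h xs)))"
    unfolding split_def by (rule sum.swap)
  also have "\<dots> = (\<Sum>(g, h)\<in>?D. pure_tensor (linear_extension (basis_act V g) ?a) (linear_extension (basis_act T h) ?b))"
    unfolding linear_extension_def by (simp add: pure_tensor_sum)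
  also have "\<dots> = (\<Sum>(g, h)\<in>?D. \<Sum>(v1, v2)\<in>{v. (v, ?w1) \<in> g} \<times> {v. (v, ?w2) \<in> h}. pure_tensor (Q v1) (Q' v2))"
  proof (rule sum.cong)
    fix gh assume "gh \<in> ?D"
    then obtain g h r' s' where gh: "gh = (g, h)" "g \<in> word_orbits r'" "h \<in> word_orbits s'" by auto
    show "(case gh of (g, h) \<Rightarrow> pure_tensor (linear_extension (basis_act V g) ?a) (linear_extension (basis_act T h) ?b)) =
      (case gh of (g, h) \<Rightarrow> \<Sum>(v1, v2)\<in>{v. (v, ?w1) \<in> g} \<times> {v. (v, ?w2) \<in> h}. pure_tensor (Q v1) (Q' v2))"
      unfolding gh(1) prod.case representsD(4)[OF V gh(2) w12(1)] representsD(4)[OF T gh(3) w12(2)]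
      by (rule pure_tensor_sum)
  qed simp
  also have "\<dots> = (\<Sum>(gh, v)\<in>Sigma ?D (\<lambda>(g, h). {v. (v, ?w1) \<in> g} \<times> {v. (v, ?w2) \<in> h}). pure_tensor (Q (fst v)) (Q' (snd v)))"
  proof -
    have "finite {v. (v, x) \<in> g}" if "g \<in> (\<Union>r. word_orbits r)" for g x using that finite_orbit_column by auto
    then show ?thesis
      using finite_orbit_decompositions[OF f] by (subst sum.Sigma[symmetric]) (auto simp: split_def)
  qed
  \<comment> \<open>Cutting v and w after r letters gives two pairs, and g and h are their orbits.
    So each v belongs to exactly one decomposition of f.\<close>
  also have "\<dots> = (\<Sum>v | (v, w) \<in> f. pure_tensor (Q (take r v)) (Q' (drop r v)))"
  proof (rule sum.reindex_bij_witness[of _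
        "\<lambda>v. ((orbit_of (take r v) ?w1, orbit_of (drop r v) ?w2), (take r v, drop r v))" "\<lambda>(gh, (v1, v2)). v1 @ v2"])
    fix x assume "x \<in> Sigma ?D (\<lambda>(g, h). {v. (v, ?w1) \<in> g} \<times> {v. (v, ?w2) \<in> h})"
    then obtain g h v1 v2 r' s' where x: "x = ((g, h), (v1, v2))" and gh: "g \<in> word_orbits r'" "h \<in> word_orbits s'" "orbit_append g h = f"
      and v: "(v1, ?w1) \<in> g" "(v2, ?w2) \<in> h" by auto
    note c1 = word_orbits_column[OF gh(1) w12(1) v(1)] and c2 = word_orbits_column[OF gh(2) w12(2) v(2)]
    have l: "length v1 = r" "length v2 = s" "length ?w1 = r" "length ?w2 = s" using c1(1) c2(1) w12 by (auto simp: words_def)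
    show "(case (case x of (gh, (v1, v2)) \<Rightarrow> v1 @ v2) of v \<Rightarrow> ((orbit_of (take r v) ?w1, orbit_of (drop r v) ?w2), (take r v, drop r v))) = x"
      using l c1(2) c2(2) by (simp add: x)
    have "f = orbit_of (v1 @ v2) (?w1 @ ?w2)"
      using gh(3) orbit_append_eq[of v1 ?w1 v2 ?w2] c1(2) c2(2) l by simp
    then show "(case x of (gh, (v1, v2)) \<Rightarrow> v1 @ v2) \<in> {v. (v, w) \<in> f}" using orbit_of_self by (simp add: x)
    show "pure_tensor (Q (take r (case x of (gh, (v1, v2)) \<Rightarrow> v1 @ v2))) (Q' (drop r (case x of (gh, (v1, v2)) \<Rightarrow> v1 @ v2))) =
       (case x of (gh, v) \<Rightarrow> pure_tensor (Q (fst v)) (Q' (snd v)))"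
      using l by (simp add: x)
  next
    fix v assume "v \<in> {v. (v, w) \<in> f}"
    then have c: "v \<in> words (r + s)" "f = orbit_of v w" using word_orbits_column[OF f w] by auto
    have v12: "take r v \<in> words r" "drop r v \<in> words s" "length v = r + s" using c(1) words_append_iff by blast+
    have "orbit_append (orbit_of (take r v) ?w1) (orbit_of (drop r v) ?w2) = f"
      using orbit_append_eq[of "take r v" ?w1 "drop r v" ?w2] v12 w12 c(2) by simp
    then show "((orbit_of (take r v) ?w1, orbit_of (drop r v) ?w2), (take r v, drop r v)) \<in>
        Sigma ?D (\<lambda>(g, h). {v. (v, ?w1) \<in> g} \<times> {v. (v, ?w2) \<in> h})"
      using word_orbitsI[OF v12(1) w12(1)] word_orbitsI[OF v12(2) w12(2)] orbit_of_self by auto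
  qed simp
  finally show "linear_extension (basis_act (tensor_module V T) f) (pure_tensor ?a ?b) =
      (\<Sum>v | (v, w) \<in> f. pure_tensor (Q (take r v)) (Q' (drop r v)))" .
next
  fix b assume "b \<in> basis (tensor_module V T)"
  then obtain x xs where b: "b = x # xs" "x \<in> basis V" "xs \<in> basis T" by (auto simp: tensor_module_def)
  obtain w1 w2 where w: "w1 \<in> words r" "Q w1 = unit_fun x" "w2 \<in> words s" "Q' w2 = unit_fun xs"
    using representsD(3)[OF V b(2)] representsD(3)[OF T b(3)] by blast
  have "w1 @ w2 \<in> words (r + s)" "take r (w1 @ w2) = w1" "drop r (w1 @ w2) = w2" using w by (auto simp: words_def)
  then show "\<exists>w\<in>words (r + s). pure_tensor (Q (take r w)) (Q' (drop r w)) = unit_fun b"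
    using w b(1) by (intro bexI[of _ "w1 @ w2"]) (simp_all add: pure_tensor_unit)
qed

lemma represents_tensor_power: "represents r (tensor_power r :: ('k::field, nat list) based_module) unit_fun"
proof (induction r)
  case 0
  show ?case
    unfolding tensor_power_def tensor_list_def
    using represents_cong[OF represents_unit, of "unit_fun :: _ \<Rightarrow> _ \<Rightarrow> 'k"] by (simp add: words_def)
next
  case (Suc r)
  have e: "tensor_power (Suc r) = tensor_module natural_module (tensor_power r :: ('k, nat list) based_module)"
    by (simp add: tensor_power_def tensor_list_def)
  have "represents (1 + r) (tensor_power (Suc r) :: ('k, nat list) based_module) unit_fun"
    unfolding e
  proof (rule represents_cong[OF represents_tensor[OF represents_natural Suc]])
    fix w assume "w \<in> words (1 + r)"
    then obtain x xs where "w = x # xs" by (auto simp: words_def length_Suc_conv)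
    then show "pure_tensor (unit_fun (hd (take 1 w))) (unit_fun (drop 1 w) :: _ \<Rightarrow> 'k) = unit_fun w"
      by (simp add: pure_tensor_unit)
  qed
  then show ?case by simp
qed

section \<open>Symmetric and exterior powers\<close>

text \<open>The flag \<open>True\<close> stands for symmetric and \<open>False\<close> for exterior
  powers, so that both are treated by one argument.\<close>

definition block_sign :: "bool \<Rightarrow> 'k::field" where
  "block_sign e = (if e then 1 else - 1)"

definition monomial :: "bool \<Rightarrow> nat list \<Rightarrow> (nat list \<Rightarrow> 'k::field)" where
  "monomial e = (if e then sym_monomial else wedge_monomial)"

definition power_module :: "bool \<Rightarrow> nat \<Rightarrow> ('k::field, nat list) based_module" where
  "power_module e r = (if e then sym_power r else ext_power r)"

definition alternates :: "nat \<Rightarrow> bool \<Rightarrow> (nat list \<Rightarrow> 'k::field) \<Rightarrow> bool" where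
  "alternates r e G \<longleftrightarrow> (\<forall>w\<in>words r. \<forall>i<r. \<forall>j<r. i \<noteq> j \<longrightarrow> G (permute_list (swap i j) w) = block_sign e * G w)"

lemma swap_permutes: "i < r \<Longrightarrow> j < r \<Longrightarrow> swap i j permutes {..<r}"
  by (rule permutes_swap_id) auto

lemma alternates_permute:
  assumes G: "alternates r e G" and \<sigma>: "\<sigma> permutes {..<r}" and w: "w \<in> words r"
  shows "G (permute_list \<sigma> w) = (if e then 1 else of_int (sign \<sigma>)) * G w"
  using finite_lessThan \<sigma>
proof (induction rule: permutes_rev_induct)
  case id
  have "G (permute_list id w) = (if e then 1 else of_int (sign (id :: nat \<Rightarrow> nat))) * G w"
    by (simp only: permute_list_id sign_id) simp
  then show ?case .
next
  case (swap a b p)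
  have ab: "a < r" "b < r" "a \<noteq> b" using swap by auto
  have t: "swap a b permutes {..<length w}" using swap_permutes[OF ab(1,2)] w by (simp add: words_def)
  have "permutation p" using swap(4) permutation_permutes by blast
  then have s: "sign (p \<circ> swap a b) = - sign p"
    using sign_compose[of p "swap a b"] permutation_swap_id[of a b] ab(3) by (simp add: sign_swap_id)
  have "G (permute_list (p \<circ> swap a b) w) = block_sign e * G (permute_list p w)"
    unfolding permute_list_compose[OF t]
    using G permute_list_words[OF w swap(4)] ab unfolding alternates_def by blast
  then have "G (permute_list (p \<circ> swap a b) w) = (if e then 1 else of_int (sign (p \<circ> swap a b))) * G w"
    unfolding s swap(5) by (simp add: block_sign_def)
  then show ?case .
qed

text \<open>Exchanging k and k + 1 matches the inversions of both words, except for the pair (k, k +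
  1), which is an inversion of exactly one of them because the letters differ.\<close>

lemma inversions_adjacent:
  assumes d: "distinct w" and k: "Suc k < length w"
  shows "(- 1) ^ inversions (permute_list (swap k (Suc k)) w) = - ((- 1) ^ inversions w :: 'k::comm_ring_1)"
proof -
  let ?t = "swap k (Suc k)" and ?n = "length w"
  let ?w = "permute_list ?t w"
  have t: "?t permutes {..<?n}" using k by (intro swap_permutes) auto
  have nth: "?w ! a = w ! (?t a)" if "a < ?n" for a using permute_list_nth[OF t that] .
  define D where "D u = {(a, b). a < b \<and> b < length u \<and> u ! a > u ! b}" for u :: "nat list"
  let ?x = "(k, Suc k)"
  have fin: "finite (D u)" for u
    by (rule finite_subset[of _ "{..<length u} \<times> {..<length u}"]) (auto simp: D_def)
  have step: "(?t a, ?t b) \<in> D u' - {?x}"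
    if ab: "(a, b) \<in> D u - {?x}" and l: "length u = ?n" "length u' = ?n" and n: "\<And>a. a < ?n \<Longrightarrow> u' ! (?t a) = u ! a"
    for a b u u'
  proof -
    have 1: "a < b" "b < ?n" "u ! a > u ! b" "(a, b) \<noteq> ?x" using ab l by (auto simp: D_def)
    then have "?t a < ?t b" using k by (auto simp: Transposition.transpose_def)
    moreover have "?t b < ?n" using permutes_in_image[OF t, of b] 1 by simp
    moreover have "(?t a, ?t b) \<noteq> ?x" using 1 by (auto simp: Transposition.transpose_def split: if_splits)
    ultimately show ?thesis using 1 n[of a] n[of b] l by (auto simp: D_def)
  qed
  have "bij_betw (\<lambda>(a, b). (?t a, ?t b)) (D w - {?x}) (D ?w - {?x})"
  proof (rule bij_betw_byWitness[where f' = "\<lambda>(a, b). (?t a, ?t b)"])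
    have n1: "?w ! (?t a) = w ! a" if "a < ?n" for a
      using nth[of "?t a"] permutes_in_image[OF t, of a] that by simp
    show "(\<lambda>(a, b). (?t a, ?t b)) ` (D w - {?x}) \<subseteq> D ?w - {?x}"
      using step[of _ _ w ?w, OF _ refl length_permute_list n1] by fast
    have n2: "w ! (?t a) = ?w ! a" if "a < ?n" for a using nth[OF that] by simp
    show "(\<lambda>(a, b). (?t a, ?t b)) ` (D ?w - {?x}) \<subseteq> D w - {?x}"
      using step[of _ _ ?w w, OF _ length_permute_list refl n2] by fast
  qed auto
  then have c: "card (D w - {?x}) = card (D ?w - {?x})" by (rule bij_betw_same_card)
  have m: "?x \<in> D ?w \<longleftrightarrow> ?x \<notin> D w"
  proof -
    have "w ! k \<noteq> w ! Suc k" using d k by (simp add: nth_eq_iff_index_eq)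
    then show ?thesis using nth[of k] nth[of "Suc k"] k by (auto simp: D_def)
  qed
  have inv: "inversions u = card (D u)" for u by (simp add: inversions_def D_def)
  show ?thesis
  proof (cases "?x \<in> D w")
    case True
    then have "card (D w) = Suc (card (D ?w))" using card.remove[OF fin True] c m by simp
    then show ?thesis by (simp add: inv)
  next
    case False
    then have "card (D ?w) = Suc (card (D w))" using card.remove[OF fin, of ?x ?w] c m by simp
    then show ?thesis by (simp add: inv)
  qed
qed

text \<open>By (i m+1) = (m m+1)(i m)(m m+1) the sign changes three times.\<close>

lemma inversions_swap:
  assumes "distinct w" "i < j" "j < length w"
  shows "(- 1) ^ inversions (permute_list (swap i j) w) = - ((- 1) ^ inversions w :: 'k::comm_ring_1)"
  using assms
proof (induction j arbitrary: w)
  case (Suc m)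
  show ?case
  proof (cases "i = m")
    case True
    then show ?thesis using inversions_adjacent Suc by blast
  next
    case False
    let ?s = "swap m (Suc m)" and ?t = "swap i m"
    have p: "?s permutes {..<length w}" "?t permutes {..<length w}" using Suc by (auto intro!: swap_permutes)
    have "swap i (Suc m) = ?s \<circ> ?t \<circ> ?s" using False Suc(3) by (auto simp: fun_eq_iff Transposition.transpose_def)
    then have e: "permute_list (swap i (Suc m)) w = permute_list ?s (permute_list ?t (permute_list ?s w))"
      using permute_list_compose[OF p(1), of "?s \<circ> ?t"] permute_list_compose[OF p(2), of ?s] by simp
    have d: "distinct (permute_list ?s w)" "distinct (permute_list ?t (permute_list ?s w))"
      using Suc(2) p by simp_all
    have "(- 1) ^ inversions (permute_list (swap i (Suc m)) w) = - ((- 1) ^ inversions (permute_list ?t (permute_list ?s w)) :: 'k)"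
      unfolding e using inversions_adjacent[OF d(2), of m] Suc(4) by simp
    also have "(- 1) ^ inversions (permute_list ?t (permute_list ?s w)) = - ((- 1) ^ inversions (permute_list ?s w) :: 'k)"
      using Suc(1)[OF d(1)] Suc(3,4) False by simp
    also have "(- 1) ^ inversions (permute_list ?s w) = - ((- 1) ^ inversions w :: 'k)"
      using inversions_adjacent[OF Suc(2), of m] Suc(4) by simp
    finally show ?thesis by simp
  qed
qed simp

lemma monomial_alternates: "alternates r e (\<lambda>w. monomial e w x)"
  unfolding alternates_def
proof (intro ballI allI impI)
  fix w i j assume w: "w \<in> words r" and ij: "i < r" "j < r" "i \<noteq> j"
  let ?w = "permute_list (swap i j) w"
  have l: "length w = r" using w by (simp add: words_def)
  have p: "swap i j permutes {..<length w}" using swap_permutes[OF ij(1,2)] l by simp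
  have s: "sort ?w = sort w" using p by (intro properties_for_sort) auto
  show "monomial e ?w x = block_sign e * monomial e w x"
  proof (cases e)
    case True
    then show ?thesis by (simp add: monomial_def sym_monomial_def s block_sign_def)
  next
    case False
    have sg: "(- 1) ^ inversions ?w = - ((- 1) ^ inversions w :: 'b)" if "distinct w"
    proof (cases "i < j")
      case True
      then show ?thesis using inversions_swap[OF that True] ij l by simp
    next
      case False
      then have "j < i" using ij by simp
      then show ?thesis using inversions_swap[OF that \<open>j < i\<close>] ij l by (simp add: transpose_commute)
    qed
    show ?thesis
      using False sg p by (auto simp: monomial_def wedge_monomial_def block_sign_def s fscale_def)
  qed
qed

lemma basis_power_module:
  "basis (power_module e r) = {i \<in> words r. sorted i \<and> (e \<or> distinct i)}"
  by (simp add: power_module_def sym_power_def ext_power_def)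

lemma monomial_basis:
  assumes "b \<in> basis (power_module e r :: ('k::field, nat list) based_module)"
  shows "monomial e b = (unit_fun b :: _ \<Rightarrow> 'k)"
proof -
  have b: "sorted b" "\<not> e \<Longrightarrow> distinct b" using assms by (auto simp: basis_power_module)
  have "{(i, j). i < j \<and> j < length b \<and> b ! i > b ! j} = {}"
  proof -
    have "\<not> b ! i > b ! j" if "i < j" "j < length b" for i j
      using sorted_nth_mono[OF b(1), of i j] that by simp
    then show ?thesis by blast
  qed
  then have "inversions b = 0" unfolding inversions_def by (simp only: card.empty)
  then show ?thesis using b by (simp add: monomial_def sym_monomial_def wedge_monomial_def sort_key_id_if_sorted)
qed

text \<open>Sorting reduces a word to a basis word up to sign. A word with a repeated letter is
  fixed by a transposition, so in the exterior case its value is its own negative and vanishes as 2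
  is invertible.\<close>

lemma power_normal_form:
  assumes two: "(2 :: 'k::field) \<noteq> 0" and w: "w \<in> words r"
  shows "\<exists>b\<in>basis (power_module e r :: ('k, nat list) based_module). \<exists>s. \<forall>G. alternates r e G \<longrightarrow> G w = s * (G b :: 'k)"
proof (cases "e \<or> distinct w")
  case True
  have sw: "sort w \<in> words r" using w by (simp add: words_def)
  have sb: "sort w \<in> basis (power_module e r :: ('k, nat list) based_module)"
    using True sw by (auto simp: basis_power_module)
  obtain \<sigma> where \<sigma>: "\<sigma> permutes {..<length (sort w)}" "permute_list \<sigma> (sort w) = w"
    using mset_eq_permutation[of w "sort w"] by auto
  have \<sigma>r: "\<sigma> permutes {..<r}" using \<sigma>(1) w by (simp add: words_def)
  show ?thesis
    using sb alternates_permute[OF _ \<sigma>r sw] \<sigma>(2) by metis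
next
  case False
  then obtain i j where ij: "i < length w" "j < length w" "i \<noteq> j" "w ! i = w ! j"
    by (auto simp: distinct_conv_nth)
  have l: "length w = r" using w by (simp add: words_def)
  have p: "swap i j permutes {..<length w}" using ij by (intro swap_permutes)
  have fixed: "permute_list (swap i j) w = w"
    using ij permute_list_nth[OF p] by (intro nth_equalityI) (auto simp: Transposition.transpose_def)
  \<comment> \<open>With the scalar 0 any basis word serves; this one has the required
    length.\<close>
  have "G w = 0 * G [1..<Suc r]" if "alternates r e G" for G :: "_ \<Rightarrow> 'k"
  proof -
    have sgn: "block_sign e = (- 1 :: 'k)" using False by (simp add: block_sign_def)
    have "G (permute_list (swap i j) w) = block_sign e * G w"
      using that[unfolded alternates_def, rule_format, OF w, of i j] ij l by simp
    then have "G w = - G w" unfolding fixed sgn by (simp only: mult_minus1)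
    then have "G w + G w = 0" by (simp only: eq_neg_iff_add_eq_0)
    then have "2 * G w = 0" by (simp only: mult_2)
    then show ?thesis using two by simp
  qed
  moreover have "[1..<Suc r] \<in> basis (power_module e r :: ('k, nat list) based_module)"
    by (auto simp: basis_power_module words_def simp del: upt_Suc)
  ultimately show ?thesis by blast
qed

lemma word_orbit_permute:
  assumes f: "f \<in> word_orbits t" and w: "w \<in> words r" and v: "(v, w) \<in> f" and \<sigma>: "\<sigma> permutes {..<r}"
  shows "(permute_list \<sigma> v, permute_list \<sigma> w) \<in> f"
  using orbit_of_permute[OF word_orbits_column(1)[OF f w v] w \<sigma>] word_orbits_column(2)[OF f w v]
    orbit_of_self by metis

text \<open>The action is given on basis words only. Both the images of words and the expected
  result are alternating in w, so the normal form reduces an arbitrary word by the same scalar on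
  both sides.\<close>

lemma represents_power:
  assumes two: "(2 :: 'k::field) \<noteq> 0"
  shows "represents r (power_module e r :: ('k, nat list) based_module) (monomial e)"
  unfolding represents_def
proof (intro conjI allI ballI)
  let ?B = "power_module e r :: ('k, nat list) based_module"
  fix w assume w: "w \<in> words r"
  have "(if e \<or> distinct w then {sort w} else {}) \<subseteq> basis ?B"
    using w by (auto simp: basis_power_module words_def)
  moreover have sup: "{x. monomial e w x \<noteq> (0 :: 'k)} \<subseteq> (if e \<or> distinct w then {sort w} else {})"
    by (auto simp: monomial_def sym_monomial_def wedge_monomial_def unit_fun_def fscale_def split: if_splits)
  ultimately show "{x. monomial e w x \<noteq> (0 :: 'k)} \<subseteq> basis ?B" by blast
  show fs: "fsupp (monomial e w :: _ \<Rightarrow> 'k)"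
    unfolding fsupp_def by (rule finite_subset[OF sup]) simp
  fix t f assume f: "f \<in> word_orbits t"
  define S :: "nat list \<Rightarrow> nat list \<Rightarrow> 'k" where "S w = (\<Sum>v | (v, w) \<in> f. monomial e v)" for w
  \<comment> \<open>The transposition is moved from w to v, since orbits are stable under
    simultaneous permutation of both words.\<close>
  have alt: "alternates r e (\<lambda>w. S w x)" for x
    unfolding alternates_def
  proof (intro ballI allI impI)
    fix u i j assume u: "u \<in> words r" and ij: "i < r" "j < r" "i \<noteq> j"
    let ?t = "swap i j"
    note p = swap_permutes[OF ij(1,2)]
    have tt: "permute_list ?t (permute_list ?t v) = v" if "v \<in> words r" for v
      using permute_list_compose[of ?t v ?t] p that by (simp add: words_def)
    have pu: "permute_list ?t u \<in> words r" by (rule permute_list_words[OF u p])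
    have "(\<Sum>v | (v, permute_list ?t u) \<in> f. monomial e v x) = (\<Sum>v | (v, u) \<in> f. (monomial e (permute_list ?t v) x :: 'k))"
    proof (rule sum.reindex_bij_witness[of _ "permute_list ?t" "permute_list ?t"])
      fix v assume "v \<in> {v. (v, permute_list ?t u) \<in> f}"
      then have v: "(v, permute_list ?t u) \<in> f" by simp
      note vr = word_orbits_column(1)[OF f pu v]
      show "permute_list ?t v \<in> {v. (v, u) \<in> f}" using word_orbit_permute[OF f pu v p] tt[OF u] by simp
      show "permute_list ?t (permute_list ?t v) = v" "monomial e (permute_list ?t (permute_list ?t v)) x = (monomial e v x :: 'k)"
        using tt[OF vr] by simp_all
    next
      fix v assume "v \<in> {v. (v, u) \<in> f}"
      then have v: "(v, u) \<in> f" by simp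
      show "permute_list ?t v \<in> {v. (v, permute_list ?t u) \<in> f}" using word_orbit_permute[OF f u v p] by simp
      show "permute_list ?t (permute_list ?t v) = v" using tt[OF word_orbits_column(1)[OF f u v]] .
    qed
    also have "\<dots> = (\<Sum>v | (v, u) \<in> f. block_sign e * monomial e v x)"
    proof (rule sum.cong)
      fix v assume "v \<in> {v. (v, u) \<in> f}"
      then have "v \<in> words r" using word_orbits_column(1)[OF f u] by simp
      then show "monomial e (permute_list ?t v) x = (block_sign e * monomial e v x :: 'k)"
        using monomial_alternates[of r e x] ij unfolding alternates_def by blast
    qed simp
    finally show "S (permute_list ?t u) x = block_sign e * S u x"
      by (simp add: S_def sum_fun_apply sum_distrib_left)
  qed
  have act: "basis_act ?B f b = S b" if b: "b \<in> basis ?B" for b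
  proof -
    have br: "b \<in> words r" using b by (auto simp: basis_power_module)
    have "basis_act ?B f b = linear_extension (monomial e) (basis_act (tensor_power r) f b)"
      by (simp add: power_module_def sym_power_def ext_power_def monomial_def)
    also have "basis_act (tensor_power r) f b = linear_extension (basis_act (tensor_power r) f) (unit_fun b :: _ \<Rightarrow> 'k)"
      by (simp add: linear_extension_unit)
    also have "\<dots> = (\<Sum>v | (v, b) \<in> f. unit_fun v)"
      by (rule representsD(4)[OF represents_tensor_power f br])
    also have "linear_extension (monomial e) (\<Sum>v | (v, b) \<in> f. unit_fun v) = S b"
      by (subst linear_extension_sum) (simp_all add: fsupp_def supp_unit_fun linear_extension_unit S_def)
    finally show ?thesis .
  qed
  obtain b s where b: "b \<in> basis ?B" and s: "\<And>G. alternates r e G \<Longrightarrow> G w = s * (G b :: 'k)"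
    using power_normal_form[OF two w] by blast
  have "monomial e w = fscale s (monomial e b :: _ \<Rightarrow> 'k)"
    using s[OF monomial_alternates] by (simp add: fun_eq_iff fscale_def)
  then have mw: "monomial e w = fscale s (unit_fun b :: _ \<Rightarrow> 'k)" using monomial_basis[OF b] by simp
  have "linear_extension (basis_act ?B f) (monomial e w) = fscale s (S b)"
    unfolding mw by (subst linear_extension_scale) (simp_all add: fsupp_def supp_unit_fun linear_extension_unit act[OF b])
  also have "\<dots> = S w" using s[OF alt] by (simp add: fun_eq_iff fscale_def)
  finally show "linear_extension (basis_act ?B f) (monomial e w) = (\<Sum>v | (v, w) \<in> f. monomial e v)"
    by (simp add: S_def)
next
  fix b assume b: "b \<in> basis (power_module e r :: ('k, nat list) based_module)"
  then have "b \<in> words r" by (simp add: basis_power_module)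
  then show "\<exists>w\<in>words r. monomial e w = (unit_fun b :: _ \<Rightarrow> 'k)" using monomial_basis[OF b] by blast
qed

section \<open>Mixed powers\<close>

fun block_tensor :: "(nat \<times> bool) list \<Rightarrow> nat list \<Rightarrow> (nat list list \<Rightarrow> 'k::field)" where
  "block_tensor [] w = unit_fun []"
| "block_tensor ((r, e) # es) w = pure_tensor (monomial e (take r w)) (block_tensor es (drop r w))"

definition tensor_of_powers :: "(nat \<times> bool) list \<Rightarrow> ('k::field, nat list list) based_module" where
  "tensor_of_powers es = tensor_list (map (\<lambda>(r, e). power_module e r) es)"

lemma tensor_of_powers_simps:
  "tensor_of_powers [] = unit_module"
  "tensor_of_powers ((r, e) # es) = tensor_module (power_module e r) (tensor_of_powers es)"
  by (simp_all add: tensor_of_powers_def tensor_list_def)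

definition degree_of :: "(nat \<times> bool) list \<Rightarrow> nat" where
  "degree_of es = sum_list (map fst es)"

lemma degree_of_simps [simp]: "degree_of [] = 0" "degree_of ((r, e) # es) = r + degree_of es"
  by (simp_all add: degree_of_def)

lemma represents_block_tensor:
  assumes two: "(2 :: 'k::field) \<noteq> 0"
  shows "represents (degree_of es) (tensor_of_powers es :: ('k, nat list list) based_module) (block_tensor es)"
proof (induction es)
  case Nil
  have "block_tensor [] = (\<lambda>w. unit_fun [] :: _ \<Rightarrow> 'k)" by (simp add: fun_eq_iff)
  then show ?case using represents_unit by (simp add: tensor_of_powers_simps)
next
  case (Cons a es)
  obtain r e where a: "a = (r, e)" by (cases a)
  have "block_tensor (a # es) = (\<lambda>w. pure_tensor (monomial e (take r w)) (block_tensor es (drop r w)) :: _ \<Rightarrow> 'k)"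
    by (simp add: a fun_eq_iff)
  then show ?case using represents_tensor[OF represents_power[OF two] Cons] by (simp add: a tensor_of_powers_simps)
qed

definition block_alternates :: "(nat \<times> bool) list \<Rightarrow> (nat list \<Rightarrow> 'k::field) \<Rightarrow> bool" where
  "block_alternates es G \<longleftrightarrow> (\<forall>w\<in>words (degree_of es). \<forall>i<degree_of es. \<forall>j<degree_of es.
     i \<noteq> j \<and> block_of (map fst es) i = block_of (map fst es) j \<longrightarrow>
     G (permute_list (swap i j) w) = block_sign (snd (es ! block_of (map fst es) i)) * G w)"

lemma permute_list_swap_append:
  "i < length u \<Longrightarrow> j < length u \<Longrightarrow> permute_list (swap i j) (u @ v) = permute_list (swap i j) u @ v"
  "i < length v \<Longrightarrow> j < length v \<Longrightarrow>
    permute_list (swap (length u + i) (length u + j)) (u @ v) = u @ permute_list (swap i j) v"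
  by (auto intro!: nth_equalityI simp: permute_list_def nth_append Transposition.transpose_def)

lemma words_append: "u \<in> words r \<Longrightarrow> v \<in> words s \<Longrightarrow> u @ v \<in> words (r + s)"
  by (auto simp: words_def)

lemma words_appendE:
  assumes "w \<in> words (r + s)"
  obtains u v where "w = u @ v" "u \<in> words r" "v \<in> words s"
  using assms words_append_iff[of w r s] that[of "take r w" "drop r w"] by simp

lemma block_tensor_alternates: "block_alternates es (\<lambda>w. block_tensor es w x :: 'k::field)"
proof (induction es arbitrary: x)
  case (Cons a es)
  obtain r e where a: "a = (r, e)" by (cases a)
  show ?case
    unfolding block_alternates_def
  proof (intro ballI allI impI)
    fix w i j assume w: "w \<in> words (degree_of (a # es))" and ij: "i < degree_of (a # es)" "j < degree_of (a # es)"
      "i \<noteq> j \<and> block_of (map fst (a # es)) i = block_of (map fst (a # es)) j"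
    obtain u v where uv: "w = u @ v" "u \<in> words r" "v \<in> words (degree_of es)"
    proof -
      have "w \<in> words (r + degree_of es)" using w by (simp add: a)
      from words_appendE[OF this] show thesis using that .
    qed
    have l: "length u = r" "length v = degree_of es" using uv by (auto simp: words_def)
    have bt: "(block_tensor (a # es) (u' @ v') x :: 'k) = (case x of [] \<Rightarrow> 0 | y # ys \<Rightarrow> monomial e u' y * block_tensor es v' ys)"
      if "length u' = r" for u' v'
      using that by (simp add: a pure_tensor_def)
    show "(block_tensor (a # es) (permute_list (swap i j) w) x :: 'k) =
      block_sign (snd ((a # es) ! block_of (map fst (a # es)) i)) * block_tensor (a # es) w x"
    proof (cases "i < r")
      case True
      then have j: "j < r" using ij(3) by (auto simp: a split: if_splits)
      have "monomial e (permute_list (swap i j) u) y = (block_sign e * monomial e u y :: 'k)" for y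
        using monomial_alternates[of r e y] uv(2) True j ij(3) unfolding alternates_def by blast
      then show ?thesis
        unfolding uv(1) using permute_list_swap_append(1)[of i u j v] True j l
        by (simp add: bt del: block_tensor.simps split: list.splits) (simp add: a)
    next
      case False
      then have j: "\<not> j < r" using ij(3) by (auto simp: a split: if_splits)
      have ij': "i - r < degree_of es" "j - r < degree_of es" "i - r \<noteq> j - r"
        "block_of (map fst es) (i - r) = block_of (map fst es) (j - r)"
        using False j ij by (auto simp: a)
      have p: "permute_list (swap i j) (u @ v) = u @ permute_list (swap (i - r) (j - r)) v"
        using permute_list_swap_append(2)[of "i - r" v "j - r" u] ij' l False j by simp
      have "block_tensor es (permute_list (swap (i - r) (j - r)) v) ys =
          (block_sign (snd (es ! block_of (map fst es) (i - r))) * block_tensor es v ys :: 'k)" for ys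
        by (rule Cons[of ys, unfolded block_alternates_def, rule_format, OF uv(3) ij'(1,2) conjI[OF ij'(3,4)]])
      then show ?thesis
        unfolding uv(1) p using False l
        by (simp add: bt del: block_tensor.simps split: list.splits) (simp add: a)
    qed
  qed
qed (simp add: block_alternates_def)

text \<open>A basis element is a list of normal words, one for each factor; concatenating them gives
  a word that maps to it. These words serve as the normal forms for mixed powers.\<close>

lemma block_tensor_concat:
  assumes "z \<in> basis (tensor_of_powers es :: ('k::field, nat list list) based_module)"
  shows "concat z \<in> words (degree_of es)" "block_tensor es (concat z) = (unit_fun z :: _ \<Rightarrow> 'k)"
proof -
  have "concat z \<in> words (degree_of es) \<and> block_tensor es (concat z) = (unit_fun z :: _ \<Rightarrow> 'k)"
    using assms
  proof (induction es arbitrary: z)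
    case Nil
    then show ?case by (simp add: tensor_of_powers_simps unit_module_def words_def)
  next
    case (Cons a es)
    obtain r e where a: "a = (r, e)" by (cases a)
    obtain y ys where z: "z = y # ys" "y \<in> basis (power_module e r :: ('k, nat list) based_module)"
      "ys \<in> basis (tensor_of_powers es :: ('k, nat list list) based_module)"
      using Cons(2) by (auto simp: a tensor_of_powers_simps tensor_module_def)
    have y: "y \<in> words r" using z(2) by (simp add: basis_power_module)
    then have l: "length y = r" by (simp add: words_def)
    show ?case
      using Cons(1)[OF z(3)] words_append[OF y] monomial_basis[OF z(2)] l by (simp add: a z(1) pure_tensor_unit)
  qed
  then show "concat z \<in> words (degree_of es)" "block_tensor es (concat z) = (unit_fun z :: _ \<Rightarrow> 'k)" by blast+
qed

text \<open>With the other letters held fixed, a compatible function is alternating in the letters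
  of one block, so the normal forms of the single blocks can be applied in turn and their scalars
  multiply.\<close>

lemma block_normal_form:
  assumes two: "(2 :: 'k::field) \<noteq> 0"
  shows "w \<in> words (degree_of es) \<Longrightarrow> \<exists>z\<in>basis (tensor_of_powers es :: ('k, nat list list) based_module). \<exists>s.
    \<forall>G. block_alternates es G \<longrightarrow> G w = s * (G (concat z) :: 'k)"
proof (induction es arbitrary: w)
  case Nil
  then show ?case
    by (intro bexI[of _ "[]"] exI[of _ 1]) (auto simp: tensor_of_powers_simps unit_module_def words_def)
next
  case (Cons a es)
  obtain r e where a: "a = (r, e)" by (cases a)
  obtain u v where uv: "w = u @ v" "u \<in> words r" "v \<in> words (degree_of es)"
  proof -
    have "w \<in> words (r + degree_of es)" using Cons(2) by (simp add: a)
    from words_appendE[OF this] show thesis using that .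
  qed
  obtain b s where b: "b \<in> basis (power_module e r :: ('k, nat list) based_module)"
    and s: "\<And>G. alternates r e G \<Longrightarrow> G u = s * (G b :: 'k)"
    using power_normal_form[OF two uv(2)] by blast
  obtain z s' where z: "z \<in> basis (tensor_of_powers es :: ('k, nat list list) based_module)"
    and s': "\<And>G. block_alternates es G \<Longrightarrow> G v = s' * (G (concat z) :: 'k)"
    using Cons(1)[OF uv(3)] by blast
  have bw: "b \<in> words r" using b by (simp add: basis_power_module)
  have "G w = (s * s') * G (concat (b # z))" if G: "block_alternates (a # es) G" for G :: "nat list \<Rightarrow> 'k"
  proof -
    have "alternates r e (\<lambda>u. G (u @ v))"
      unfolding alternates_def
    proof (intro ballI allI impI)
      fix u i j assume u: "u \<in> words r" and ij: "i < r" "j < r" "i \<noteq> j"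
      have uw: "u @ v \<in> words (degree_of (a # es))" using words_append[OF u uv(3)] by (simp add: a)
      have "permute_list (swap i j) (u @ v) = permute_list (swap i j) u @ v"
        using u ij by (intro permute_list_swap_append) (auto simp: words_def)
      then show "G (permute_list (swap i j) u @ v) = block_sign e * G (u @ v)"
        using G[unfolded block_alternates_def, rule_format, OF uw, of i j] ij by (simp add: a)
    qed
    from s[OF this] have 1: "G w = s * G (b @ v)" by (simp add: uv(1))
    have "block_alternates es (\<lambda>v. G (b @ v))"
      unfolding block_alternates_def
    proof (intro ballI allI impI)
      fix v i j assume v: "v \<in> words (degree_of es)" and ij: "i < degree_of es" "j < degree_of es"
        "i \<noteq> j \<and> block_of (map fst es) i = block_of (map fst es) j"
      have bv: "b @ v \<in> words (degree_of (a # es))" using words_append[OF bw v] by (simp add: a)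
      have p: "permute_list (swap (r + i) (r + j)) (b @ v) = b @ permute_list (swap i j) v"
        using permute_list_swap_append(2)[of i v j b] v ij bw by (simp add: words_def)
      have "G (permute_list (swap (r + i) (r + j)) (b @ v)) =
          block_sign (snd ((a # es) ! block_of (map fst (a # es)) (r + i))) * G (b @ v)"
        using G[unfolded block_alternates_def, rule_format, OF bv, of "r + i" "r + j"] ij by (simp add: a)
      then show "G (b @ permute_list (swap i j) v) = block_sign (snd (es ! block_of (map fst es) i)) * G (b @ v)"
        unfolding p by (simp add: a)
    qed
    from s'[OF this] show ?thesis using 1 by (simp add: mult.assoc)
  qed
  moreover have "b # z \<in> basis (tensor_of_powers (a # es) :: ('k, nat list list) based_module)"
    using b z by (simp add: a tensor_of_powers_simps tensor_module_def)
  ultimately show ?case by blast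
qed

section \<open>Mixed powers as modules over the algebra\<close>

lemma mixed_power_eq:
  "mixed_power \<alpha> \<beta> = (module_of_based (tensor_of_powers (map (\<lambda>r. (r, True)) \<alpha> @ map (\<lambda>r. (r, False)) \<beta>)) :: ('k::field, _, _) kmodule)"
proof -
  have "map (\<lambda>(r, e). power_module e r) (map (\<lambda>r. (r, True)) \<alpha> @ map (\<lambda>r. (r, False)) \<beta>) =
      map sym_power \<alpha> @ (map ext_power \<beta> :: ('k, nat list) based_module list)"
    by (simp add: power_module_def comp_def)
  then show ?thesis unfolding mixed_power_def tensor_of_powers_def by (simp only:)
qed

lemma module_of_based_act:
  "mod_act (module_of_based B) a u = (\<Sum>f | a f \<noteq> 0. fscale (a f) (linear_extension (basis_act B f) u))"
  by (simp add: module_of_based_def linear_extension_def)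

text \<open>Every basis vector is the image of a word. So the images of the words span the carrier,
  and the action of an orbit on a basis vector is a sum of such images.\<close>

lemma module_of_based_linear:
  fixes B :: "('k::field, 'x) based_module"
  assumes B: "represents r B Q"
  shows "linear_action (schur_algebra n) (module_of_based B)"
    and "mod_carrier (module_of_based B) = fun_space.span (Q ` words r)"
proof -
  let ?M = "module_of_based B"
  have carr: "mod_carrier ?M = {v. fsupp v \<and> {x. v x \<noteq> 0} \<subseteq> basis B}"
    by (simp add: module_of_based_def fsupp_def)
  have sub: "fun_space.subspace (mod_carrier ?M)"
  proof (rule fun_space.subspaceI)
    show "0 \<in> mod_carrier ?M" by (simp add: carr fsupp_def)
    fix u v assume "u \<in> mod_carrier ?M" "v \<in> mod_carrier ?M"
    then have uv: "fsupp u" "{x. u x \<noteq> 0} \<subseteq> basis B" "fsupp v" "{x. v x \<noteq> 0} \<subseteq> basis B" by (auto simp: carr)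
    have "{x. (u + v) x \<noteq> 0} \<subseteq> {x. u x \<noteq> 0} \<union> {x. v x \<noteq> 0}" by auto
    then show "u + v \<in> mod_carrier ?M"
      using uv finite_subset[of "{x. (u + v) x \<noteq> 0}" "{x. u x \<noteq> 0} \<union> {x. v x \<noteq> 0}"]
      unfolding carr fsupp_def by blast
  next
    fix c u assume "u \<in> mod_carrier ?M"
    moreover have "{x. fscale c u x \<noteq> 0} \<subseteq> {x. u x \<noteq> 0}" by (auto simp: fscale_def)
    ultimately show "fscale c u \<in> mod_carrier ?M"
      using finite_subset[of "{x. fscale c u x \<noteq> 0}" "{x. u x \<noteq> 0}"] unfolding carr fsupp_def by blast
  qed
  have Qin: "Q w \<in> mod_carrier ?M" if "w \<in> words r" for w
    using representsD(1,2)[OF B that] by (auto simp: carr)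
  show span: "mod_carrier ?M = fun_space.span (Q ` words r)"
  proof (intro equalityI subsetI)
    fix u assume u: "u \<in> mod_carrier ?M"
    have fu: "finite {x. u x \<noteq> 0}" using u by (simp add: carr fsupp_def)
    have "u = (\<Sum>x | u x \<noteq> 0. fscale (u x) (unit_fun x))"
    proof
      fix y
      have "(\<Sum>x | u x \<noteq> 0. fscale (u x) (unit_fun x)) y = (\<Sum>x | u x \<noteq> 0. if x = y then u x else 0)"
        unfolding sum_fun_apply by (intro sum.cong) (auto simp: fscale_def unit_fun_def)
      then show "u y = (\<Sum>x | u x \<noteq> 0. fscale (u x) (unit_fun x)) y" using fu by simp
    qed
    also have "\<dots> \<in> fun_space.span (Q ` words r)"
    proof (intro fun_space.span_sum fun_space.span_scale fun_space.span_base)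
      fix x assume "x \<in> {x. u x \<noteq> 0}"
      then have "x \<in> basis B" using u by (auto simp: carr)
      then obtain w where "w \<in> words r" "Q w = unit_fun x" using representsD(3)[OF B] by blast
      then show "unit_fun x \<in> Q ` words r" by (metis imageI)
    qed
    finally show "u \<in> fun_space.span (Q ` words r)" .
  next
    fix u assume "u \<in> fun_space.span (Q ` words r)"
    then show "u \<in> mod_carrier ?M" using fun_space.span_minimal[OF _ sub] Qin by blast
  qed
  note act = module_of_based_act[of B]
  have actf: "linear_extension (basis_act B f) u \<in> mod_carrier ?M"
    if f: "f \<in> word_orbits n" and u: "u \<in> mod_carrier ?M" for f u
    unfolding linear_extension_def
  proof (intro fun_space.subspace_sum[OF sub] fun_space.subspace_scale[OF sub])
    fix x assume "x \<in> {x. u x \<noteq> 0}"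
    then have "x \<in> basis B" using u by (auto simp: carr)
    then obtain w where w: "w \<in> words r" "Q w = unit_fun x" using representsD(3)[OF B] by blast
    have "basis_act B f x = (\<Sum>v | (v, w) \<in> f. Q v)"
      using representsD(4)[OF B f w(1)] w(2) by (simp add: linear_extension_unit)
    also have "\<dots> \<in> mod_carrier ?M"
      using word_orbits_column(1)[OF f w(1)] Qin by (intro fun_space.subspace_sum[OF sub]) auto
    finally show "basis_act B f x \<in> mod_carrier ?M" .
  qed
  show "linear_action (schur_algebra n) ?M"
    unfolding linear_action_def
  proof (intro conjI ballI allI sub)
    fix a :: "word_orbit \<Rightarrow> 'k" and u c assume a: "a \<in> schur_algebra n" and u: "u \<in> mod_carrier ?M"
    show "mod_act ?M a u \<in> mod_carrier ?M"
      unfolding act using a actf u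
      by (intro fun_space.subspace_sum[OF sub] fun_space.subspace_scale[OF sub]) (auto simp: schur_algebra_def)
    have fu: "fsupp u" using u by (simp add: carr)
    show "mod_act ?M a (u + v) = mod_act ?M a u + mod_act ?M a v" if "v \<in> mod_carrier ?M" for v
    proof -
      have "fsupp v" using that by (simp add: carr)
      then show ?thesis
        by (simp add: act linear_extension_add[OF fu] fun_space.scale_right_distrib sum.distrib)
    qed
    show "mod_act ?M a (fscale c u) = fscale c (mod_act ?M a u)"
      by (simp add: act linear_extension_scale[OF fu] fun_space.scale_sum_right mult.commute)
  qed
qed

lemma presents_mixed_power:
  fixes \<alpha> \<beta> :: "nat list"
  assumes two: "(2 :: 'k::field) \<noteq> 0" and n: "sum_list \<alpha> + sum_list \<beta> = n"
  shows "\<exists>q. signed_words.presents (schur_algebra n) (words n) {..<n} permute_word orbit_matrix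
     (word_colour \<alpha> \<beta>) (mixed_power \<alpha> \<beta> :: ('k, _, _) kmodule) q"
proof -
  interpret S: signed_words "schur_algebra n" "words n" "{..<n}" permute_word "orbit_matrix :: _ \<Rightarrow> _ \<Rightarrow> _ \<Rightarrow> 'k"
    by (rule signed_words_schur)
  let ?es = "map (\<lambda>r. (r, True)) \<alpha> @ map (\<lambda>r. (r, False)) \<beta>"
  let ?B = "tensor_of_powers ?es :: ('k, nat list list) based_module"
  let ?q = "block_tensor ?es :: nat list \<Rightarrow> nat list list \<Rightarrow> 'k"
  let ?M = "mixed_power \<alpha> \<beta> :: ('k, _, _) kmodule"
  have fst_es: "map fst ?es = \<alpha> @ \<beta>" by (simp add: comp_def)
  have deg: "degree_of ?es = n" unfolding degree_of_def fst_es using n by simp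
  have rep: "represents n ?B ?q" using represents_block_tensor[OF two, of ?es] deg by simp
  have sgn: "block_sign (snd (?es ! block_of (\<alpha> @ \<beta>) i)) = (colour_sign (word_colour \<alpha> \<beta> i) :: 'k)" if "i < n" for i
  proof -
    have "block_of (\<alpha> @ \<beta>) i < length \<alpha> + length \<beta>" using block_of_less[of i "\<alpha> @ \<beta>"] that n by simp
    then show ?thesis
      by (auto simp: word_colour_def Let_def nth_append block_sign_def)
  qed
  \<comment> \<open>The bridge between the two languages: equal colour means equal block, and the
    sign of the colour is the sign of the block.\<close>
  have comp: "S.compatible (word_colour \<alpha> \<beta>) G \<longleftrightarrow> block_alternates ?es G" for G
  proof -
    have "S.compatible (word_colour \<alpha> \<beta>) G \<longleftrightarrow> (\<forall>w\<in>words n. \<forall>i<n. \<forall>j<n.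
        i \<noteq> j \<and> block_of (\<alpha> @ \<beta>) i = block_of (\<alpha> @ \<beta>) j \<longrightarrow>
        G (permute_list (swap i j) w) = colour_sign (word_colour \<alpha> \<beta> i) * G w)"
      unfolding S.compatible_def word_colour_eq_iff by (simp only: Ball_def lessThan_iff)
    also have "\<dots> \<longleftrightarrow> block_alternates ?es G"
      unfolding block_alternates_def deg fst_es
      by (rule ball_cong[OF refl], rule all_cong1, rule imp_cong[OF refl], rule all_cong1,
          rule imp_cong[OF refl], rule imp_cong[OF refl], subst sgn, assumption, rule refl)
    finally show ?thesis .
  qed
  show ?thesis
  proof (intro exI[of _ ?q], unfold S.presents_def mixed_power_eq, intro conjI allI ballI)
    show "linear_action (schur_algebra n) (module_of_based ?B)" by (rule module_of_based_linear(1)[OF rep])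
    show "mod_carrier (module_of_based ?B) = fun_space.span (?q ` words n)" by (rule module_of_based_linear(2)[OF rep])
    show "S.compatible (word_colour \<alpha> \<beta>) (\<lambda>w. ?q w x)" for x unfolding comp by (rule block_tensor_alternates)
    let ?C = "concat ` basis ?B"
    note bc = block_tensor_concat[where es = ?es and 'k = 'k, unfolded deg]
    have unit_inj: "z = z'" if "unit_fun z = (unit_fun z' :: nat list list \<Rightarrow> 'k)" for z z'
      using that by (metis unit_fun_def zero_neq_one)
    have inj: "inj_on ?q ?C" using bc(2) unit_inj by (auto simp: inj_on_def)
    have qC: "?q ` ?C = unit_fun ` basis ?B" using bc(2) by (force simp: image_iff)
    have ind: "fun_space.independent (?q ` ?C)"
      unfolding qC fun_space.independent_explicit_module
    proof (intro allI impI)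
      fix t :: "(nat list list \<Rightarrow> 'k) set" and u v assume t: "finite t" "t \<subseteq> unit_fun ` basis ?B" "(\<Sum>v\<in>t. fscale (u v) v) = 0" "v \<in> t"
      obtain z where z: "v = unit_fun z" using t(2,4) by blast
      have e: "x z = (if x = v then 1 else 0)" if x: "x \<in> t" for x
      proof -
        obtain y where y: "x = unit_fun y" using x t(2) by blast
        show ?thesis
        proof (cases "y = z")
          case True
          then show ?thesis by (simp add: y z unit_fun_def)
        next
          case False
          have "x \<noteq> v"
          proof
            assume "x = v"
            then have "unit_fun y = (unit_fun z :: nat list list \<Rightarrow> 'k)" unfolding y z .
            from unit_inj[OF this] False show False by contradiction
          qed
          moreover have "x z = 0" using False by (simp add: y unit_fun_def)
          ultimately show ?thesis by simp
        qed
      qed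
      have "(\<Sum>x\<in>t. fscale (u x) x) z = (\<Sum>x\<in>t. if x = v then u x else 0)"
        unfolding sum_fun_apply by (rule sum.cong[OF refl]) (simp add: fscale_def e)
      then show "u v = 0" using t by simp
    qed
    show "\<exists>B\<subseteq>words n. inj_on ?q B \<and> fun_space.independent (?q ` B) \<and>
        (\<forall>w\<in>words n. \<exists>b\<in>B. \<exists>s. \<forall>G. S.compatible (word_colour \<alpha> \<beta>) G \<longrightarrow> G w = s * G b)"
    proof (intro exI[of _ ?C] conjI inj ind ballI)
      show "?C \<subseteq> words n" using bc(1) by blast
      fix w assume "w \<in> words n"
      then show "\<exists>b\<in>?C. \<exists>s. \<forall>G. S.compatible (word_colour \<alpha> \<beta>) G \<longrightarrow> G w = s * G b"
        unfolding comp using block_normal_form[OF two, of w ?es] deg by auto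
    qed
    fix a :: "word_orbit \<Rightarrow> 'k" and w assume a: "a \<in> schur_algebra n" and w: "w \<in> words n"
    have fa: "finite {f. a f \<noteq> 0}" "{f. a f \<noteq> 0} \<subseteq> word_orbits n" using a by (auto simp: schur_algebra_def)
    have "mod_act (module_of_based ?B) a (?q w) = (\<Sum>f | a f \<noteq> 0. fscale (a f) (\<Sum>v | (v, w) \<in> f. ?q v))"
      unfolding module_of_based_act
    proof (rule sum.cong[OF refl])
      fix f assume "f \<in> {f. a f \<noteq> 0}"
      then have "f \<in> word_orbits n" using fa(2) by blast
      from representsD(4)[OF rep this w]
      show "fscale (a f) (linear_extension (basis_act ?B f) (?q w)) = fscale (a f) (\<Sum>v | (v, w) \<in> f. ?q v)"
        by (rule arg_cong)
    qed
    also have "\<dots> = (\<Sum>f | a f \<noteq> 0. \<Sum>v | (v, w) \<in> f. fscale (a f) (?q v))"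
      by (simp add: fun_space.scale_sum_right)
    also have "\<dots> = (\<Sum>(f, v)\<in>Sigma {f. a f \<noteq> 0} (\<lambda>f. {v. (v, w) \<in> f}). fscale (a f) (?q v))"
      using fa finite_orbit_column[of _ n w] by (intro sum.Sigma) auto
    \<comment> \<open>Each v lies in the column of w for exactly one orbit, so the pairs (f, v) are
      indexed by v alone.\<close>
    also have "\<dots> = (\<Sum>v | v \<in> words n \<and> orbit_matrix a v w \<noteq> 0. fscale (orbit_matrix a v w) (?q v))"
    proof (rule sum.reindex_bij_witness[of _ "\<lambda>v. (orbit_of v w, v)" snd])
      fix x assume "x \<in> Sigma {f. a f \<noteq> 0} (\<lambda>f. {v. (v, w) \<in> f})"
      then obtain f v where x: "x = (f, v)" "a f \<noteq> 0" "(v, w) \<in> f" by blast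
      have f: "f \<in> word_orbits n" using fa(2) x(2) by blast
      note c = word_orbits_column(1,2)[OF f w x(3)]
      show "(orbit_of (snd x) w, snd x) = x" using c x by simp
      show "snd x \<in> {v. v \<in> words n \<and> orbit_matrix a v w \<noteq> 0}" using c x by (simp add: orbit_matrix_def)
      show "fscale (orbit_matrix a (snd x) w) (?q (snd x)) = (case x of (f, v) \<Rightarrow> fscale (a f) (?q v))"
        using c x by (simp add: orbit_matrix_def)
    next
      fix v assume "v \<in> {v. v \<in> words n \<and> orbit_matrix a v w \<noteq> 0}"
      then show "(orbit_of v w, v) \<in> Sigma {f. a f \<noteq> 0} (\<lambda>f. {v. (v, w) \<in> f})"
        using orbit_of_self by (simp add: orbit_matrix_def)
    qed simp
    finally show "mod_act (module_of_based ?B) a (?q w) =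
      (\<Sum>v | v \<in> words n \<and> orbit_matrix a v w \<noteq> 0. fscale (orbit_matrix a v w) (?q v))" .
  qed
qed

lemma signed_family_schur:
  assumes two: "(2 :: 'k::field) \<noteq> 0"
  shows "signed_family (schur_algebra n) (words n) {..<n} permute_word (orbit_matrix :: _ \<Rightarrow> _ \<Rightarrow> _ \<Rightarrow> 'k)
     (mixed_power :: _ \<Rightarrow> _ \<Rightarrow> ('k, _, _) kmodule) n"
proof (rule signed_family.intro[OF signed_words_schur], unfold_locales)
  interpret signed_words "schur_algebra n" "words n" "{..<n}" permute_word "orbit_matrix :: _ \<Rightarrow> _ \<Rightarrow> _ \<Rightarrow> 'k"
    by (rule signed_words_schur)
  fix \<alpha> \<beta> assume n: "sum_list \<alpha> + sum_list \<beta> = n"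
  have "card {y \<in> {..<n}. word_colour \<alpha> \<beta> y = x} = colour_count \<alpha> \<beta> x" for x
    using card_word_colour[of \<alpha> \<beta> x] n by simp
  then show "\<exists>c q. presents c (mixed_power \<alpha> \<beta> :: ('k, _, _) kmodule) q \<and>
      (\<forall>x. card {y \<in> {..<n}. c y = x} = colour_count \<alpha> \<beta> x)"
    using presents_mixed_power[OF two n] by blast
qed

theorem corollary4p8:
  fixes p n r :: nat
    and \<alpha> \<beta> \<eta> \<rho> la mu :: "nat list"
    and Y :: "nat list \<times> nat list \<Rightarrow> ('k::field, nat \<Rightarrow> nat, 'y) kmodule"
    and L :: "nat list \<times> nat list \<Rightarrow> ('k, word_orbit \<Rightarrow> 'k, 'l) kmodule"
  assumes char: "CHAR('k) = p" "odd p"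
    and Y: "signed_young_modules p Y"
    and L: "listing_modules p L"
    and "composition \<alpha>" "composition \<beta>" "sum_list \<alpha> + sum_list \<beta> = n"
    and "length \<eta> = length \<beta>" "length \<rho> = length \<beta>"
    and "\<And>i. i < length \<beta> \<Longrightarrow> \<beta> ! i = p * \<eta> ! i + \<rho> ! i \<and> \<rho> ! i \<le> p - 1"
    and "r = (\<Sum>i<length \<beta>. \<rho> ! i)"
    and "is_partition la" "mset la = mset (\<alpha> @ replicate r 1)"
    and "is_partition mu" "mset mu = mset (filter (\<lambda>x. x \<noteq> 0) \<eta>)"
  shows
    "(has_summand (carrier (sym_group n)) (signed_perm_module \<alpha> \<beta>) (Y (la, mu)) \<and>
     multiplicity_in (carrier (sym_group n)) (signed_perm_module \<alpha> \<beta>) (Y (la, mu)) = 1 \<and>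
     (\<forall>(de, th)\<in>partition_pairs p n.
        has_summand (carrier (sym_group n)) (signed_perm_module \<alpha> \<beta>) (Y (de, th)) \<longrightarrow>
        dominates p (de, th) (la, mu))) \<and>
     (has_summand (schur_algebra n) (mixed_power \<alpha> \<beta>) (L (la, mu)) \<and>
     multiplicity_in (schur_algebra n) (mixed_power \<alpha> \<beta>) (L (la, mu)) = 1 \<and>
     (\<forall>(de, th)\<in>partition_pairs p n.
        has_summand (schur_algebra n) (mixed_power \<alpha> \<beta>) (L (de, th)) \<longrightarrow>
        dominates p (de, th) (la, mu)))"
proof -
  have p0: "p > 0" using char(2) by (rule odd_pos)
  \<comment> \<open>Otherwise the odd number p would divide 2 and be 1, which is not a
    characteristic of a field.\<close>
  have two: "(2 :: 'k) \<noteq> 0"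
  proof
    assume "(2 :: 'k) = 0"
    then have "of_nat 2 = (0 :: 'k)" by simp
    then have "p dvd 2" using char(1) of_nat_eq_0_iff_char_dvd[where 'a = 'k] by metis
    then have "p = 1" using char(2) by (metis dvd_refl prime_nat_iff two_is_prime_nat)
    then show False using char(1) CHAR_not_1[where 'a = 'k] by simp
  qed
  \<comment> \<open>Quotient and remainder are unique, so the given \<eta> and \<rho> are those of
    \<open>div\<close> and \<open>mod\<close>, as \<open>label_of\<close> uses them.\<close>
  have \<eta>: "\<eta> = map (\<lambda>b. b div p) \<beta>"
  proof (rule nth_equalityI)
    fix i assume "i < length \<eta>"
    then have i: "i < length \<beta>" using assms(8) by simp
    have "\<beta> ! i div p = \<eta> ! i" using assms(10)[OF i] p0 by (auto simp: div_mult_self4)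
    then show "\<eta> ! i = map (\<lambda>b. b div p) \<beta> ! i" using i by simp
  qed (use assms(8) in simp)
  have \<rho>: "\<rho> = map (\<lambda>b. b mod p) \<beta>"
  proof (rule nth_equalityI)
    fix i assume "i < length \<rho>"
    then have i: "i < length \<beta>" using assms(9) by simp
    have "\<beta> ! i mod p = \<rho> ! i" using assms(10)[OF i] p0 by auto
    then show "\<rho> ! i = map (\<lambda>b. b mod p) \<beta> ! i" using i by simp
  qed (use assms(9) in simp)
  have "r = sum_list \<rho>" using assms(9,11) by (simp add: sum_list_sum_nth atLeast0LessThan)
  then have l: "label_of p \<alpha> \<beta> la mu"
    unfolding label_of_def using assms(12-15) \<eta> \<rho> by simp
  have Y1: "labels_summands p n (carrier (sym_group n)) signed_perm_module Y"
    and Y2: "linear_action (carrier (sym_group n)) (Y x)" if "x \<in> partition_pairs p n" for x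
    using Y that unfolding signed_young_modules_def group_module_def by blast+
  have L1: "labels_summands p n (schur_algebra n) mixed_power L"
    and L2: "linear_action (schur_algebra n) (L x)" if "x \<in> partition_pairs p n" for x
    using L that unfolding listing_modules_def schur_module_def by blast+
  have x: "(la, mu) \<in> partition_pairs p n" using label_of_partition_pairs[OF l] assms(7) by simp
  show ?thesis
    by (rule conjI[OF
        signed_family.family_theorem[OF signed_family_sym_group char(1) p0 Y1[OF x] Y2 assms(5,7) l]
        signed_family.family_theorem[OF signed_family_schur[OF two] char(1) p0 L1[OF x] L2 assms(5,7) l]])
qed

end
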